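(* Let $(S,0)$ be an irreducible germ of quasi-ordinary hypersurface given with a normalized quasi-ordinary projection $\pi$, and let $\underline\nu=(\nu_1,\dots,\nu_r)$ be a sequence of monomial valuations of the ring $R=\mathcal O_S$, corresponding to a sequence $\underline v=(v_1,\dots,v_r)$ of non-zero vectors of $\sigma\cap N$, with at least one, say $\nu_1$, centered at the maximal ideal of $R$. Then this sequence of valuations induces a multi-graded ring $\mathrm{gr}_{\underline\nu}R$ together with a sequence of valuations $\underline{\bar\nu}=(\bar\nu_1,\dots,\bar\nu_r)$ on it, and there exists an isomorphism of graded rings $$\psi:\mathrm{gr}_{\underline\nu}R\to\mathbf C[\Gamma_\pi]^{(\underline v)}$$ such that $\nu_i\circ\psi=\bar\nu_i$ for $i=1,\dots,r$.
   Context: **Quasi-ordinary hypersurfaces.** A germ of algebroid hypersurface $(S,0)\subset(\mathbf C^{d+1},0)$ is quasi-ordinary if there is a finite morphism $\pi:(S,0)\to(\mathbf C^d,0)$ (quasi-ordinary projection) whose discriminant locus is contained in a normal crossing divisor. In suitable coordinates $S$ is $f=0$ with $f\in\mathbf C[[x_1,\dots,x_d]][y]$ a Weierstrass polynomial of degree $n$ (irreducible, since $S$ is) whose discriminant in $y$ is a monomial times a unit. Its roots lie in $\mathbf C[[x_1^{1/n},\dots,x_d^{1/n}]]$; the difference of two distinct roots is a monomial times a unit, and the exponents so obtained are the characteristic exponents $\lambda_1<\dots<\lambda_g$ in $\mathbf Q^d$ ($<$: $\le$ coordinate-wise and $\ne$), $\lambda_j=(\lambda_j^1,\dots,\lambda_j^d)$.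 The projection is normalized if $(\lambda_1^1,\dots,\lambda_g^1)\ge_{\rm lex}\cdots\ge_{\rm lex}(\lambda_1^d,\dots,\lambda_g^d)$ and, if $\lambda_1=(\lambda_1^1,0,\dots,0)$, then $\lambda_1^1>1$. Let $M_0=\mathbf Z^d$ with canonical basis $e_1,\dots,e_d$, $M_j=M_{j-1}+\mathbf Z\lambda_j$, $M=M_g$, $n_j=[M_j:M_{j-1}]$; $N$ is the dual lattice of $M$, $\sigma\subset N_{\mathbf R}$ the cone spanned by the dual basis of $e_1,\dots,e_d$. Put $\gamma_1=\lambda_1$, $\gamma_{j+1}-n_j\gamma_j=\lambda_{j+1}-\lambda_j$, and $\Gamma_\pi=\mathbf Z^d_{\ge0}+\gamma_1\mathbf Z_{\ge0}+\cdots+\gamma_g\mathbf Z_{\ge0}$. For a root $\zeta$ of $f$, $\mathcal O_S=\mathbf C[[x]][\zeta]\subset\mathbf C[[\sigma^\vee\cap M]]$ ($x_i=X^{e_i}$) is the inclusion in the integral closure. A non-zero $v\in\sigma\cap N$ defines a monomial valuation $\nu(\sum c_uX^u)=\min_{c_u\ne0}\langle v,u\rangle$ of $\mathbf C[[\sigma^\vee\cap M]]$ and, by restriction, of $\mathcal O_S$; it is centered at the maximal ideal of $\mathcal O_S$ iff $v\in\stackrel{\circ}{\sigma}$. The same formula defines $\nu_i$ on $\mathbf C[\Gamma_\pi]$. **Gradings.** $\mathbf C[\Gamma_\pi]^{(\underline v)}$ is $\mathbf C[\Gamma_\pi]$ with the $\mathbf Z^r_{\ge0}$-grading with components $H(\underline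 a)=\bigoplus_{u\in\Gamma_\pi,\ \langle v_j,u\rangle=a_j,\ j=1,\dots,r}\mathbf CX^u$. **Graded ring of a valuation, compatibility, induced valuations.** For a (multi-graded) ring $A$ and a discrete valuation $\nu$ non-negative on $A$, put $I(b)=\{\phi\in A:\nu(\phi)\ge b\}$ and $\mathrm{gr}_\nu A=\bigoplus_{b\ge0}I(b)/I(b+1)$. If $A=\bigoplus_{\underline a}J(\underline a)$, $\nu$ is compatible with the grading if all $I(b)$ are homogeneous; then $\mathrm{gr}_\nu A$ is multi-graded with components $J(\underline a,b)=I(\underline a,b)/I(\underline a,b+1)$, $I(\underline a,b)=I(b)\cap J(\underline a)$. Another valuation $\omega$ on $A$ induces $\bar\omega$ on $\mathrm{gr}_\nu A$: for a non-zero homogeneous $\bar h$ of $\nu$-degree $b$ (and of given multidegree, if $A$ is multi-graded), $\bar\omega(\bar h)=\max\{\omega(h):h+I(b+1)=\bar h\}$, and on a sum of non-zero homogeneous terms $\bar\omega$ is the minimum of the values. $\mathrm{gr}_{\underline\nu}R$ with $\underline{\bar\nu}$ is obtained by iterating: from $\mathrm{gr}_{(\nu_1,\dots,\nu_k)}R$ with its induced maps $\tilde\nu_1,\dots,\tilde\nu_r$, take the graded ring associated with $\tilde\nu_{k+1}$ and the maps induced on it, for $k=1,\dots,r-1$, starting with $\mathrm{gr}_{\nu_1}R$; the assertion includes that at each step these maps are valuations compatible with the grading. *)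

theory Defs
  imports
    "Subresultants.Resultant_Prelim"
    "HOL-Analysis.Finite_Cartesian_Product"
    "HOL-Algebra.Ring_Divisibility"
    "HOL-Algebra.Weak_Morphisms"
    "HOL-Library.Poly_Mapping"
    "HOL-Library.Extended_Nat"
begin

no_notation vec_index (infixl \<open>$\<close> 100)

section \<open>Power series with fractional exponents\<close>

definition grid :: "nat \<Rightarrow> (rat ^ 'd) set"
  where "grid n = {u. \<forall>i. 0 \<le> u $ i \<and> of_nat n * u $ i \<in> \<int>}"

text \<open>The union over all \<open>n > 0\<close> of the rings \<open>C[[x_1^(1/n), ..., x_d^(1/n)]]\<close>; an element is
  the function sending an exponent to its coefficient.\<close>

definition on_grid :: "nat \<Rightarrow> (rat ^ 'd \<Rightarrow> complex) \<Rightarrow> bool"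
  where "on_grid n f \<longleftrightarrow> (\<forall>u. f u \<noteq> 0 \<longrightarrow> u \<in> grid n)"

typedef ('d::finite) puiseux = "{f :: rat ^ 'd \<Rightarrow> complex. \<exists>n>0. on_grid n f}"
  morphisms puis_coeff Abs_puiseux
  by (rule exI[of _ "\<lambda>_. 0"]) (auto simp: on_grid_def)

setup_lifting type_definition_puiseux

definition puis_supp :: "('d::finite) puiseux \<Rightarrow> (rat ^ 'd) set"
  where "puis_supp \<phi> = {u. puis_coeff \<phi> u \<noteq> 0}"

lemma grid_0: "0 \<in> grid n"
  by (simp add: grid_def)

lemma grid_add: "u \<in> grid n \<Longrightarrow> w \<in> grid n \<Longrightarrow> u + w \<in> grid n"
  by (auto simp: grid_def algebra_simps)

lemma grid_mult:
  assumes "u \<in> grid n" shows "u \<in> grid (n * m)" "u \<in> grid (m * n)"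
proof -
  have "of_nat (n * m) * u $ i \<in> \<int>" for i
  proof -
    have "of_nat m * (of_nat n * u $ i) \<in> \<int>" using assms by (simp add: grid_def Ints_mult)
    thus ?thesis by (simp add: mult_ac)
  qed
  thus "u \<in> grid (n * m)" using assms by (simp add: grid_def)
  thus "u \<in> grid (m * n)" by (simp add: mult.commute)
qed

lemma on_grid_mult:
  assumes "on_grid n f" shows "on_grid (n * m) f" "on_grid (m * n) f"
  using assms grid_mult unfolding on_grid_def by blast+

lemma on_grid_add:
  assumes "on_grid n f" "on_grid n g" shows "on_grid n (\<lambda>u. f u + g u)"
  using assms unfolding on_grid_def by (metis add.right_neutral)

lemma common_denominator:
  fixes f g :: "rat ^ 'd \<Rightarrow> complex"
  assumes "\<exists>n>0. on_grid n f" "\<exists>n>0. on_grid n g"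
  obtains n where "n > 0" "on_grid n f" "on_grid n g"
proof -
  obtain n where n: "n > 0" "on_grid n f" using assms(1) by blast
  obtain m where m: "m > 0" "on_grid m g" using assms(2) by blast
  show thesis
    by (rule that[of "n * m"]) (use n m in \<open>auto intro: on_grid_mult\<close>)
qed

definition cauchy :: "(rat ^ 'd \<Rightarrow> complex) \<Rightarrow> (rat ^ 'd \<Rightarrow> complex) \<Rightarrow> rat ^ 'd \<Rightarrow> complex"
  where "cauchy f g u = (\<Sum>s | f s \<noteq> 0 \<and> g (u - s) \<noteq> 0. f s * g (u - s))"

definition grid_below :: "nat \<Rightarrow> rat ^ 'd \<Rightarrow> (rat ^ 'd) set"
  where "grid_below n u = {s \<in> grid n. u - s \<in> grid n}"

lemma finite_grid_below:
  assumes "n > 0" shows "finite (grid_below n (u :: rat ^ 'd))"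
proof -
  define K where "K = (\<Union>i. (\<lambda>k. of_int k / of_nat n :: rat) ` {0..\<lfloor>of_nat n * u $ i\<rfloor>})"
  have fK: "finite K" unfolding K_def by auto
  have "finite ((\<lambda>g. vec_lambda g :: rat ^ 'd) ` {g. \<forall>i. g i \<in> K})"
    by (rule finite_imageI)
      (use finite_PiE[of "UNIV :: 'd set" "\<lambda>_. K"] fK in \<open>simp add: PiE_def Pi_def\<close>)
  moreover have "grid_below n u \<subseteq> (\<lambda>g. vec_lambda g :: rat ^ 'd) ` {g. \<forall>i. g i \<in> K}"
  proof
    fix s assume s: "s \<in> grid_below n u"
    have "s $ i \<in> K" for i
    proof -
      have g: "s \<in> grid n" "u - s \<in> grid n" using s by (auto simp: grid_below_def)
      then obtain k where k: "of_nat n * s $ i = of_int k" by (auto simp: grid_def elim!: Ints_cases)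
      have "s $ i = of_int k / of_nat n" using assms k by (simp add: field_simps)
      moreover have "0 \<le> k"
      proof -
        have "0 \<le> of_nat n * s $ i" using g(1) by (simp add: grid_def)
        thus ?thesis using k by simp
      qed
      moreover have "k \<le> \<lfloor>of_nat n * u $ i\<rfloor>"
      proof -
        have "s $ i \<le> u $ i" using g(2) by (simp add: grid_def)
        hence "of_nat n * s $ i \<le> of_nat n * u $ i" by (simp add: mult_left_mono)
        thus ?thesis using k by (simp add: le_floor_iff)
      qed
      ultimately show ?thesis unfolding K_def by (intro UN_I[of i] image_eqI[of _ _ k]) auto
    qed
    moreover have "s = vec_lambda (\<lambda>i. s $ i)" by simp
    ultimately show "s \<in> (\<lambda>g. vec_lambda g :: rat ^ 'd) ` {g. \<forall>i. g i \<in> K}" by blast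
  qed
  ultimately show ?thesis using finite_subset by blast
qed

lemma cauchy_eq:
  assumes "n > 0" "on_grid n f" "on_grid n g"
  shows "cauchy f g u = (\<Sum>s\<in>grid_below n u. f s * g (u - s))"
  unfolding cauchy_def
  by (rule sum.mono_neutral_left) (use assms finite_grid_below in \<open>auto simp: grid_below_def on_grid_def\<close>)

lemma cauchy_supp:
  assumes "on_grid n f" "on_grid n g"
  shows "on_grid n (cauchy f g)"
  unfolding on_grid_def
proof (intro allI impI)
  fix u assume "cauchy f g u \<noteq> 0"
  then obtain s where "f s \<noteq> 0" "g (u - s) \<noteq> 0"
    unfolding cauchy_def by (auto elim!: sum.not_neutral_contains_not_neutral)
  thus "u \<in> grid n" using grid_add[of s n "u - s"] assms by (simp add: on_grid_def)
qed

lemma cauchy_commute: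
  assumes n: "n > 0" and f: "on_grid n f" and g: "on_grid n g"
  shows "cauchy f g = cauchy g f"
proof
  fix u
  have "(\<Sum>s\<in>grid_below n u. f s * g (u - s)) = (\<Sum>s\<in>grid_below n u. g s * f (u - s))"
    by (rule sum.reindex_bij_witness[where i = "\<lambda>s. u - s" and j = "\<lambda>s. u - s"]) (auto simp: grid_below_def)
  thus "cauchy f g u = cauchy g f u"
    using cauchy_eq[OF n f g] cauchy_eq[OF n g f] by simp
qed

lemma cauchy_assoc:
  assumes n: "n > 0" and f: "on_grid n f" and g: "on_grid n g"
    and h: "on_grid n h"
  shows "cauchy (cauchy f g) h = cauchy f (cauchy g h)"
proof
  fix u
  note fg = cauchy_supp[OF f g] and gh = cauchy_supp[OF g h]
  have "cauchy (cauchy f g) h u = (\<Sum>s\<in>grid_below n u. \<Sum>t\<in>grid_below n s. f t * g (s - t) * h (u - s))"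
    by (simp add: cauchy_eq[OF n fg h] cauchy_eq[OF n f g] sum_distrib_right)
  also have "\<dots> = (\<Sum>(s, t)\<in>Sigma (grid_below n u) (grid_below n). f t * g (s - t) * h (u - s))"
    by (rule sum.Sigma) (use n finite_grid_below in auto)
  also have "\<dots> = (\<Sum>(t, r)\<in>Sigma (grid_below n u) (\<lambda>t. grid_below n (u - t)). f t * (g r * h (u - t - r)))"
  proof (rule sum.reindex_bij_witness[where i = "\<lambda>(t, r). (t + r, t)" and j = "\<lambda>(s, t). (t, s - t)"])
    fix a assume "a \<in> Sigma (grid_below n u) (grid_below n)"
    then obtain s t where a: "a = (s, t)" "s \<in> grid_below n u" "t \<in> grid_below n s" by auto
    have "u - t \<in> grid n" using grid_add[of "u - s" n "s - t"] a by (simp add: grid_below_def)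
    thus "(case a of (s, t) \<Rightarrow> (t, s - t)) \<in> Sigma (grid_below n u) (\<lambda>t. grid_below n (u - t))"
      using a by (auto simp: grid_below_def)
  next
    fix b assume "b \<in> Sigma (grid_below n u) (\<lambda>t. grid_below n (u - t))"
    then obtain t r where b: "b = (t, r)" "t \<in> grid_below n u" "r \<in> grid_below n (u - t)" by auto
    have "t + r \<in> grid n" using b grid_add by (auto simp: grid_below_def)
    thus "(case b of (t, r) \<Rightarrow> (t + r, t)) \<in> Sigma (grid_below n u) (grid_below n)"
      using b by (auto simp: grid_below_def algebra_simps)
  qed (auto simp: mult.assoc)
  also have "\<dots> = (\<Sum>t\<in>grid_below n u. \<Sum>r\<in>grid_below n (u - t). f t * (g r * h (u - t - r)))"
    by (rule sum.Sigma[symmetric]) (use n finite_grid_below in auto)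
  also have "\<dots> = cauchy f (cauchy g h) u"
    by (simp add: cauchy_eq[OF n f gh] cauchy_eq[OF n g h] sum_distrib_left)
  finally show "cauchy (cauchy f g) h u = cauchy f (cauchy g h) u" .
qed

lemma cauchy_add:
  assumes n: "n > 0" and f: "on_grid n f" and g: "on_grid n g"
    and h: "on_grid n h"
  shows "cauchy (\<lambda>u. f u + g u) h = (\<lambda>u. cauchy f h u + cauchy g h u)"
proof
  fix u
  note fg = on_grid_add[OF f g]
  show "cauchy (\<lambda>u. f u + g u) h u = cauchy f h u + cauchy g h u"
    by (simp add: cauchy_eq[OF n fg h] cauchy_eq[OF n f h] cauchy_eq[OF n g h]
        sum.distrib algebra_simps)
qed

lemma cauchy_one: "cauchy (\<lambda>u. if u = 0 then 1 else 0) f = f"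
proof
  fix u
  have "{s. (if s = 0 then 1 else 0 :: complex) \<noteq> 0 \<and> f (u - s) \<noteq> 0} = (if f u = 0 then {} else {0})"
    by auto
  thus "cauchy (\<lambda>u. if u = 0 then 1 else 0) f u = f u" by (simp add: cauchy_def)
qed

text \<open>Selecting, one coordinate after another, the exponents on which that coordinate is minimal
  leaves a single exponent, the lexicographically smallest one.\<close>

primrec lexmin :: "'d list \<Rightarrow> (rat ^ 'd) set \<Rightarrow> (rat ^ 'd) set" where
  "lexmin [] S = S"
| "lexmin (i # is) S = lexmin is {u \<in> S. \<forall>w\<in>S. u $ i \<le> w $ i}"

lemma lexmin_subset: "lexmin is S \<subseteq> S"
  by (induction "is" arbitrary: S) (simp, force)

lemma grid_minimal:
  fixes S :: "(rat ^ 'd) set"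
  assumes "n > 0" "S \<subseteq> grid n" "S \<noteq> {}"
  shows "\<exists>u\<in>S. \<forall>w\<in>S. u $ i \<le> w $ i"
proof -
  define m where "m u = nat \<lfloor>of_nat n * u $ i\<rfloor>" for u :: "rat ^ 'd"
  obtain u where u: "u \<in> S" "\<And>w. w \<in> S \<Longrightarrow> m u \<le> m w"
    using assms(3) ex_has_least_nat[of "\<lambda>u. u \<in> S" _ m] by blast
  have "u $ i \<le> w $ i" if w: "w \<in> S" for w
  proof -
    have eq: "of_nat (m s) = of_nat n * s $ i" if "s \<in> S" for s
    proof -
      have "of_nat n * s $ i \<in> \<int>" "0 \<le> of_nat n * s $ i"
        using that assms(2) by (auto simp: grid_def)
      thus ?thesis unfolding m_def by (auto elim!: Ints_cases)
    qed
    have "of_nat (m u) \<le> (of_nat (m w) :: rat)" using u(2)[OF w] by simp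
    thus ?thesis using eq u(1) w assms(1) by simp
  qed
  thus ?thesis using u(1) by blast
qed

lemma lexmin_nonempty:
  assumes "n > 0" "S \<subseteq> grid n" "S \<noteq> {}" shows "lexmin is S \<noteq> {}"
  using assms
proof (induction "is" arbitrary: S)
  case (Cons i "is")
  show ?case using Cons.IH[of "{u \<in> S. \<forall>w\<in>S. u $ i \<le> w $ i}"] grid_minimal[OF Cons.prems, of i] Cons.prems
    by (simp, blast)
qed simp

lemma lexmin_sum:
  assumes "u \<in> lexmin is S" "w \<in> lexmin is T" "u' \<in> S" "w' \<in> T" "u' + w' = u + w"
  shows "\<forall>i\<in>set is. u' $ i = u $ i"
  using assms
proof (induction "is" arbitrary: S T)
  case (Cons i "is")
  let ?S = "{u \<in> S. \<forall>w\<in>S. u $ i \<le> w $ i}" and ?T = "{u \<in> T. \<forall>w\<in>T. u $ i \<le> w $ i}"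
  have uw: "u \<in> ?S" "w \<in> ?T"
    using Cons.prems(1,2) lexmin_subset[of "is" ?S] lexmin_subset[of "is" ?T] by auto
  have "u' $ i + w' $ i = u $ i + w $ i" using Cons.prems(5) by (metis vector_add_component)
  moreover have "u $ i \<le> u' $ i" "w $ i \<le> w' $ i" using uw Cons.prems by auto
  ultimately have e: "u' $ i = u $ i" "w' $ i = w $ i" by linarith+
  hence "u' \<in> ?S" "w' \<in> ?T" using uw Cons.prems by auto
  thus ?case using Cons.IH[of ?S ?T] Cons.prems e by auto
qed simp

lemma cauchy_nonzero:
  fixes f g :: "rat ^ 'd \<Rightarrow> complex"
  assumes n: "n > 0" and f: "on_grid n f" and g: "on_grid n g"
    and "f a \<noteq> 0" "g b \<noteq> 0"
  shows "\<exists>u. cauchy f g u \<noteq> 0"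
proof -
  obtain "is" :: "'d list" where "is": "set is = UNIV" using finite_list[of "UNIV :: 'd set"] by auto
  let ?S = "{u. f u \<noteq> 0}" and ?T = "{u. g u \<noteq> 0}"
  obtain u where u: "u \<in> lexmin is ?S" using lexmin_nonempty[OF n, of ?S "is"] f assms(4) unfolding on_grid_def by blast
  obtain w where w: "w \<in> lexmin is ?T" using lexmin_nonempty[OF n, of ?T "is"] g assms(5) unfolding on_grid_def by blast
  have uw: "f u \<noteq> 0" "g w \<noteq> 0"
    using subsetD[OF lexmin_subset u] subsetD[OF lexmin_subset w] by simp_all
  have "{s. f s \<noteq> 0 \<and> g (u + w - s) \<noteq> 0} = {u}"
  proof (intro equalityI subsetI)
    fix s assume s: "s \<in> {s. f s \<noteq> 0 \<and> g (u + w - s) \<noteq> 0}"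
    hence "\<forall>i\<in>set is. s $ i = u $ i" by (intro lexmin_sum[OF u w, of s "u + w - s"]) simp_all
    thus "s \<in> {u}" using "is" by (simp add: vec_eq_iff)
  next
    fix s assume "s \<in> {u}"
    thus "s \<in> {s. f s \<noteq> 0 \<and> g (u + w - s) \<noteq> 0}" using uw by simp
  qed
  hence "cauchy f g (u + w) = f u * g w" unfolding cauchy_def by simp
  thus ?thesis using uw by (metis mult_eq_0_iff)
qed

instantiation puiseux :: (finite) idom
begin

lift_definition zero_puiseux :: "'a puiseux" is "\<lambda>_. 0" by (auto simp: on_grid_def)

lift_definition one_puiseux :: "'a puiseux" is "\<lambda>u. if u = 0 then 1 else 0"
  by (auto intro!: exI[of _ 1] simp: grid_0 on_grid_def)

lift_definition plus_puiseux :: "'a puiseux \<Rightarrow> 'a puiseux \<Rightarrow> 'a puiseux" is "\<lambda>f g u. f u + g u"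
proof -
  fix f g :: "rat ^ 'a \<Rightarrow> complex"
  assume "\<exists>n>0. on_grid n f" "\<exists>n>0. on_grid n g"
  then obtain n where "n > 0" "on_grid n f" "on_grid n g"
    using common_denominator by blast
  thus "\<exists>n>0. on_grid n (\<lambda>u. f u + g u)" using on_grid_add by blast
qed

lift_definition uminus_puiseux :: "'a puiseux \<Rightarrow> 'a puiseux" is "\<lambda>f u. - f u" by (simp add: on_grid_def)

definition minus_puiseux :: "'a puiseux \<Rightarrow> 'a puiseux \<Rightarrow> 'a puiseux"
  where "minus_puiseux \<phi> \<psi> = \<phi> + (- \<psi>)"

lift_definition times_puiseux :: "'a puiseux \<Rightarrow> 'a puiseux \<Rightarrow> 'a puiseux" is cauchy
proof -
  fix f g :: "rat ^ 'a \<Rightarrow> complex"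
  assume "\<exists>n>0. on_grid n f" "\<exists>n>0. on_grid n g"
  then obtain n where "n > 0" "on_grid n f" "on_grid n g"
    using common_denominator by blast
  thus "\<exists>n>0. on_grid n (cauchy f g)" using cauchy_supp by blast
qed

lemma puis_denominator2:
  fixes \<phi> \<psi> :: "'a puiseux"
  obtains n where "n > 0" "on_grid n (puis_coeff \<phi>)"
    "on_grid n (puis_coeff \<psi>)"
  by (rule common_denominator[of "puis_coeff \<phi>" "puis_coeff \<psi>"])
    (use puis_coeff[of \<phi>] puis_coeff[of \<psi>] in auto)

lemma puis_denominator3:
  fixes \<phi> \<psi> \<theta> :: "'a puiseux"
  obtains n where "n > 0" "on_grid n (puis_coeff \<phi>)"
    "on_grid n (puis_coeff \<psi>)" "on_grid n (puis_coeff \<theta>)"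
proof -
  obtain n where n: "n > 0" "on_grid n (puis_coeff \<phi>)"
    "on_grid n (puis_coeff \<psi>)"
    by (rule puis_denominator2[of \<phi> \<psi>])
  obtain m where m: "m > 0" "on_grid m (puis_coeff \<theta>)"
    by (rule puis_denominator2[of \<theta> \<theta>])
  show thesis
    by (rule that[of "n * m"]) (use n m in \<open>auto intro: on_grid_mult\<close>)
qed

instance
proof
  fix a b c :: "'a puiseux"
  show "a + b + c = a + (b + c)" by transfer (simp add: add.assoc)
  show "a + b = b + a" by transfer (simp add: add.commute)
  show "0 + a = a" by transfer simp
  show "- a + a = 0" by transfer simp
  show "a - b = a + - b" by (simp add: minus_puiseux_def)
  show "a * b * c = a * (b * c)"
  proof -
    obtain n where n: "n > 0" "on_grid n (puis_coeff a)"
      "on_grid n (puis_coeff b)" "on_grid n (puis_coeff c)"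
      by (rule puis_denominator3[of a b c])
    show ?thesis using cauchy_assoc[OF n]
      by (simp add: puis_coeff_inject[symmetric] times_puiseux.rep_eq)
  qed
  have comm: "a * b = b * a" for a b :: "'a puiseux"
  proof -
    obtain n where n: "n > 0" "on_grid n (puis_coeff a)"
      "on_grid n (puis_coeff b)"
      by (rule puis_denominator2[of a b])
    show ?thesis using cauchy_commute[OF n]
      by (simp add: puis_coeff_inject[symmetric] times_puiseux.rep_eq)
  qed
  show "1 * a = a" by transfer (rule cauchy_one)
  show "a * b = b * a" by (rule comm)
  have dist: "(a + b) * c = a * c + b * c" for a b c :: "'a puiseux"
  proof -
    obtain n where n: "n > 0" "on_grid n (puis_coeff a)"
      "on_grid n (puis_coeff b)" "on_grid n (puis_coeff c)"
      by (rule puis_denominator3[of a b c])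
    show ?thesis using cauchy_add[OF n]
      by (simp add: puis_coeff_inject[symmetric] times_puiseux.rep_eq plus_puiseux.rep_eq)
  qed
  show "(a + b) * c = a * c + b * c" by (rule dist)
  show "a * (b + c) = a * b + a * c" using dist[of b c a] comm by simp
  show "0 * a = 0" by (simp add: puis_coeff_inject[symmetric] times_puiseux.rep_eq zero_puiseux.rep_eq cauchy_def fun_eq_iff)
  thus "a * 0 = 0" using comm[of a 0] by simp
  show "(0 :: 'a puiseux) \<noteq> 1" by transfer (metis zero_neq_one)
  show "a \<noteq> 0 \<Longrightarrow> b \<noteq> 0 \<Longrightarrow> a * b \<noteq> 0"
  proof -
    assume ab: "a \<noteq> 0" "b \<noteq> 0"
    obtain n where n: "n > 0" "on_grid n (puis_coeff a)"
      "on_grid n (puis_coeff b)"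
      by (rule puis_denominator2[of a b])
    obtain s t where "puis_coeff a s \<noteq> 0" "puis_coeff b t \<noteq> 0"
      using ab by (metis puis_coeff_inject zero_puiseux.rep_eq ext)
    hence "\<exists>u. puis_coeff (a * b) u \<noteq> 0"
      using cauchy_nonzero[OF n] by (simp add: times_puiseux.rep_eq)
    thus "a * b \<noteq> 0" by (auto simp: zero_puiseux.rep_eq)
  qed
qed

end

text \<open>The monomial \<open>x^u\<close>, for \<open>u \<ge> 0\<close> only (otherwise \<open>0\<close>).\<close>

lift_definition puis_monom :: "rat ^ 'd \<Rightarrow> ('d::finite) puiseux"
  is "\<lambda>u w. if w = u \<and> 0 \<le> u then 1 else 0"
proof -
  fix u :: "rat ^ 'd"
  define q where "q i = snd (quotient_of (u $ i))" for i
  define n where "n = (\<Prod>i\<in>UNIV. nat (q i))"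
  have q: "q i > 0" for i unfolding q_def by (rule quotient_of_denom_pos')
  have "of_nat n * u $ i \<in> \<int>" for i
  proof -
    have e: "u $ i = of_int (fst (quotient_of (u $ i))) / of_int (q i)"
      unfolding q_def by (rule quotient_of_div) simp
    have "nat (q i) dvd n" unfolding n_def by (rule dvd_prodI) auto
    then obtain k where "n = nat (q i) * k" by (rule dvdE)
    hence "(of_nat n :: rat) = of_int (q i) * of_nat k" using q[of i] by simp
    hence "of_nat n * u $ i = of_int (fst (quotient_of (u $ i)) * int k)"
      by (subst e) (use q[of i] in simp)
    thus ?thesis by (metis Ints_of_int)
  qed
  moreover have "n > 0" unfolding n_def using q by (auto intro: prod_pos)
  ultimately show "\<exists>n>0. on_grid n (\<lambda>w. if w = u \<and> 0 \<le> u then 1 else 0)"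
    by (intro exI[of _ n]) (auto simp: on_grid_def grid_def less_eq_vec_def)
qed

definition subring_on :: "'a::comm_ring_1 set \<Rightarrow> 'a ring"
  where "subring_on S = \<lparr>carrier = S, mult = (*), one = 1, zero = 0, add = (+)\<rparr>"

text \<open>\<open>C[[x]]\<close> and \<open>C[[x]][y]\<close>.\<close>

definition pseries :: "('d::finite) puiseux set"
  where "pseries = {\<phi>. puis_supp \<phi> \<subseteq> grid 1}"

definition pseries_poly :: "('d::finite) puiseux poly set"
  where "pseries_poly = {p. \<forall>i. Polynomial.coeff p i \<in> pseries}"


section \<open>Quasi-ordinary polynomials and their characteristic data\<close>

definition weierstrass :: "('d::finite) puiseux poly \<Rightarrow> bool"
  where "weierstrass f \<longleftrightarrow> f \<in> pseries_poly \<and> lead_coeff f = 1 \<and>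
    (\<forall>i<Polynomial.degree f. puis_coeff (Polynomial.coeff f i) 0 = 0)"

text \<open>Discriminant of a monic polynomial.\<close>

definition discriminant :: "'a::idom poly \<Rightarrow> 'a"
  where "discriminant f =
    (- 1) ^ (Polynomial.degree f * (Polynomial.degree f - 1) div 2) * resultant f (pderiv f)"

definition quasi_ordinary :: "('d::finite) puiseux poly \<Rightarrow> bool"
  where "quasi_ordinary f \<longleftrightarrow> weierstrass f \<and> ring_irreducible\<^bsub>subring_on pseries_poly\<^esub> f \<and>
    (\<exists>u\<in>grid 1. \<exists>e\<in>Units (subring_on pseries). discriminant f = puis_monom u * e)"

text \<open>The strict order on \<open>rat ^ 'd\<close> is: coordinatewise \<open>\<le>\<close> and \<open>\<noteq>\<close>.\<close>

definition characteristic_exponents :: "('d::finite) puiseux poly \<Rightarrow> (rat ^ 'd) list \<Rightarrow> bool"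
  where "characteristic_exponents f ls \<longleftrightarrow> sorted_wrt (<) ls \<and>
    set ls = {u. 0 \<le> u \<and> (\<exists>\<zeta> \<zeta>' e. poly f \<zeta> = 0 \<and> poly f \<zeta>' = 0 \<and> \<zeta> \<noteq> \<zeta>' \<and>
      e dvd 1 \<and> \<zeta> - \<zeta>' = puis_monom u * e)}"

text \<open>The coordinates are numbered along the linear order of the index type.\<close>

definition normalized :: "(rat ^ 'd::{finite,linorder}) list \<Rightarrow> bool"
  where "normalized ls \<longleftrightarrow>
    (\<forall>i j. i \<le> j \<longrightarrow> lexordp_eq (map (\<lambda>l. l $ j) ls) (map (\<lambda>l. l $ i) ls)) \<and>
    (ls \<noteq> [] \<longrightarrow> (\<forall>i. i \<noteq> Min UNIV \<longrightarrow> hd ls $ i = 0) \<longrightarrow> 1 < hd ls $ Min UNIV)"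

text \<open>\<open>lattice_of [\<lambda>_1, ..., \<lambda>_j]\<close> is \<open>M_j\<close>.\<close>

definition lattice_of :: "(rat ^ 'd::finite) list \<Rightarrow> (rat ^ 'd) set"
  where "lattice_of ls = {m + (\<Sum>j<length ls. of_int (k j) *s ls ! j) | m k. \<forall>i. m $ i \<in> \<int>}"

definition lattice_index :: "(rat ^ 'd::finite) set \<Rightarrow> (rat ^ 'd) set \<Rightarrow> nat"
  where "lattice_index L L' = card ((\<lambda>u. (+) u ` L') ` L)"

text \<open>Lists are indexed from \<open>0\<close>: \<open>ls ! j\<close> is \<open>\<lambda>_(j+1)\<close> and \<open>gam ls j\<close> is \<open>\<gamma>_(j+1)\<close>.\<close>

primrec gam :: "(rat ^ 'd::finite) list \<Rightarrow> nat \<Rightarrow> rat ^ 'd" where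
  "gam ls 0 = ls ! 0"
| "gam ls (Suc j) =
    of_nat (lattice_index (lattice_of (take (Suc j) ls)) (lattice_of (take j ls))) *s gam ls j
      + (ls ! Suc j - ls ! j)"

definition Gam :: "(rat ^ 'd::finite) list \<Rightarrow> (rat ^ 'd) set"
  where "Gam ls = {m + (\<Sum>j<length ls. of_nat (k j) *s gam ls j) | m k. m \<in> grid 1}"


section \<open>Monomial valuations\<close>

definition pairing :: "rat ^ 'd::finite \<Rightarrow> rat ^ 'd \<Rightarrow> rat"
  where "pairing v u = (\<Sum>i\<in>UNIV. v $ i * u $ i)"

text \<open>\<open>M\<close> has full rank, so \<open>Hom(M, Z)\<close> embeds in \<open>Q^d\<close> by means of the dual basis of \<open>e_1, ..., e_d\<close>.\<close>

definition dual_lattice :: "(rat ^ 'd::finite) set \<Rightarrow> (rat ^ 'd) set"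
  where "dual_lattice M = {v. \<forall>u\<in>M. pairing v u \<in> \<int>}"

text \<open>The rational points of the cone spanned by the dual basis.\<close>

definition sigma :: "(rat ^ 'd::finite) set"
  where "sigma = {v. \<forall>i. 0 \<le> v $ i}"

text \<open>For \<open>v \<in> sigma \<inter> N\<close> and \<open>u \<in> M\<close> with \<open>u \<ge> 0\<close> the pairing is a natural number, and on sets of
  such \<open>u\<close> the infimum is a minimum; the value of \<open>0\<close> is \<open>\<infinity>\<close>.\<close>

definition min_pairing :: "rat ^ 'd::finite \<Rightarrow> (rat ^ 'd) set \<Rightarrow> enat"
  where "min_pairing v U = (INF u\<in>U. enat (nat \<lfloor>pairing v u\<rfloor>))"

definition monomial_val :: "rat ^ 'd::finite \<Rightarrow> 'd puiseux \<Rightarrow> enat"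
  where "monomial_val v \<phi> = min_pairing v (puis_supp \<phi>)"

definition O_S :: "('d::finite) puiseux \<Rightarrow> 'd puiseux ring"
  where "O_S \<zeta> = subring_on {poly p \<zeta> | p. p \<in> pseries_poly}"

definition centered_at_max :: "('a, 'm) ring_scheme \<Rightarrow> ('a \<Rightarrow> enat) \<Rightarrow> bool"
  where "centered_at_max R \<nu> \<longleftrightarrow> maximalideal {\<phi> \<in> carrier R. 0 < \<nu> \<phi>} R"


section \<open>Multi-graded rings, valuations and associated graded rings\<close>

text \<open>A ring with a grading by \<open>Z_{\<ge>0}^grank\<close>; degrees are lists of length \<open>grank\<close>, and \<open>component\<close> is
  irrelevant on other lists.\<close>

record 'a graded_ring = "'a ring" +
  grank :: nat
  component :: "nat list \<Rightarrow> 'a set"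

definition decomposition :: "('a, 'm) graded_ring_scheme \<Rightarrow> (nat list \<Rightarrow> 'a) \<Rightarrow> 'a \<Rightarrow> bool"
  where "decomposition A y x \<longleftrightarrow>
    (\<forall>a. y a \<in> (if length a = grank A then component A a else {\<zero>\<^bsub>A\<^esub>})) \<and>
    finite {a. y a \<noteq> \<zero>\<^bsub>A\<^esub>} \<and> x = (\<Oplus>\<^bsub>A\<^esub>a\<in>{a. y a \<noteq> \<zero>\<^bsub>A\<^esub>}. y a)"

definition hcomp :: "('a, 'm) graded_ring_scheme \<Rightarrow> 'a \<Rightarrow> nat list \<Rightarrow> 'a"
  where "hcomp A x = (THE y. decomposition A y x)"

definition multi_graded :: "('a, 'm) graded_ring_scheme \<Rightarrow> bool"
  where "multi_graded A \<longleftrightarrow> cring A \<and>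
    (\<forall>a. length a = grank A \<longrightarrow> additive_subgroup (component A a) A) \<and>
    (\<forall>x\<in>carrier A. \<exists>!y. decomposition A y x) \<and>
    \<one>\<^bsub>A\<^esub> \<in> component A (replicate (grank A) 0) \<and>
    (\<forall>a b. length a = grank A \<longrightarrow> length b = grank A \<longrightarrow>
      (\<forall>x\<in>component A a. \<forall>y\<in>component A b. x \<otimes>\<^bsub>A\<^esub> y \<in> component A (map2 (+) a b)))"

definition discrete_valuation :: "('a, 'm) ring_scheme \<Rightarrow> ('a \<Rightarrow> enat) \<Rightarrow> bool"
  where "discrete_valuation A \<nu> \<longleftrightarrow>
    (\<forall>x\<in>carrier A. \<nu> x = \<infinity> \<longleftrightarrow> x = \<zero>\<^bsub>A\<^esub>) \<and>
    (\<forall>x\<in>carrier A. \<forall>y\<in>carrier A. \<nu> (x \<otimes>\<^bsub>A\<^esub> y) = \<nu> x + \<nu> y \<and> min (\<nu> x) (\<nu> y) \<le> \<nu> (x \<oplus>\<^bsub>A\<^esub> y)) \<and>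
    (\<exists>x\<in>carrier A. \<nu> x \<noteq> 0 \<and> \<nu> x \<noteq> \<infinity>)"

definition filt :: "('a, 'm) ring_scheme \<Rightarrow> ('a \<Rightarrow> enat) \<Rightarrow> nat \<Rightarrow> 'a set"
  where "filt A \<nu> b = {x \<in> carrier A. enat b \<le> \<nu> x}"

definition compatible_val :: "('a, 'm) graded_ring_scheme \<Rightarrow> ('a \<Rightarrow> enat) \<Rightarrow> bool"
  where "compatible_val A \<nu> \<longleftrightarrow> (\<forall>b. \<forall>x\<in>filt A \<nu> b. \<forall>a. hcomp A x a \<in> filt A \<nu> b)"

text \<open>The ring \<open>\<Oplus>_b I(b)/I(b+1)\<close>: an element is a family of cosets \<open>F b \<in> I(b)/I(b+1)\<close>, almost all
  of them zero. The component of degree \<open>(a, b)\<close>, where \<open>a\<close> is a degree of \<open>A\<close>, is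
  \<open>(I(b) \<inter> J(a)) / (I(b+1) \<inter> J(a))\<close>, regarded as a subgroup of \<open>I(b)/I(b+1)\<close>.\<close>

definition gr :: "('a, 'm) graded_ring_scheme \<Rightarrow> ('a \<Rightarrow> enat) \<Rightarrow> (nat \<Rightarrow> 'a set) graded_ring"
  where "gr A \<nu> =
    \<lparr>carrier = {F. (\<forall>b. F b \<in> (\<lambda>x. filt A \<nu> (Suc b) +>\<^bsub>A\<^esub> x) ` filt A \<nu> b) \<and>
        finite {b. F b \<noteq> filt A \<nu> (Suc b)}},
     mult = (\<lambda>F G b. \<Union>x\<in>{x. \<forall>i. x i \<in> F i}. \<Union>y\<in>{y. \<forall>i. y i \<in> G i}.
        filt A \<nu> (Suc b) +>\<^bsub>A\<^esub> (\<Oplus>\<^bsub>A\<^esub>i\<in>{..b}. x i \<otimes>\<^bsub>A\<^esub> y (b - i))),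
     one = (\<lambda>b. if b = 0 then filt A \<nu> 1 +>\<^bsub>A\<^esub> \<one>\<^bsub>A\<^esub> else filt A \<nu> (Suc b)),
     zero = (\<lambda>b. filt A \<nu> (Suc b)),
     add = (\<lambda>F G b. F b <+>\<^bsub>A\<^esub> G b),
     grank = Suc (grank A),
     component = (\<lambda>c. {F. F (last c) \<in>
          (\<lambda>x. filt A \<nu> (Suc (last c)) +>\<^bsub>A\<^esub> x) ` (filt A \<nu> (last c) \<inter> component A (butlast c)) \<and>
        (\<forall>b. b \<noteq> last c \<longrightarrow> F b = filt A \<nu> (Suc b))})\<rparr>"

text \<open>For a homogeneous \<open>H\<close> of degree \<open>c\<close>, the elements \<open>h\<close> with \<open>h + I(b+1) = H\<close>, \<open>b = last c\<close>, are
  those of the coset \<open>H b\<close>. A finite supremum in \<^typ>\<open>enat\<close> is a maximum; that it is finite is part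
  of the map being a valuation.\<close>

definition induced_val :: "('a, 'm) graded_ring_scheme \<Rightarrow> ('a \<Rightarrow> enat) \<Rightarrow> ('a \<Rightarrow> enat) \<Rightarrow> (nat \<Rightarrow> 'a set) \<Rightarrow> enat"
  where "induced_val A \<nu> \<omega> F =
    (INF c\<in>{c. hcomp (gr A \<nu>) F c \<noteq> \<zero>\<^bsub>gr A \<nu>\<^esub>}. SUP h\<in>hcomp (gr A \<nu>) F c (last c). \<omega> h)"

text \<open>Passing from \<open>A\<close> to \<open>gr A \<nu>\<close> changes the element type from \<open>'a\<close> to \<open>nat \<Rightarrow> 'a set\<close>. To iterate,
  everything is carried over to the following type along injections; a family of cosets is encoded
  by choosing a representative in each of them (injective, as distinct cosets are disjoint).\<close>

datatype 'a tower = Base 'a | Family "nat \<Rightarrow> 'a tower"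

definition encode_family :: "(nat \<Rightarrow> 'a tower set) \<Rightarrow> 'a tower"
  where "encode_family F = Family (\<lambda>b. SOME h. h \<in> F b)"

definition carry_ring :: "('a \<Rightarrow> 'b) \<Rightarrow> 'a graded_ring \<Rightarrow> 'b graded_ring"
  where "carry_ring f A =
    ring.extend (image_ring f A) (graded_ring.fields (grank A) (\<lambda>a. f ` component A a))"

definition carry_val :: "('a \<Rightarrow> 'b) \<Rightarrow> 'a graded_ring \<Rightarrow> ('a \<Rightarrow> enat) \<Rightarrow> 'b \<Rightarrow> enat"
  where "carry_val f A \<omega> = \<omega> \<circ> inv_into (carrier A) f"

definition ungraded :: "'a ring \<Rightarrow> 'a graded_ring"
  where "ungraded R = ring.extend R (graded_ring.fields 0 (\<lambda>_. carrier R))"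

text \<open>\<open>iterated_gr R \<nu>s k\<close> is the ring \<open>gr_(\<nu>_1, ..., \<nu>_k) R\<close> with the maps induced on it by
  \<open>\<nu>_1, ..., \<nu>_r\<close>; for \<open>k = 0\<close> it is \<open>R\<close> with its trivial \<open>Z^0\<close>-grading.\<close>

primrec iterated_gr ::
  "'a ring \<Rightarrow> ('a \<Rightarrow> enat) list \<Rightarrow> nat \<Rightarrow> 'a tower graded_ring \<times> ('a tower \<Rightarrow> enat) list"
where
  "iterated_gr R \<nu>s 0 = (carry_ring Base (ungraded R), map (carry_val Base (ungraded R)) \<nu>s)"
| "iterated_gr R \<nu>s (Suc k) = (case iterated_gr R \<nu>s k of (A, \<omega>s) \<Rightarrow>
    (carry_ring encode_family (gr A (\<omega>s ! k)),
     map (\<lambda>\<omega>. carry_val encode_family (gr A (\<omega>s ! k)) (induced_val A (\<omega>s ! k) \<omega>)) \<omega>s))"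

definition multi_gr :: "'a ring \<Rightarrow> ('a \<Rightarrow> enat) list \<Rightarrow> 'a tower graded_ring"
  where "multi_gr R \<nu>s = fst (iterated_gr R \<nu>s (length \<nu>s))"

definition multi_val :: "'a ring \<Rightarrow> ('a \<Rightarrow> enat) list \<Rightarrow> nat \<Rightarrow> 'a tower \<Rightarrow> enat"
  where "multi_val R \<nu>s i = snd (iterated_gr R \<nu>s (length \<nu>s)) ! i"


section \<open>The graded semigroup algebra\<close>

definition semigroup_algebra ::
  "(rat ^ 'd::finite) set \<Rightarrow> (rat ^ 'd) list \<Rightarrow> ((rat ^ 'd) \<Rightarrow>\<^sub>0 complex) graded_ring"
  where "semigroup_algebra G vs =
    (let C = {p. Poly_Mapping.keys p \<subseteq> G} in
     ring.extend (subring_on C) (graded_ring.fields (length vs)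
       (\<lambda>a. {p \<in> C. \<forall>u\<in>Poly_Mapping.keys p. \<forall>j<length vs. pairing (vs ! j) u = of_nat (a ! j)})))"

definition algebra_val :: "rat ^ 'd::finite \<Rightarrow> ((rat ^ 'd) \<Rightarrow>\<^sub>0 complex) \<Rightarrow> enat"
  where "algebra_val v p = min_pairing v (Poly_Mapping.keys p)"

definition graded_iso :: "'a graded_ring \<Rightarrow> 'b graded_ring \<Rightarrow> ('a \<Rightarrow> 'b) set"
  where "graded_iso A B = {\<psi> \<in> ring_iso A B. grank A = grank B \<and>
    (\<forall>a. length a = grank A \<longrightarrow> \<psi> ` component A a = component B a)}"

end

theory Submission
  imports Defs
begin

text \<open>
Vectors \<open>t \<in> Z^d\<close> act on fractional power series by \<open>x^u \<mapsto> exp(2\<pi>i\<langle>t,u\<rangle>) x^u\<close>. As \<open>f\<close> is irreducible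
its roots are the conjugates of \<open>\<zeta>\<close>, and as the differences of roots divide the discriminant they are
monomials times units. By duality of finite abelian groups the exponents of \<open>\<zeta>\<close> not \<open>\<ge> \<lambda>_(j+1)\<close> lie in
\<open>M_j\<close>, and there are \<open>t_j\<close> that generate the dual of \<open>M_j/M_(j-1)\<close>. The product of the conjugates, by the
\<open>\<Sum> k_i t_i\<close> with \<open>0 \<le> k_i < n_i\<close>, of \<open>y\<close> minus the truncation of \<open>\<zeta>\<close> below \<open>\<lambda>_(j+1)\<close> is a semiroot, of degree \<open>n_1 \<cdots> n_j\<close>,
whose value at \<open>\<zeta>\<close> is \<open>x^\<gamma>_(j+1)\<close> times a unit. Expanding an element of \<open>O_S\<close> in powers of the semiroots, the
terms have initial exponents in distinct cosets, so they do not cancel: for a weight in the interior of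
the cone all initial exponents lie in \<open>\<Gamma>\<close>. Conversely every \<open>u \<in> \<Gamma>\<close> is the least exponent of an element.
Hence taking initial forms identifies \<open>gr_(\<nu>_1) R\<close> with \<open>C[\<Gamma>]\<close>, and every element of \<open>C[\<Gamma>]\<close> lifts without
decreasing any of the \<open>\<nu>_i\<close>, which determines the induced valuations. From then on the same
argument applies to \<open>C[\<Gamma>]\<close> itself.
\<close>

section \<open>Supports and least exponents\<close>

text \<open>The interior position of v_1 enters twice. A weight with positive coordinates is
  strictly increasing for the coordinatewise order, so a series with a least exponent has that
  exponent as its only initial one; and only finitely many exponents of a series share a weight, so
  initial forms are polynomials. Both can fail on the boundary of the cone. Hence initial forms in R
  are taken for v_1 alone, and those for v_2, ..., v_r only in C[Gamma], where supports are finite.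
  The obstacle in the expansion is cancellation: the powers i of a semiroot that occur satisfy 0 <=
  i < n_j because of its degree, and gamma_j has order exactly n_j modulo M_(j-1); degree and order
  agree because the box of conjugates has n_j steps in its last direction. Induced valuations are
  suprema over cosets, so an isomorphism of graded rings is not enough: one lift must be good for
  all nu_i at once. Such lifts exist because a least exponent for the coordinatewise order is
  minimal for every weight in the cone.\<close>

lemma pairing_add: "pairing v (u + w) = pairing v u + pairing v w"
  by (simp add: pairing_def algebra_simps sum.distrib)

lemma pairing_diff: "pairing v (u - w) = pairing v u - pairing v w"
  by (simp add: pairing_def algebra_simps sum_subtractf)

lemma pairing_smult: "pairing v (c *s u) = c * pairing v u"
  by (simp add: pairing_def sum_distrib_left algebra_simps)

lemma pairing_add_left: "pairing (v + w) u = pairing v u + pairing w u"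
  by (simp add: pairing_def algebra_simps sum.distrib)

lemma pairing_smult_left: "pairing (c *s v) u = c * pairing v u"
  by (simp add: pairing_def sum_distrib_left algebra_simps)

lemma pairing_0 [simp]: "pairing v 0 = 0" "pairing 0 v = 0"
  by (simp_all add: pairing_def)

lemma pairing_axis: "pairing v (axis i 1) = v $ i"
  by (simp add: pairing_def axis_def if_distrib cong: if_cong)

lemma pairing_nonneg: "v \<in> sigma \<Longrightarrow> 0 \<le> u \<Longrightarrow> 0 \<le> pairing v u"
  by (auto simp: pairing_def sigma_def less_eq_vec_def intro!: sum_nonneg)

lemma pairing_pos:
  assumes "\<forall>i. 0 < v $ i" "0 \<le> u" "u \<noteq> 0"
  shows "0 < pairing v u"
proof -
  obtain i where "u $ i \<noteq> 0" using assms(3) by (auto simp: vec_eq_iff)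
  hence "0 < u $ i" using assms(2) by (auto simp: less_eq_vec_def order_less_le)
  thus ?thesis unfolding pairing_def
    by (intro sum_pos2[of _ i]) (use assms in \<open>auto simp: less_eq_vec_def less_imp_le\<close>)
qed

lemma grid_nonneg: "u \<in> grid n \<Longrightarrow> 0 \<le> u"
  by (simp add: grid_def less_eq_vec_def)

text \<open>The common denominator of the coordinates is the one already found when
  \<open>puis_monom u\<close> was shown to be a series.\<close>

lemma ex_grid:
  fixes u :: "rat ^ 'd::finite"
  assumes "0 \<le> u" obtains n where "n > 0" "u \<in> grid n"
proof -
  obtain n where n: "n > 0" "on_grid n (puis_coeff (puis_monom u))"
    using puis_coeff[of "puis_monom u"] by auto
  have "puis_coeff (puis_monom u) u \<noteq> 0" using assms by (simp add: puis_monom.rep_eq)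
  thus thesis using n that unfolding on_grid_def by blast
qed

text \<open>\<open>S\<close> may be infinite, but \<open>v\<close> is rational: after clearing the
  denominators of \<open>v\<close> and of the grid the pairing takes natural values on
  \<open>S\<close>, and these are well ordered.\<close>

lemma pairing_minimal:
  fixes v :: "rat ^ 'd::finite"
  assumes v: "v \<in> sigma" and n: "n > 0" and S: "S \<subseteq> grid n" "S \<noteq> {}"
  shows "\<exists>u\<in>S. \<forall>w\<in>S. pairing v u \<le> pairing v w"
proof -
  have "0 \<le> v" using v by (simp add: sigma_def less_eq_vec_def)
  then obtain q where q: "q > 0" "v \<in> grid q" using ex_grid by blast
  define m where "m u = nat \<lfloor>of_nat (q * n) * pairing v u\<rfloor>" for u
  have eq: "of_nat (m u) = of_nat (q * n) * pairing v u" if "u \<in> S" for u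
  proof -
    have u: "u \<in> grid n" using that S by auto
    have "of_nat (q * n) * pairing v u = (\<Sum>i\<in>UNIV. (of_nat q * v $ i) * (of_nat n * u $ i))"
      by (simp add: pairing_def sum_distrib_left mult_ac)
    also have "\<dots> \<in> \<int>" using u q by (intro Ints_sum) (rule Ints_mult, simp_all add: grid_def)
    finally have "of_nat (q * n) * pairing v u \<in> \<int>" .
    moreover have "0 \<le> of_nat (q * n) * pairing v u"
      using pairing_nonneg[OF v grid_nonneg[OF u]] by simp
    ultimately show ?thesis unfolding m_def by (auto elim!: Ints_cases)
  qed
  obtain u where u: "u \<in> S" "\<And>w. w \<in> S \<Longrightarrow> m u \<le> m w"
    using S(2) ex_has_least_nat[of "\<lambda>u. u \<in> S" _ m] by blast
  have "pairing v u \<le> pairing v w" if "w \<in> S" for w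
  proof -
    have "(of_nat (m u) :: rat) \<le> of_nat (m w)" using u(2)[OF that] by simp
    hence "of_nat (q * n) * pairing v u \<le> of_nat (q * n) * pairing v w"
      using eq u(1) that by simp
    thus ?thesis using q n by (simp add: zero_less_mult_iff)
  qed
  thus ?thesis using u(1) by blast
qed

lemma cauchy_single:
  assumes "\<And>s. f s \<noteq> 0 \<Longrightarrow> g (u + w - s) \<noteq> 0 \<Longrightarrow> s = u"
  shows "cauchy f g (u + w) = f u * g w"
proof -
  have "{s. f s \<noteq> 0 \<and> g (u + w - s) \<noteq> 0} \<subseteq> {u}" using assms by blast
  hence "cauchy f g (u + w) = (\<Sum>s\<in>{u}. f s * g (u + w - s))"
    unfolding cauchy_def by (intro sum.mono_neutral_left) auto
  thus ?thesis by simp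
qed

lemma cauchy_nonzeroD:
  assumes "cauchy f g u \<noteq> 0"
  obtains s where "f s \<noteq> 0" "g (u - s) \<noteq> 0"
  using assms unfolding cauchy_def by (auto elim!: sum.not_neutral_contains_not_neutral)

text \<open>A weight can be minimal at several exponents of a factor, and the corresponding products
  could cancel. Taking the lexicographically smallest of these exponents leaves a single summand in
  the coefficient at \<open>u + w\<close>.\<close>

lemma cauchy_minimal:
  fixes f g :: "rat ^ 'd::finite \<Rightarrow> complex"
  assumes n: "n > 0" and f: "on_grid n f" "f a \<noteq> 0" and g: "on_grid n g" "g b \<noteq> 0"
    and v: "v \<in> sigma"
  obtains u w where "f u \<noteq> 0" "g w \<noteq> 0" "cauchy f g (u + w) \<noteq> 0"
    "\<And>s. f s \<noteq> 0 \<Longrightarrow> pairing v u \<le> pairing v s" "\<And>s. g s \<noteq> 0 \<Longrightarrow> pairing v w \<le> pairing v s"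
proof -
  obtain "is" :: "'d list" where "is": "set is = UNIV" using finite_list[of "UNIV :: 'd set"] by auto
  define S where "S = {u. f u \<noteq> 0 \<and> (\<forall>s. f s \<noteq> 0 \<longrightarrow> pairing v u \<le> pairing v s)}"
  define T where "T = {u. g u \<noteq> 0 \<and> (\<forall>s. g s \<noteq> 0 \<longrightarrow> pairing v u \<le> pairing v s)}"
  have "S \<noteq> {}" "T \<noteq> {}"
    using pairing_minimal[OF v n, of "{u. f u \<noteq> 0}"] pairing_minimal[OF v n, of "{u. g u \<noteq> 0}"] f g
    unfolding S_def T_def on_grid_def by fast+
  moreover have "S \<subseteq> grid n" "T \<subseteq> grid n" using f g unfolding S_def T_def on_grid_def by auto
  ultimately obtain u w where uw: "u \<in> lexmin is S" "w \<in> lexmin is T"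
    using lexmin_nonempty[OF n] by (metis ex_in_conv)
  hence uST: "u \<in> S" "w \<in> T" using lexmin_subset by blast+
  have "cauchy f g (u + w) = f u * g w"
  proof (rule cauchy_single)
    fix s assume s: "f s \<noteq> 0" "g (u + w - s) \<noteq> 0"
    have "pairing v u \<le> pairing v s" "pairing v w \<le> pairing v (u + w - s)"
      using s uST unfolding S_def T_def by blast+
    hence "pairing v s = pairing v u" "pairing v (u + w - s) = pairing v w"
      by (auto simp: pairing_add pairing_diff)
    hence "s \<in> S" "u + w - s \<in> T" using uST s unfolding S_def T_def by auto
    hence "\<forall>i\<in>set is. s $ i = u $ i" by (intro lexmin_sum[OF uw, of s "u + w - s"]) simp_all
    thus "s = u" using "is" by (simp add: vec_eq_iff)
  qed
  thus thesis using that[of u w] uST unfolding S_def T_def by auto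
qed

section \<open>Coefficients and least exponents of series\<close>

lemmas puis_coeff_simps = plus_puiseux.rep_eq uminus_puiseux.rep_eq zero_puiseux.rep_eq
  one_puiseux.rep_eq times_puiseux.rep_eq

lemma puis_coeff_diff: "puis_coeff (\<phi> - \<psi>) u = puis_coeff \<phi> u - puis_coeff \<psi> u"
  unfolding minus_puiseux_def puis_coeff_simps by simp

lemma puis_coeff_sum: "puis_coeff (sum h A) u = (\<Sum>i\<in>A. puis_coeff (h i) u)"
  by (induction A rule: infinite_finite_induct) (auto simp: puis_coeff_simps)

lemma puis_eqI: "(\<And>u. puis_coeff \<phi> u = puis_coeff \<psi> u) \<Longrightarrow> \<phi> = \<psi>"
  by (simp add: puis_coeff_inject[symmetric] fun_eq_iff)

lemma puis_nonzeroD: "\<phi> \<noteq> 0 \<Longrightarrow> \<exists>u. puis_coeff \<phi> u \<noteq> 0"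
  using puis_eqI[of \<phi> 0] by (auto simp: zero_puiseux.rep_eq)

lemma puis_grid: "\<exists>n>0. \<forall>u. puis_coeff \<phi> u \<noteq> 0 \<longrightarrow> u \<in> grid n"
  using puis_coeff[of \<phi>] by (auto simp: on_grid_def)

lemma puis_coeff_nonneg: "puis_coeff \<phi> u \<noteq> 0 \<Longrightarrow> 0 \<le> u"
  using puis_grid[of \<phi>] grid_nonneg by blast

lemma puis_coeff_mult_nonzeroD:
  assumes "puis_coeff (\<phi> * \<psi>) u \<noteq> 0"
  obtains s where "puis_coeff \<phi> s \<noteq> 0" "puis_coeff \<psi> (u - s) \<noteq> 0"
  by (rule cauchy_nonzeroD[OF assms[unfolded times_puiseux.rep_eq]]) (rule that)

lemma puis_coeff_mult_0: "puis_coeff (\<phi> * \<psi>) 0 = puis_coeff \<phi> 0 * puis_coeff \<psi> 0"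
proof -
  have "s = 0" if "puis_coeff \<phi> s \<noteq> 0" "puis_coeff \<psi> (0 + 0 - s) \<noteq> 0" for s
  proof -
    have "0 \<le> s" "0 \<le> - s" using that[THEN puis_coeff_nonneg] by simp_all
    hence "s $ i = 0" for i unfolding less_eq_vec_def by (metis neg_0_le_iff_le order_antisym uminus_vec_def vec_lambda_beta zero_index)
    thus ?thesis by (simp add: vec_eq_iff)
  qed
  from cauchy_single[of "puis_coeff \<phi>" "puis_coeff \<psi>" 0 0, OF this] show ?thesis
    by (simp add: puis_coeff_simps)
qed

text \<open>The coordinatewise order is partial, so a series need not have a least exponent. Having
  one means being x^u times a series with non-zero constant term; this is the form in which
  monomials times units are handled below.\<close>

definition least :: "('d::finite) puiseux \<Rightarrow> rat ^ 'd \<Rightarrow> bool"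
  where "least \<phi> u \<longleftrightarrow> puis_coeff \<phi> u \<noteq> 0 \<and> (\<forall>w. puis_coeff \<phi> w \<noteq> 0 \<longrightarrow> u \<le> w)"

lemma least_nonneg: "least \<phi> u \<Longrightarrow> 0 \<le> u"
  using puis_coeff_nonneg by (auto simp: least_def)

lemma least_coeff_mult:
  assumes "least \<phi> a" "least \<psi> b"
  shows "puis_coeff (\<phi> * \<psi>) (a + b) = puis_coeff \<phi> a * puis_coeff \<psi> b"
proof -
  have "s = a" if "puis_coeff \<phi> s \<noteq> 0" "puis_coeff \<psi> (a + b - s) \<noteq> 0" for s
  proof -
    have "a \<le> s" "b \<le> a + b - s" using that assms by (auto simp: least_def)
    hence ab: "a $ i \<le> s $ i" "b $ i \<le> a $ i + b $ i - s $ i" for i by (simp_all add: less_eq_vec_def)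
    have "s $ i = a $ i" for i using ab(1)[of i] ab(2)[of i] by linarith
    thus ?thesis by (simp add: vec_eq_iff)
  qed
  from cauchy_single[OF this] show ?thesis by (simp add: puis_coeff_simps)
qed

lemma least_mult:
  assumes "least \<phi> a" "least \<psi> b" shows "least (\<phi> * \<psi>) (a + b)"
proof -
  have "a + b \<le> w" if w: "puis_coeff (\<phi> * \<psi>) w \<noteq> 0" for w
  proof -
    obtain s where "puis_coeff \<phi> s \<noteq> 0" "puis_coeff \<psi> (w - s) \<noteq> 0"
      using w by (rule puis_coeff_mult_nonzeroD)
    hence "a \<le> s" "b \<le> w - s" using assms by (auto simp: least_def)
    hence "a + b \<le> s + (w - s)" unfolding less_eq_vec_def vector_add_component by (intro allI add_mono) auto
    moreover have "s + (w - s) = w" by (rule add_diff_cancel_left'[THEN trans[OF add_diff_eq]])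
    ultimately show ?thesis by simp
  qed
  moreover have "puis_coeff (\<phi> * \<psi>) (a + b) \<noteq> 0"
    unfolding least_coeff_mult[OF assms] using assms by (simp add: least_def)
  ultimately show ?thesis unfolding least_def by blast
qed

lemma least_one: "least 1 0"
  by (auto simp: least_def puis_coeff_simps)

lemma least_power: "least \<phi> a \<Longrightarrow> least (\<phi> ^ k) (of_nat k *s a)"
proof (induction k)
  case (Suc k)
  have "of_nat (Suc k) *s a = a + of_nat k *s a" by (simp add: vec_eq_iff algebra_simps)
  thus ?case using least_mult[OF Suc.prems Suc.IH[OF Suc.prems]] by simp
qed (simp add: least_one)

lemma least_prod:
  "finite A \<Longrightarrow> (\<And>i. i \<in> A \<Longrightarrow> least (h i) (a i)) \<Longrightarrow> least (\<Prod>i\<in>A. h i) (\<Sum>i\<in>A. a i)"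
  by (induction A rule: finite_induct) (auto intro: least_one least_mult)

lemma least_monom: "0 \<le> u \<Longrightarrow> least (puis_monom u) u"
  by (auto simp: least_def puis_monom.rep_eq)

lemma unit_coeff_0: "e dvd 1 \<Longrightarrow> puis_coeff e 0 \<noteq> 0"
  by (metis dvdE mult_eq_0_iff one_neq_zero puis_coeff_mult_0 one_puiseux.rep_eq)

lemma least_unit: "e dvd 1 \<Longrightarrow> least e 0"
  using unit_coeff_0 puis_coeff_nonneg by (auto simp: least_def)

lemma least_monom_mult: "0 \<le> u \<Longrightarrow> e dvd 1 \<Longrightarrow> least (puis_monom u * e) u"
  using least_mult[OF least_monom[of u] least_unit[of e]] by simp

lemma least_add:
  assumes "least \<phi> a" "\<And>w. puis_coeff \<psi> w \<noteq> 0 \<Longrightarrow> a < w"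
  shows "least (\<phi> + \<psi>) a"
proof -
  have "puis_coeff \<psi> a = 0" using assms(2)[of a] by auto
  moreover have "a \<le> w" if "puis_coeff (\<phi> + \<psi>) w \<noteq> 0" for w
  proof (cases "puis_coeff \<phi> w = 0")
    case True
    thus ?thesis using that assms(2)[of w] by (simp add: plus_puiseux.rep_eq)
  next
    case False
    thus ?thesis using assms(1) by (simp add: least_def)
  qed
  ultimately show ?thesis using assms(1) by (simp add: least_def plus_puiseux.rep_eq)
qed

text \<open>In each coordinate the minimal exponents of the factors add up to that of the product; so do
  the two vectors of minima, and only one term contributes to the coefficient at their sum.\<close>

lemma least_factor:
  assumes u: "least (\<phi> * \<psi>) u"
  obtains a b where "least \<phi> a" "least \<psi> b" "u = a + b"
proof -
  have nz: "\<phi> \<noteq> 0" "\<psi> \<noteq> 0" using u by (auto simp: least_def puis_coeff_simps cauchy_def)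
  obtain p q where pq: "puis_coeff \<phi> p \<noteq> 0" "puis_coeff \<psi> q \<noteq> 0" using nz puis_nonzeroD by metis
  obtain n where n: "n > 0" "on_grid n (puis_coeff \<phi>)" "on_grid n (puis_coeff \<psi>)"
    by (rule puis_denominator2[of \<phi> \<psi>])
  have "\<exists>x y. (\<forall>s. puis_coeff \<phi> s \<noteq> 0 \<longrightarrow> x \<le> s $ i) \<and> (\<forall>s. puis_coeff \<psi> s \<noteq> 0 \<longrightarrow> y \<le> s $ i) \<and> u $ i \<le> x + y" for i
  proof -
    have ax: "axis i 1 \<in> sigma" by (simp add: sigma_def axis_def)
    have e: "pairing (axis i 1) s = s $ i" for s
      by (simp add: pairing_def axis_def if_distrib if_distribR cong: if_cong)
    obtain s t where "puis_coeff (\<phi> * \<psi>) (s + t) \<noteq> 0" "\<And>w. puis_coeff \<phi> w \<noteq> 0 \<Longrightarrow> s $ i \<le> w $ i"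
      "\<And>w. puis_coeff \<psi> w \<noteq> 0 \<Longrightarrow> t $ i \<le> w $ i"
      using cauchy_minimal[OF n(1,2) pq(1) n(3) pq(2) ax] unfolding e puis_coeff_simps by metis
    moreover from this(1) have "u \<le> s + t" using u by (simp add: least_def)
    ultimately show ?thesis by (intro exI[of _ "s $ i"] exI[of _ "t $ i"]) (simp add: less_eq_vec_def)
  qed
  then obtain a b where ab: "\<And>i s. puis_coeff \<phi> s \<noteq> 0 \<Longrightarrow> a i \<le> s $ i"
    "\<And>i s. puis_coeff \<psi> s \<noteq> 0 \<Longrightarrow> b i \<le> s $ i" "\<And>i. u $ i \<le> a i + b i" by metis
  obtain s where s: "puis_coeff \<phi> s \<noteq> 0" "puis_coeff \<psi> (u - s) \<noteq> 0"
    using u puis_coeff_mult_nonzeroD unfolding least_def by metis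
  have "s $ i = a i \<and> (u - s) $ i = b i" for i
    using ab(1)[OF s(1), of i] ab(2)[OF s(2), of i] ab(3)[of i] by simp
  hence "\<forall>w. puis_coeff \<phi> w \<noteq> 0 \<longrightarrow> s \<le> w" "\<forall>w. puis_coeff \<psi> w \<noteq> 0 \<longrightarrow> u - s \<le> w"
    unfolding less_eq_vec_def using ab(1,2) by metis+
  thus thesis using s that[of s "u - s"] by (simp add: least_def)
qed

lemma puis_coeff_monom_mult:
  assumes "0 \<le> a"
  shows "puis_coeff (puis_monom a * \<phi>) (a + w) = puis_coeff \<phi> w"
proof -
  have "s = a" if "puis_coeff (puis_monom a) s \<noteq> 0" for s
    using that by (simp add: puis_monom.rep_eq split: if_splits)
  from cauchy_single[OF this] show ?thesis using assms
    by (simp add: times_puiseux.rep_eq puis_monom.rep_eq)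
qed

text \<open>Dividing by x^a keeps all exponents on the same grid, because \<open>a\<close> itself
  belongs to the support.\<close>

lemma least_factor_monom:
  assumes a: "least \<phi> a" obtains e where "\<phi> = puis_monom a * e" "puis_coeff e 0 \<noteq> 0"
proof -
  obtain n where n: "n > 0" "\<And>u. puis_coeff \<phi> u \<noteq> 0 \<Longrightarrow> u \<in> grid n" using puis_grid by metis
  have "on_grid n (\<lambda>w. puis_coeff \<phi> (a + w))"
    unfolding on_grid_def
  proof (intro allI impI)
    fix w assume w: "puis_coeff \<phi> (a + w) \<noteq> 0"
    have "a \<le> a + w" using a w unfolding least_def by blast
    hence "0 \<le> w" by (simp add: less_eq_vec_def)
    moreover have "of_nat n * w $ i \<in> \<int>" for i
    proof -
      have "of_nat n * (a + w) $ i \<in> \<int>" "of_nat n * a $ i \<in> \<int>"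
        using n(2)[OF w] n(2)[of a] a unfolding grid_def least_def by blast+
      from Ints_diff[OF this] show ?thesis by (simp add: ring_distribs)
    qed
    ultimately show "w \<in> grid n" by (simp add: grid_def less_eq_vec_def)
  qed
  hence e: "puis_coeff (Abs_puiseux (\<lambda>w. puis_coeff \<phi> (a + w))) = (\<lambda>w. puis_coeff \<phi> (a + w))"
    using n(1) by (intro Abs_puiseux_inverse) blast
  have "\<phi> = puis_monom a * Abs_puiseux (\<lambda>w. puis_coeff \<phi> (a + w))"
  proof (rule puis_eqI)
    fix u
    show "puis_coeff \<phi> u = puis_coeff (puis_monom a * Abs_puiseux (\<lambda>w. puis_coeff \<phi> (a + w))) u"
      using puis_coeff_monom_mult[OF least_nonneg[OF a], of "Abs_puiseux (\<lambda>w. puis_coeff \<phi> (a + w))" "u - a"] e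
      by simp
  qed
  moreover have "puis_coeff (Abs_puiseux (\<lambda>w. puis_coeff \<phi> (a + w))) 0 \<noteq> 0"
    using a e by (simp add: least_def)
  ultimately show thesis using that by blast
qed

lemma puis_monom_add:
  assumes "0 \<le> a" "0 \<le> b" shows "puis_monom (a + b) = puis_monom a * puis_monom b"
proof (rule puis_eqI)
  fix u
  have "0 \<le> a + b" using assms by (auto simp: less_eq_vec_def)
  thus "puis_coeff (puis_monom (a + b)) u = puis_coeff (puis_monom a * puis_monom b) u"
    using puis_coeff_monom_mult[OF assms(1), of "puis_monom b" "u - a"] assms
    by (simp add: puis_monom.rep_eq diff_eq_eq add.commute)
qed

text \<open>Both factors of a monomial times a unit have a least exponent. That the cofactor
  \<open>e'\<close> is a unit is not read off from its constant term: it divides the unit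
  \<open>e\<close> once the monomials are cancelled.\<close>

lemma dvd_monom_unit:
  assumes "\<phi> dvd puis_monom u * e" "e dvd 1" "0 \<le> u"
  obtains a e' where "least \<phi> a" "e' dvd 1" "\<phi> = puis_monom a * e'"
proof -
  obtain \<psi> where \<psi>: "puis_monom u * e = \<phi> * \<psi>" using assms(1) by (rule dvdE)
  have "least (\<phi> * \<psi>) u" using least_monom_mult[OF assms(3,2)] \<psi> by simp
  then obtain a b where ab: "least \<phi> a" "least \<psi> b" "u = a + b" by (rule least_factor)
  obtain e1 where e1: "\<phi> = puis_monom a * e1" using ab(1) by (rule least_factor_monom)
  obtain e2 where e2: "\<psi> = puis_monom b * e2" using ab(2) by (rule least_factor_monom)
  have "puis_monom u * e = puis_monom u * (e1 * e2)"
    unfolding \<psi> unfolding e1 e2 ab(3) puis_monom_add[OF ab(1,2)[THEN least_nonneg]]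
    by (simp only: mult_ac)
  moreover have "puis_monom u \<noteq> 0"
    using least_monom[OF assms(3)] by (auto simp: least_def puis_coeff_simps)
  ultimately have "e = e1 * e2" by simp
  hence "e1 * e2 dvd 1" using assms(2) by simp
  hence "e1 dvd 1" by (rule dvd_mult_left)
  thus thesis using that ab(1) e1 by blast
qed

section \<open>Characters of lattices\<close>

text \<open>Kept polymorphic because it is used for lattices in Q^d and also for graphs of
  characters, which are subgroups of Q^d x Q.\<close>

definition add_subgroup :: "'a::ab_group_add set \<Rightarrow> bool"
  where "add_subgroup L \<longleftrightarrow> 0 \<in> L \<and> (\<forall>a\<in>L. \<forall>b\<in>L. a - b \<in> L)"

lemma add_subgroupD:
  assumes "add_subgroup L"
  shows "0 \<in> L" "a \<in> L \<Longrightarrow> b \<in> L \<Longrightarrow> a - b \<in> L" "a \<in> L \<Longrightarrow> - a \<in> L"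
    "a \<in> L \<Longrightarrow> b \<in> L \<Longrightarrow> a + b \<in> L"
proof -
  show 0: "0 \<in> L" and d: "\<And>a b. a \<in> L \<Longrightarrow> b \<in> L \<Longrightarrow> a - b \<in> L"
    using assms by (auto simp: add_subgroup_def)
  show m: "- a \<in> L" if "a \<in> L" for a using d[OF 0 that] by simp
  show "a \<in> L \<Longrightarrow> b \<in> L \<Longrightarrow> a + b \<in> L" using d[OF _ m, of a b] by simp
qed

lemma add_subgroup_sum:
  "add_subgroup L \<Longrightarrow> (\<And>i. i \<in> I \<Longrightarrow> h i \<in> L) \<Longrightarrow> sum h I \<in> L"
  by (induction I rule: infinite_finite_induct) (auto intro: add_subgroupD)

text \<open>Integer multiples enter through an additive map \<open>g\<close> from the integers, so
  that the same induction serves vectors and pairs.\<close>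

lemma add_subgroup_int_mult:
  fixes g :: "int \<Rightarrow> 'a::ab_group_add"
  assumes L: "add_subgroup L" and g: "g 1 \<in> L" "\<And>j k. g (j + k) = g j + g k"
  shows "g k \<in> L"
proof (induction k rule: int_induct[where k = 0])
  case base
  have "g 0 = 0" using g(2)[of 0 0] by simp
  thus ?case using add_subgroupD(1)[OF L] by simp
next
  case (step1 i)
  show ?case unfolding g(2) using add_subgroupD(4)[OF L step1(2) g(1)] .
next
  case (step2 i)
  have "g i = g (i - 1) + g 1" using g(2)[of "i - 1" 1] by simp
  hence "g (i - 1) = g i - g 1" by simp
  thus ?case using add_subgroupD(2)[OF L step2(2) g(1)] by simp
qed

lemma add_subgroup_smult:
  fixes L :: "(rat ^ 'd) set"
  shows "add_subgroup L \<Longrightarrow> u \<in> L \<Longrightarrow> of_int k *s u \<in> L"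
  by (rule add_subgroup_int_mult[where g = "\<lambda>k. of_int k *s u"])
    (simp_all add: vec_eq_iff algebra_simps)

lemma add_subgroup_smult_pair:
  fixes P :: "((rat ^ 'd) \<times> rat) set"
  shows "add_subgroup P \<Longrightarrow> (w, q) \<in> P \<Longrightarrow> (of_int k *s w, of_int k * q) \<in> P"
  by (rule add_subgroup_int_mult[where g = "\<lambda>k. (of_int k *s w, of_int k * q)"])
    (simp_all add: vec_eq_iff algebra_simps)

text \<open>\<open>m\<close> is the order of the class of \<open>u\<close> modulo \<open>L\<close>;
  division with remainder by this least positive number gives the divisibility.\<close>

lemma add_subgroup_order:
  fixes L :: "(rat ^ 'd) set"
  assumes L: "add_subgroup L" and N: "N > 0" "of_nat N *s u \<in> L"
  obtains m where "m > 0" "of_nat m *s u \<in> L" "\<And>k. of_int k *s u \<in> L \<Longrightarrow> int m dvd k"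
proof -
  define m where "m = (LEAST m. m > 0 \<and> of_nat m *s u \<in> L)"
  have m: "m > 0 \<and> of_nat m *s u \<in> L"
    unfolding m_def by (rule LeastI[of "\<lambda>m. m > 0 \<and> of_nat m *s u \<in> L" N]) (use N in simp)
  have "int m dvd k" if k: "of_int k *s u \<in> L" for k
  proof (rule ccontr)
    assume nd: "\<not> int m dvd k"
    define r where "r = nat (k mod int m)"
    have r: "int r = k mod int m" unfolding r_def using m by simp
    have "of_int k *s u - of_int (k div int m) *s (of_nat m *s u) \<in> L"
      using add_subgroupD(2)[OF L k add_subgroup_smult[OF L]] m by blast
    also have "of_int k *s u - of_int (k div int m) *s (of_nat m *s u)
        = of_int (k - k div int m * int m) *s u"
      by (simp add: vec_eq_iff algebra_simps)
    also have "k - k div int m * int m = int r" unfolding r by (simp add: minus_div_mult_eq_mod)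
    finally have "of_nat r *s u \<in> L" by simp
    moreover have "r > 0" using nd r by (metis dvd_eq_mod_eq_0 gr0I of_nat_0)
    moreover have "r < m" using r m by (metis of_nat_0_less_iff of_nat_less_iff pos_mod_bound)
    ultimately show False using not_less_Least[of r "\<lambda>m. m > 0 \<and> of_nat m *s u \<in> L"]
      unfolding m_def by blast
  qed
  thus thesis using that m by blast
qed

text \<open>A homomorphism from a subgroup of \<open>Q^d\<close> to \<open>Q/Z\<close> is represented by the subgroup of
  \<open>Q^d \<times> Q\<close> formed by the lifts of its values; it extends because \<open>Q/Z\<close> is divisible.\<close>

lemma extend_character:
  fixes P :: "((rat ^ 'd) \<times> rat) set"
  assumes P: "add_subgroup P" and Z: "\<And>r. (0, r) \<in> P \<Longrightarrow> r \<in> \<int>"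
    and N: "N > 0" "(of_nat N *s w, s0) \<in> P"
  shows "\<exists>q P'. add_subgroup P' \<and> P \<subseteq> P' \<and> (w, q) \<in> P' \<and> (\<forall>r. (0, r) \<in> P' \<longrightarrow> r \<in> \<int>)"
proof -
  have F: "add_subgroup (fst ` P)"
    unfolding add_subgroup_def
  proof (intro conjI ballI)
    show "0 \<in> fst ` P" using add_subgroupD(1)[OF P] by force
    fix a b assume "a \<in> fst ` P" "b \<in> fst ` P"
    then obtain x y where "(a, x) \<in> P" "(b, y) \<in> P" by force
    from add_subgroupD(2)[OF P this] show "a - b \<in> fst ` P" by force
  qed
  obtain m where m: "m > 0" "of_nat m *s w \<in> fst ` P" "\<And>k. of_int k *s w \<in> fst ` P \<Longrightarrow> int m dvd k"
    using add_subgroup_order[OF F N(1), of w] imageI[OF N(2), of fst] by auto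
  obtain s where s: "(of_nat m *s w, s) \<in> P" using m(2) by force
  \<comment> \<open>Divisibility of Q/Z: \<open>s\<close> lifts the value at \<open>m w\<close>, and
    any \<open>q\<close> with \<open>m q = s\<close> may be prescribed at \<open>w\<close>. As
    \<open>m\<close> is the exact order of \<open>w\<close> modulo the domain, no other relation
    constrains \<open>q\<close>.\<close>
  define q where "q = s / of_nat m"
  define P' where "P' = {(a + of_int k *s w, r + of_int k * q) | a r k. (a, r) \<in> P}"
  have 1: "add_subgroup P'"
    unfolding add_subgroup_def
  proof (intro conjI ballI)
    show "0 \<in> P'" unfolding P'_def using add_subgroupD(1)[OF P]
      by (intro CollectI exI[of _ 0]) (simp add: zero_prod_def)
    fix x y assume "x \<in> P'" "y \<in> P'"
    then obtain a r k b r' k' where xy: "x = (a + of_int k *s w, r + of_int k * q)" "(a, r) \<in> P"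
      "y = (b + of_int k' *s w, r' + of_int k' * q)" "(b, r') \<in> P" unfolding P'_def by blast
    have "(a - b, r - r') \<in> P" using add_subgroupD(2)[OF P xy(2,4)] by simp
    moreover have "x - y = (a - b + of_int (k - k') *s w, r - r' + of_int (k - k') * q)"
      unfolding xy by (simp add: vec_eq_iff algebra_simps)
    ultimately show "x - y \<in> P'" unfolding P'_def by blast
  qed
  have 2: "P \<subseteq> P'"
  proof
    fix x assume "x \<in> P"
    thus "x \<in> P'" unfolding P'_def
      by (intro CollectI exI[of _ "fst x"] exI[of _ "snd x"] exI[of _ 0]) (simp add: vec_eq_iff prod_eq_iff)
  qed
  have "(0 + of_int 1 *s w, 0 + of_int 1 * q) \<in> P'"
    unfolding P'_def using add_subgroupD(1)[OF P] by (simp only: zero_prod_def) blast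
  hence 3: "(w, q) \<in> P'" by simp
  have 4: "r \<in> \<int>" if r: "(0, r) \<in> P'" for r
  proof -
    obtain a r' k where k: "a + of_int k *s w = 0" "r = r' + of_int k * q" "(a, r') \<in> P"
      using r unfolding P'_def by auto
    have "of_int k *s w = - a" using k(1) by (metis add.commute eq_neg_iff_add_eq_0)
    moreover have "- a \<in> fst ` P" using add_subgroupD(3)[OF P k(3)] by force
    ultimately have "int m dvd k" using m(3) by simp
    then obtain c where c: "k = int m * c" by (rule dvdE)
    have "(of_int c *s (of_nat m *s w), of_int c * s) \<in> P"
      by (rule add_subgroup_smult_pair[OF P s])
    from add_subgroupD(4)[OF P k(3) this]
    have "(a + of_int c *s (of_nat m *s w), r' + of_int c * s) \<in> P" by simp
    moreover have "of_int c *s (of_nat m *s w) = of_int k *s w" unfolding c by (simp add: vec_eq_iff)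
    moreover have "of_int c * s = of_int k * q" unfolding c q_def using m(1) by simp
    ultimately show ?thesis using Z k by simp
  qed
  show ?thesis using 1 2 3 4 by blast
qed

lemma extend_character_finite:
  fixes P :: "((rat ^ 'd) \<times> rat) set"
  assumes "finite I" "add_subgroup P" "\<And>r. (0, r) \<in> P \<Longrightarrow> r \<in> \<int>"
    and "N > 0" "\<And>i. i \<in> I \<Longrightarrow> \<exists>s. (of_nat N *s w i, s) \<in> P"
  shows "\<exists>q P'. add_subgroup P' \<and> P \<subseteq> P' \<and> (\<forall>i\<in>I. (w i, q i) \<in> P') \<and> (\<forall>r. (0, r) \<in> P' \<longrightarrow> r \<in> \<int>)"
  using assms
proof (induction I rule: finite_induct)
  case empty
  thus ?case by blast
next
  case (insert i I)
  obtain q P' where P': "add_subgroup P'" "P \<subseteq> P'" "\<forall>i\<in>I. (w i, q i) \<in> P'" "\<forall>r. (0, r) \<in> P' \<longrightarrow> r \<in> \<int>"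
    using insert.IH[OF insert.prems(1-3) insert.prems(4)[OF insertI2]] by blast
  obtain s where s: "(of_nat N *s w i, s) \<in> P" using insert.prems by blast
  hence s': "(of_nat N *s w i, s) \<in> P'" using P' by blast
  obtain q' P'' where P'': "add_subgroup P''" "P' \<subseteq> P''" "(w i, q') \<in> P''" "\<forall>r. (0, r) \<in> P'' \<longrightarrow> r \<in> \<int>"
    using extend_character[OF P'(1) P'(4)[rule_format] insert.prems(3) s'] by blast
  have "\<forall>j\<in>insert i I. (w j, (q(i := q')) j) \<in> P''" using P'' P' insert.hyps by auto
  thus ?case using P'' P' by (intro exI[of _ "q(i := q')"] exI[of _ P'']) auto
qed

text \<open>Since \<open>m\<close> is the order of \<open>u\<close> modulo \<open>L\<close>, sending
  \<open>L\<close> to 0 and \<open>u\<close> to 1/m defines a character with values in Q/Z. Extended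
  to (1/n) Z^d, which contains \<open>L\<close> and \<open>u\<close>, it is still trivial on Z^d,
  and such characters are pairings with integral vectors.\<close>

lemma separating_character:
  fixes L :: "(rat ^ 'd::finite) set"
  assumes L: "add_subgroup L" and Z: "\<And>u. (\<forall>i. u $ i \<in> \<int>) \<Longrightarrow> u \<in> L"
    and n: "n > 0" "\<And>w i. w \<in> insert u L \<Longrightarrow> of_nat n * w $ i \<in> \<int>"
    and m: "m > 0" "of_nat m *s u \<in> L" "\<And>k. of_int k *s u \<in> L \<Longrightarrow> int m dvd k"
  obtains t where "\<forall>i. t $ i \<in> \<int>" "\<And>l. l \<in> L \<Longrightarrow> pairing t l \<in> \<int>" "pairing t u - 1 / of_nat m \<in> \<int>"
proof -
  \<comment> \<open>The graph of the character on L + Z u: all rational lifts of its values.\<close>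
  define P :: "((rat ^ 'd) \<times> rat) set"
    where "P = {(l + of_int k *s u, of_int k / of_nat m + of_int z) | l k z. l \<in> L}"
  have PI: "(l + of_int k *s u, of_int k / of_nat m + of_int z) \<in> P" if "l \<in> L" for l k z
    unfolding P_def using that by blast
  have P: "add_subgroup P"
    unfolding add_subgroup_def
  proof (intro conjI ballI)
    show "0 \<in> P" using PI[OF add_subgroupD(1)[OF L], of 0 0] by (simp add: zero_prod_def vec_eq_iff)
    fix x y assume "x \<in> P" "y \<in> P"
    then obtain l k z l' k' z' where xy: "x = (l + of_int k *s u, of_int k / of_nat m + of_int z)" "l \<in> L"
      "y = (l' + of_int k' *s u, of_int k' / of_nat m + of_int z')" "l' \<in> L" unfolding P_def by blast
    have "x - y = ((l - l') + of_int (k - k') *s u, of_int (k - k') / of_nat m + of_int (z - z'))"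
      unfolding xy by (simp add: vec_eq_iff algebra_simps diff_divide_distrib)
    thus "x - y \<in> P" using PI[OF add_subgroupD(2)[OF L xy(2,4)]] by metis
  qed
  have PZ: "r \<in> \<int>" if r: "(0, r) \<in> P" for r
  proof -
    obtain l k z where k: "l + of_int k *s u = 0" "r = of_int k / of_nat m + of_int z" "l \<in> L"
      using r unfolding P_def by auto
    have "of_int k *s u = - l" using k(1) by (metis add.commute eq_neg_iff_add_eq_0)
    hence "int m dvd k" using m(3) add_subgroupD(3)[OF L k(3)] by simp
    then obtain c where "k = int m * c" by (rule dvdE)
    hence "r = of_int (c + z)" using k(2) m(1) by simp
    thus ?thesis by (metis Ints_of_int)
  qed
  \<comment> \<open>Generators of (1/n) Z^d; their \<open>n\<close>-th multiples are the unit
    vectors, which lie in \<open>L\<close>.\<close>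
  define w :: "'d \<Rightarrow> rat ^ 'd" where "w i = axis i (1 / of_nat n)" for i
  have wn: "of_nat n *s w i = axis i 1" for i using n(1) by (simp add: w_def vec_eq_iff axis_def)
  have axL: "axis i 1 \<in> L" for i by (rule Z) (simp add: axis_def)
  have ax: "(axis i 1, 0) \<in> P" for i
    using PI[OF axL, of i 0 0] by (simp add: vec_eq_iff)
  obtain q P' where P': "add_subgroup P'" "P \<subseteq> P'" "\<And>i. (w i, q i) \<in> P'" "\<And>r. (0, r) \<in> P' \<Longrightarrow> r \<in> \<int>"
    using extend_character_finite[OF finite[of "UNIV :: 'd set"] P PZ n(1), of w] ax
    unfolding wn by (metis UNIV_I)
  \<comment> \<open>By additivity the extended character is the pairing with the vector of the
    \<open>n q_i\<close>. These are lifts of its values at the unit vectors, where it is trivial, so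
    they are integers.\<close>
  define t :: "rat ^ 'd" where "t = (\<chi> i. of_nat n * q i)"
  have tZ: "t $ i \<in> \<int>" for i
  proof -
    have "(of_int (int n) *s w i, of_int (int n) * q i) \<in> P'"
      by (rule add_subgroup_smult_pair[OF P'(1,3)])
    hence "(axis i 1, t $ i) \<in> P'" by (simp add: wn t_def)
    from add_subgroupD(2)[OF P'(1) this subsetD[OF P'(2) ax[of i]]]
    show ?thesis using P'(4) by simp
  qed
  have grid: "(x, pairing t x) \<in> P'" if x: "\<And>i. of_nat n * x $ i \<in> \<int>" for x
  proof -
    define k where "k i = \<lfloor>of_nat n * x $ i\<rfloor>" for i
    have k: "of_int (k i) = of_nat n * x $ i" for i
      unfolding k_def using x[of i] by (simp add: of_int_floor)
    have "(\<Sum>i\<in>UNIV. (of_int (k i) *s w i, of_int (k i) * q i)) \<in> P'"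
      by (intro add_subgroup_sum[OF P'(1)] add_subgroup_smult_pair[OF P'(1,3)])
    moreover have "(\<Sum>i\<in>UNIV. (of_int (k i) *s w i, of_int (k i) * q i))
        = (\<Sum>i\<in>UNIV. of_int (k i) *s w i, \<Sum>i\<in>UNIV. of_int (k i) * q i)"
      by (rule sum_prod)
    moreover have "(\<Sum>i\<in>UNIV. of_int (k i) *s w i) = x"
      using n(1) by (simp add: vec_eq_iff k w_def axis_def if_distrib if_distribR cong: if_cong)
    moreover have "(\<Sum>i\<in>UNIV. of_int (k i) * q i) = pairing t x"
      by (simp add: pairing_def t_def k mult_ac)
    ultimately show ?thesis by simp
  qed
  have LP: "(l, 0) \<in> P'" if "l \<in> L" for l
    using subsetD[OF P'(2) PI[OF that, of 0 0]] by (simp add: vec_eq_iff)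
  have "pairing t l \<in> \<int>" if "l \<in> L" for l
    using add_subgroupD(2)[OF P'(1) grid[of l] LP[OF that]] n(2)[of l] that P'(4) by simp
  moreover have "pairing t u - 1 / of_nat m \<in> \<int>"
  proof -
    have "(u, 1 / of_nat m) \<in> P'"
      using subsetD[OF P'(2) PI[OF add_subgroupD(1)[OF L], of 1 0]] by (simp add: vec_eq_iff)
    from add_subgroupD(2)[OF P'(1) grid[of u] this] show ?thesis using n(2)[of u] P'(4) by simp
  qed
  ultimately show thesis using that tZ by blast
qed

section \<open>Conjugates of a branch\<close>

definition chi :: "rat ^ 'd::finite \<Rightarrow> rat ^ 'd \<Rightarrow> complex"
  where "chi t u = cis (2 * pi * real_of_rat (pairing t u))"

lemma chi_add: "chi t (u + w) = chi t u * chi t w" "chi (s + t) u = chi s u * chi t u"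
  by (simp_all add: chi_def pairing_add pairing_add_left of_rat_add cis_mult ring_distribs)

lemma chi_0 [simp]: "chi 0 u = 1" "chi t 0 = 1"
  by (simp_all add: chi_def)

lemma chi_nonzero [simp]: "chi t u \<noteq> 0"
  by (simp add: chi_def)

lemma chi_eq_1_iff: "chi t u = 1 \<longleftrightarrow> pairing t u \<in> \<int>"
proof
  assume "chi t u = 1"
  hence "cos (2 * pi * real_of_rat (pairing t u)) = 1" by (simp add: chi_def complex_eq_iff)
  then obtain n :: int where "2 * pi * real_of_rat (pairing t u) = of_int n * 2 * pi"
    by (subst (asm) cos_one_2pi_int) blast
  hence "real_of_rat (pairing t u) = real_of_rat (of_int n)" by simp
  hence "pairing t u = of_int n" by (simp only: of_rat_eq_iff)
  thus "pairing t u \<in> \<int>" by simp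
next
  assume "pairing t u \<in> \<int>"
  then obtain n where "pairing t u = of_int n" by (rule Ints_cases)
  thus "chi t u = 1" by (simp add: chi_def)
qed

lift_definition act :: "rat ^ 'd \<Rightarrow> ('d::finite) puiseux \<Rightarrow> 'd puiseux"
  is "\<lambda>t f u. chi t u * f u"
  by (auto simp: on_grid_def)

lemma puis_coeff_act: "puis_coeff (act t \<phi>) u = chi t u * puis_coeff \<phi> u"
  by (simp add: act.rep_eq)

lemma act_0 [simp]: "act 0 \<phi> = \<phi>"
  by (rule puis_eqI) (simp add: puis_coeff_act)

lemma act_act: "act s (act t \<phi>) = act (s + t) \<phi>"
  by (rule puis_eqI) (simp add: puis_coeff_act chi_add)

lemma act_mult: "act t (\<phi> * \<psi>) = act t \<phi> * act t \<psi>"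
proof (rule puis_eqI)
  fix u
  have "chi t s * a * (chi t (u - s) * b) = chi t u * (a * b)" for s a b
    using chi_add(1)[of t s "u - s"] by simp
  hence "(\<Sum>s | a s \<noteq> 0 \<and> b (u - s) \<noteq> 0. chi t s * a s * (chi t (u - s) * b (u - s)))
      = (\<Sum>s | a s \<noteq> 0 \<and> b (u - s) \<noteq> 0. chi t u * (a s * b (u - s)))" for a b
    by (simp only:)
  thus "puis_coeff (act t (\<phi> * \<psi>)) u = puis_coeff (act t \<phi> * act t \<psi>) u"
    by (simp add: times_puiseux.rep_eq puis_coeff_act cauchy_def sum_distrib_left)
qed

interpretation act: comm_ring_hom "act t"
  by unfold_locales
    (auto intro!: puis_eqI simp: act_mult puis_coeff_act plus_puiseux.rep_eq zero_puiseux.rep_eq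
      one_puiseux.rep_eq ring_distribs)

interpretation act_poly: map_poly_comm_ring_hom "act t" ..

lemma act_fixed_iff: "act t \<phi> = \<phi> \<longleftrightarrow> (\<forall>u\<in>puis_supp \<phi>. pairing t u \<in> \<int>)"
proof -
  have "act t \<phi> = \<phi> \<longleftrightarrow> (\<forall>u. chi t u * puis_coeff \<phi> u = puis_coeff \<phi> u)"
    by (metis puis_coeff_act puis_eqI)
  also have "\<dots> \<longleftrightarrow> (\<forall>u\<in>puis_supp \<phi>. chi t u = 1)" by (auto simp: puis_supp_def)
  finally show ?thesis by (simp add: chi_eq_1_iff)
qed

lemma puis_supp_act [simp]: "puis_supp (act t \<phi>) = puis_supp \<phi>"
  by (simp add: puis_supp_def puis_coeff_act)

lemma least_act [simp]: "least (act t \<phi>) u \<longleftrightarrow> least \<phi> u"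
  by (simp add: least_def puis_coeff_act)

section \<open>Series and polynomials with exponents in a given set\<close>

definition supported :: "(rat ^ 'd::finite) set \<Rightarrow> 'd puiseux set"
  where "supported L = {\<phi>. puis_supp \<phi> \<subseteq> L}"

definition polys_over :: "(rat ^ 'd::finite) set \<Rightarrow> 'd puiseux poly set"
  where "polys_over L = {p. \<forall>i. Polynomial.coeff p i \<in> supported L}"

definition additive_monoid :: "'a::monoid_add set \<Rightarrow> bool"
  where "additive_monoid L \<longleftrightarrow> 0 \<in> L \<and> (\<forall>u\<in>L. \<forall>w\<in>L. u + w \<in> L)"

lemma add_subgroup_monoid: "add_subgroup L \<Longrightarrow> additive_monoid L"
  using add_subgroupD by (auto simp: additive_monoid_def)

lemma supportedI: "(\<And>u. puis_coeff \<phi> u \<noteq> 0 \<Longrightarrow> u \<in> L) \<Longrightarrow> \<phi> \<in> supported L"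
  by (auto simp: supported_def puis_supp_def)

lemma supportedD: "\<phi> \<in> supported L \<Longrightarrow> puis_coeff \<phi> u \<noteq> 0 \<Longrightarrow> u \<in> L"
  by (auto simp: supported_def puis_supp_def)

lemma supported_0 [simp]: "0 \<in> supported L"
  by (rule supportedI) (simp add: zero_puiseux.rep_eq)

lemma supported_add: "\<phi> \<in> supported L \<Longrightarrow> \<psi> \<in> supported L \<Longrightarrow> \<phi> + \<psi> \<in> supported L"
  by (rule supportedI) (metis add_0 plus_puiseux.rep_eq supportedD)

lemma supported_uminus: "\<phi> \<in> supported L \<Longrightarrow> - \<phi> \<in> supported L"
  by (rule supportedI) (auto simp: uminus_puiseux.rep_eq dest: supportedD)

lemma supported_diff: "\<phi> \<in> supported L \<Longrightarrow> \<psi> \<in> supported L \<Longrightarrow> \<phi> - \<psi> \<in> supported L"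
  using supported_add[OF _ supported_uminus, of \<phi> L \<psi>] by simp

lemma supported_sum: "(\<And>i. i \<in> I \<Longrightarrow> h i \<in> supported L) \<Longrightarrow> sum h I \<in> supported L"
  by (induction I rule: infinite_finite_induct) (auto intro: supported_add)

lemma supported_1: "additive_monoid L \<Longrightarrow> 1 \<in> supported L"
  by (rule supportedI) (auto simp: one_puiseux.rep_eq additive_monoid_def split: if_splits)

lemma supported_mult:
  assumes "additive_monoid L" "\<phi> \<in> supported L" "\<psi> \<in> supported L" shows "\<phi> * \<psi> \<in> supported L"
proof (rule supportedI)
  fix u assume "puis_coeff (\<phi> * \<psi>) u \<noteq> 0"
  then obtain s where "puis_coeff \<phi> s \<noteq> 0" "puis_coeff \<psi> (u - s) \<noteq> 0"
    by (rule puis_coeff_mult_nonzeroD)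
  hence "s \<in> L" "u - s \<in> L" using assms supportedD by blast+
  hence "s + (u - s) \<in> L" using assms(1) unfolding additive_monoid_def by blast
  thus "u \<in> L" by simp
qed

lemma supported_power: "additive_monoid L \<Longrightarrow> \<phi> \<in> supported L \<Longrightarrow> \<phi> ^ k \<in> supported L"
  by (induction k) (auto intro: supported_1 supported_mult)

lemma polys_overI: "(\<And>i. Polynomial.coeff p i \<in> supported L) \<Longrightarrow> p \<in> polys_over L"
  by (simp add: polys_over_def)

lemma polys_overD: "p \<in> polys_over L \<Longrightarrow> Polynomial.coeff p i \<in> supported L"
  by (simp add: polys_over_def)

lemma polys_over_0 [simp]: "0 \<in> polys_over L"
  by (rule polys_overI) simp

lemma polys_over_pCons: "a \<in> supported L \<Longrightarrow> p \<in> polys_over L \<Longrightarrow> pCons a p \<in> polys_over L"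
  by (rule polys_overI) (auto simp: coeff_pCons dest: polys_overD split: nat.split)

lemma polys_over_1: "additive_monoid L \<Longrightarrow> 1 \<in> polys_over L"
  unfolding one_pCons by (intro polys_over_pCons supported_1) simp_all

lemma polys_over_add: "p \<in> polys_over L \<Longrightarrow> q \<in> polys_over L \<Longrightarrow> p + q \<in> polys_over L"
  by (rule polys_overI) (auto intro: supported_add dest: polys_overD)

lemma polys_over_diff: "p \<in> polys_over L \<Longrightarrow> q \<in> polys_over L \<Longrightarrow> p - q \<in> polys_over L"
  by (rule polys_overI) (auto intro: supported_diff dest: polys_overD)

lemma polys_over_monom: "a \<in> supported L \<Longrightarrow> Polynomial.monom a k \<in> polys_over L"
  by (rule polys_overI) auto

lemma polys_over_mult:
  "additive_monoid L \<Longrightarrow> p \<in> polys_over L \<Longrightarrow> q \<in> polys_over L \<Longrightarrow> p * q \<in> polys_over L"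
  by (rule polys_overI) (auto simp: Polynomial.coeff_mult intro!: supported_sum supported_mult dest: polys_overD)

lemma polys_over_prod:
  "additive_monoid L \<Longrightarrow> (\<And>i. i \<in> I \<Longrightarrow> h i \<in> polys_over L) \<Longrightarrow> prod h I \<in> polys_over L"
  by (induction I rule: infinite_finite_induct) (auto intro: polys_over_1 polys_over_mult)

lemma polys_over_power: "additive_monoid L \<Longrightarrow> p \<in> polys_over L \<Longrightarrow> p ^ k \<in> polys_over L"
  by (induction k) (auto intro: polys_over_1 polys_over_mult)

lemma supported_poly:
  assumes "additive_monoid L" "p \<in> polys_over L" "\<phi> \<in> supported L" shows "poly p \<phi> \<in> supported L"
  unfolding poly_altdef
  by (intro supported_sum supported_mult supported_power polys_overD assms)

text \<open>Used in two roles: as the lattice M_0 of exponents and as the group of vectors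
  \<open>t\<close> that act on series.\<close>

definition integral_points :: "(rat ^ 'd::finite) set"
  where "integral_points = {u. \<forall>i. u $ i \<in> \<int>}"

lemma add_subgroup_integral_points: "add_subgroup integral_points"
  by (auto simp: add_subgroup_def integral_points_def)

lemmas additive_monoid_integral_points = add_subgroup_monoid[OF add_subgroup_integral_points]

text \<open>Non-negativity of exponents is built into the type of series, so integrality alone cuts
  out C[[x]].\<close>

lemma pseries_eq: "pseries = supported integral_points"
proof -
  have "puis_supp \<phi> \<subseteq> grid 1 \<longleftrightarrow> puis_supp \<phi> \<subseteq> integral_points" for \<phi> :: "'a puiseux"
    using puis_coeff_nonneg[of \<phi>]
    by (auto simp: puis_supp_def grid_def integral_points_def less_eq_vec_def)
  thus ?thesis by (simp add: pseries_def supported_def)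
qed

lemma pseries_poly_eq: "pseries_poly = polys_over integral_points"
  by (simp add: pseries_poly_def polys_over_def pseries_eq)

lemma pairing_integral: "t \<in> integral_points \<Longrightarrow> u \<in> integral_points \<Longrightarrow> pairing t u \<in> \<int>"
  by (auto simp: pairing_def integral_points_def intro!: Ints_sum Ints_mult)

lemma pairing_commute: "pairing t u = pairing u t"
  by (simp add: pairing_def mult.commute)

text \<open>Galois descent: acting by the i-th unit vector detects whether the i-th coordinate of
  every exponent is an integer.\<close>

lemma act_supported_integral:
  assumes "\<And>t. t \<in> integral_points \<Longrightarrow> act t \<phi> = \<phi>" shows "\<phi> \<in> supported integral_points"
proof (rule supportedI)
  fix u assume u: "puis_coeff \<phi> u \<noteq> 0"
  have "u $ i \<in> \<int>" for i
  proof -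
    have "axis i 1 \<in> integral_points" by (simp add: integral_points_def axis_def)
    hence "pairing (axis i 1) u \<in> \<int>" using assms u by (auto simp: act_fixed_iff puis_supp_def)
    thus ?thesis by (simp add: pairing_commute pairing_axis)
  qed
  thus "u \<in> integral_points" by (simp add: integral_points_def)
qed

lemma act_integral_fixed:
  "t \<in> integral_points \<Longrightarrow> \<phi> \<in> supported integral_points \<Longrightarrow> act t \<phi> = \<phi>"
  unfolding act_fixed_iff supported_def using pairing_integral by blast

lemma act_poly_integral_fixed:
  "t \<in> integral_points \<Longrightarrow> p \<in> polys_over integral_points \<Longrightarrow> map_poly (act t) p = p"
  by (rule poly_eqI) (simp add: act_integral_fixed polys_overD)

text \<open>As \<open>m\<close> is monic no coefficient is ever divided, so the quotient and the
  remainder keep their exponents in \<open>L\<close>.\<close>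

lemma monic_division:
  assumes L: "additive_monoid L" and m: "m \<in> polys_over L" "lead_coeff m = 1" "0 < Polynomial.degree m"
    and p: "p \<in> polys_over L"
  shows "\<exists>q r. q \<in> polys_over L \<and> r \<in> polys_over L \<and> p = q * m + r \<and>
    Polynomial.degree r < Polynomial.degree m"
  using p
proof (induction "Polynomial.degree p" arbitrary: p rule: less_induct)
  case less
  show ?case
  proof (cases "Polynomial.degree p < Polynomial.degree m")
    case True
    thus ?thesis using less.prems by (intro exI[of _ 0] exI[of _ p]) simp
  next
    case False
    define c where "c = Polynomial.monom (lead_coeff p) (Polynomial.degree p - Polynomial.degree m)"
    have cL: "c \<in> polys_over L" unfolding c_def using less.prems by (intro polys_over_monom polys_overD)
    have "Polynomial.degree c \<le> Polynomial.degree p - Polynomial.degree m"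
      unfolding c_def by (rule Polynomial.degree_monom_le)
    hence dc: "Polynomial.degree (c * m) \<le> Polynomial.degree p"
      using Polynomial.degree_mult_le[of c m] False by linarith
    have "Polynomial.coeff (c * m) (Polynomial.degree p) = lead_coeff p"
      using False m(2) by (simp add: c_def coeff_monom_mult)
    hence "Polynomial.coeff (p - c * m) (Polynomial.degree p) = 0" by simp
    moreover have "Polynomial.degree (p - c * m) \<le> Polynomial.degree p"
      using dc by (intro degree_diff_le) auto
    ultimately have "Polynomial.degree (p - c * m) < Polynomial.degree p"
      using False m(3) by (metis degree_0 leading_coeff_0_iff linorder_not_less order_le_less)
    from less.hyps[OF this polys_over_diff[OF less.prems polys_over_mult[OF L cL m(1)]]]
    obtain q r where qr: "q \<in> polys_over L" "r \<in> polys_over L" "p - c * m = q * m + r"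
      "Polynomial.degree r < Polynomial.degree m" by blast
    have "p = (q + c) * m + r" using qr(3) by (simp add: algebra_simps)
    thus ?thesis using qr cL polys_over_add by blast
  qed
qed

text \<open>A row of the Sylvester matrix, paired with the powers of \<open>z\<close>, gives a power of \<open>z\<close> times
  \<open>p(z)\<close> or \<open>q(z)\<close>; so does \<open>det\<close> times the last power \<open>z^0\<close>, by the adjugate.\<close>

lemma dvd_resultant:
  fixes p q :: "'a::comm_ring_1 poly"
  assumes "c dvd poly p z" "c dvd poly q z" "0 < Polynomial.degree p"
  shows "c dvd resultant p q"
proof -
  define m n N where mn: "m = Polynomial.degree p" "n = Polynomial.degree q" "N = m + n"
  define S where "S = sylvester_mat p q"
  have S: "S \<in> carrier_mat N N" unfolding S_def mn by (rule sylvester_carrier_mat)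
  have N: "0 < N" using assms(3) mn by simp
  \<comment> \<open>A row lists the coefficients of y^(k+1) h at the degrees N - j, each one more
    than the exponent of the power of z paired with it. Hence \<open>Suc k\<close> on the left and
    \<open>k\<close> on the right.\<close>
  have ev: "(\<Sum>j<N. Polynomial.coeff (Polynomial.monom 1 (Suc k) * h) (N - j) * z ^ (N - 1 - j)) = z ^ k * poly h z"
    if "k + Polynomial.degree h < N" for k and h :: "'a poly"
  proof -
    have "Polynomial.degree (Polynomial.monom 1 k * h) \<le> k + Polynomial.degree h"
      by (rule order_trans[OF Polynomial.degree_mult_le]) (simp add: Polynomial.degree_monom_le)
    hence d: "Polynomial.degree (Polynomial.monom 1 k * h) \<le> N - 1" using that by linarith
    have "(\<Sum>j<N. Polynomial.coeff (Polynomial.monom 1 (Suc k) * h) (N - j) * z ^ (N - 1 - j))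
      = (\<Sum>j<N. Polynomial.coeff (Polynomial.monom 1 k * h) (N - 1 - j) * z ^ (N - 1 - j))"
      by (intro sum.cong refl) (auto simp: coeff_monom_mult)
    also have "\<dots> = (\<Sum>j<N. Polynomial.coeff (Polynomial.monom 1 k * h) j * z ^ j)"
      using sum.nat_diff_reindex[of "\<lambda>j. Polynomial.coeff (Polynomial.monom 1 k * h) j * z ^ j" N] by simp
    also have "\<dots> = (\<Sum>j\<le>N - 1. Polynomial.coeff (Polynomial.monom 1 k * h) j * z ^ j)"
      using N by (intro sum.cong) auto
    also have "\<dots> = poly (Polynomial.monom 1 k * h) z"
      unfolding poly_altdef using d by (intro sum.mono_neutral_right) (auto simp: Polynomial.coeff_eq_0)
    finally show ?thesis by (simp add: poly_monom)
  qed
  have row: "c dvd (\<Sum>j<N. S $$ (i, j) * z ^ (N - 1 - j))" if i: "i < N" for i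
  proof (cases "i < n")
    case True
    have "n - i = Suc (n - Suc i)" using True by simp
    hence "(\<Sum>j<N. S $$ (i, j) * z ^ (N - 1 - j))
      = (\<Sum>j<N. Polynomial.coeff (Polynomial.monom 1 (Suc (n - Suc i)) * p) (N - j) * z ^ (N - 1 - j))"
      using True i by (intro sum.cong refl) (simp add: S_def sylvester_index_mat2 mn)
    also have "\<dots> = z ^ (n - Suc i) * poly p z" using True by (intro ev) (simp add: mn)
    finally show ?thesis using assms(1) by simp
  next
    case False
    have "N - i = Suc (N - Suc i)" using i by simp
    hence "(\<Sum>j<N. S $$ (i, j) * z ^ (N - 1 - j))
      = (\<Sum>j<N. Polynomial.coeff (Polynomial.monom 1 (Suc (N - Suc i)) * q) (N - j) * z ^ (N - 1 - j))"
      using False i by (intro sum.cong refl) (simp add: S_def sylvester_index_mat2 mn)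
    also have "\<dots> = z ^ (N - Suc i) * poly q z" using False i by (intro ev) (simp add: mn)
    finally show ?thesis using assms(2) by simp
  qed
  note adj = adj_mat[OF S]
  have "det S = (\<Sum>j<N. (det S \<cdot>\<^sub>m 1\<^sub>m N) $$ (N - 1, j) * z ^ (N - 1 - j))"
    using N by (subst sum.remove[of _ "N - 1"]) (auto intro!: sum.neutral)
  also have "\<dots> = (\<Sum>j<N. (\<Sum>i<N. adj_mat S $$ (N - 1, i) * S $$ (i, j)) * z ^ (N - 1 - j))"
    unfolding adj(3)[symmetric] using adj(1) S N
    by (intro sum.cong refl) (auto simp: scalar_prod_def atLeast0LessThan)
  also have "\<dots> = (\<Sum>i<N. adj_mat S $$ (N - 1, i) * (\<Sum>j<N. S $$ (i, j) * z ^ (N - 1 - j)))"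
    unfolding sum_distrib_right sum_distrib_left by (subst sum.swap) (simp add: mult.assoc)
  finally have "det S = \<dots>" .
  moreover have "c dvd \<dots>" by (rule dvd_sum, rule dvd_mult, rule row) simp
  ultimately show ?thesis by (simp add: resultant_def S_def)
qed

section \<open>Roots of a quasi-ordinary polynomial\<close>

lemma prod_roots_dvd:
  fixes p :: "'a::idom poly"
  assumes "finite Z" "\<And>z. z \<in> Z \<Longrightarrow> poly p z = 0"
  shows "(\<Prod>z\<in>Z. [:- z, 1:]) dvd p"
  using assms
proof (induction Z rule: finite_induct)
  case (insert z Z)
  then obtain q where q: "p = (\<Prod>z\<in>Z. [:- z, 1:]) * q" by (auto elim: dvdE)
  have "poly (\<Prod>z\<in>Z. [:- z, 1:]) z \<noteq> 0"
    using insert.hyps by (auto simp: poly_prod)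
  hence "poly q z = 0" using insert.prems[of z] q by simp
  then obtain r where "q = [:- z, 1:] * r" by (auto simp: poly_eq_0_iff_dvd elim: dvdE)
  hence "p = [:- z, 1:] * (\<Prod>z\<in>Z. [:- z, 1:]) * r" using q by (simp only: mult_ac)
  thus ?case unfolding prod.insert[OF insert.hyps] by (rule dvdI)
qed simp

lemma degree_prod_roots:
  fixes Z :: "'a::idom set"
  shows "lead_coeff (\<Prod>z\<in>Z. [:- z, 1:]) = 1" "Polynomial.degree (\<Prod>z\<in>Z. [:- z, 1:]) = card Z"
  by (simp add: Polynomial.lead_coeff_prod) (simp add: degree_prod_eq_sum_degree)

text \<open>By its degree \<open>p\<close> is no unit, so it cannot be a proper factor and
  \<open>f\<close> divides \<open>p\<close> as well. Then \<open>q\<close> is a constant, and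
  comparing leading coefficients makes it 1.\<close>

lemma irreducible_eq_factor:
  fixes f p :: "('d::finite) puiseux poly"
  assumes f: "ring_irreducible\<^bsub>subring_on pseries_poly\<^esub> f" "lead_coeff f = 1"
    and p: "p \<in> pseries_poly" "lead_coeff p = 1" "0 < Polynomial.degree p"
    and q: "q \<in> pseries_poly" "f = p * q"
  shows "f = p"
proof -
  let ?R = "subring_on (pseries_poly :: 'd puiseux poly set)"
  have irr: "f \<noteq> 0" "\<And>b. b \<in> carrier ?R \<Longrightarrow> properfactor ?R b f \<Longrightarrow> b \<in> Units ?R"
    using f(1) by (auto simp: ring_irreducible_def irreducible_def subring_on_def)
  have "p divides\<^bsub>?R\<^esub> f" using q by (auto simp: factor_def subring_on_def)
  moreover have "p \<notin> Units ?R"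
  proof
    assume "p \<in> Units ?R"
    then obtain r where r: "p * r = 1" by (auto simp: Units_def subring_on_def)
    hence "p \<noteq> 0" "r \<noteq> 0" by auto
    hence "Polynomial.degree p + Polynomial.degree r = 0"
      using r by (metis Polynomial.degree_mult_eq Polynomial.degree_1)
    thus False using p(3) by simp
  qed
  ultimately have "f divides\<^bsub>?R\<^esub> p"
    using irr(2)[of p] p(1) by (auto simp: properfactor_def subring_on_def)
  then obtain c where c: "p = f * c" by (auto simp: factor_def subring_on_def)
  have "f * (c * q) = f * 1" unfolding mult.assoc[symmetric] c[symmetric] q(2)[symmetric] by simp
  hence "c * q = 1" by (rule iffD1[OF mult_left_cancel[OF irr(1)]])
  hence "c \<noteq> 0" "q \<noteq> 0" by auto
  hence "Polynomial.degree c + Polynomial.degree q = 0"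
    using \<open>c * q = 1\<close> by (metis Polynomial.degree_mult_eq Polynomial.degree_1)
  then obtain a where a: "q = [:a:]" using degree_eq_zeroE by auto
  have "lead_coeff f = lead_coeff p * lead_coeff q" unfolding q(2) by (rule Polynomial.lead_coeff_mult)
  hence "a = 1" using f(2) p(2) a by simp
  thus ?thesis using q(2) a by simp
qed

text \<open>The monic polynomial \<open>p\<close> whose roots are the conjugates of
  \<open>\<zeta>\<close> has coefficients fixed by every integral vector, so it lies in C[[x]][y].
  It divides \<open>f\<close>, and irreducibility gives \<open>f = p\<close>.\<close>

lemma quasi_ordinary_roots:
  fixes f :: "('d::finite) puiseux poly"
  assumes f: "quasi_ordinary f" and \<zeta>: "poly f \<zeta> = 0" and z: "poly f z = 0"
  shows "\<exists>t\<in>integral_points. z = act t \<zeta>"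
proof -
  define Z where "Z = (\<lambda>t. act t \<zeta>) ` integral_points"
  define p where "p = (\<Prod>z\<in>Z. [:- z, 1:])"
  have fW: "f \<in> polys_over integral_points" "lead_coeff f = 1"
    and irr: "ring_irreducible\<^bsub>subring_on pseries_poly\<^esub> f"
    using f by (auto simp: quasi_ordinary_def weierstrass_def pseries_poly_eq)
  have rootZ: "poly f z = 0" if z: "z \<in> Z" for z
  proof -
    obtain t where t: "t \<in> integral_points" "z = act t \<zeta>" using z unfolding Z_def by blast
    have "poly (map_poly (act t) f) (act t \<zeta>) = 0" using \<zeta> by simp
    thus ?thesis using t act_poly_integral_fixed[OF t(1) fW(1)] by simp
  qed
  have "f \<noteq> 0" using fW(2) by auto
  hence fin: "finite Z" using rootZ by (intro finite_subset[OF _ poly_roots_finite]) auto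
  have "0 \<in> (integral_points :: (rat ^ 'd) set)" by (simp add: integral_points_def)
  hence \<zeta>Z: "\<zeta> \<in> Z" unfolding Z_def using act_0[of \<zeta>] by (metis imageI)
  have lead: "lead_coeff p = 1" unfolding p_def by (rule degree_prod_roots)
  have deg: "0 < Polynomial.degree p"
    unfolding p_def degree_prod_roots using fin \<zeta>Z by (simp add: card_gt_0_iff) blast
  have pL: "p \<in> polys_over integral_points"
  proof (rule polys_overI, rule act_supported_integral)
    fix i and t :: "rat ^ 'd" assume t: "t \<in> integral_points"
    have "act t ` Z = Z"
    proof
      have sub: "act s ` Z \<subseteq> Z" if s: "s \<in> integral_points" for s
      proof -
        have "act s (act t' \<zeta>) \<in> Z" if "t' \<in> integral_points" for t'
        proof -
          have "s + t' \<in> integral_points"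
            using add_subgroupD(4)[OF add_subgroup_integral_points s that] .
          thus ?thesis unfolding Z_def act_act by blast
        qed
        thus ?thesis unfolding Z_def by blast
      qed
      show "act t ` Z \<subseteq> Z" using sub t .
      show "Z \<subseteq> act t ` Z"
      proof
        fix z assume "z \<in> Z"
        moreover have "- t \<in> integral_points" using add_subgroupD(3)[OF add_subgroup_integral_points t] .
        ultimately have "act (- t) z \<in> Z" using sub by blast
        moreover have "z = act t (act (- t) z)" by (simp add: act_act)
        ultimately show "z \<in> act t ` Z" by blast
      qed
    qed
    moreover have "inj_on (act t) Z"
      by (rule inj_on_inverseI[of _ "act (- t)"]) (simp add: act_act)
    ultimately have "map_poly (act t) p = p"
      unfolding p_def act_poly.hom_prod
      using prod.reindex[of "act t" Z "\<lambda>z. [:- z, 1:]"] by (simp add: act.hom_uminus comp_def)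
    thus "act t (Polynomial.coeff p i) = Polynomial.coeff p i"
      by (metis act.coeff_map_poly_hom)
  qed
  \<comment> \<open>A priori \<open>p\<close> divides \<open>f\<close> only over fractional series.
    Division over C[[x]] has a remainder that \<open>p\<close> also divides, hence 0 by degree, and
    so the cofactor has integral exponents.\<close>
  obtain q r where qr: "q \<in> polys_over integral_points" "f = q * p + r" "Polynomial.degree r < Polynomial.degree p"
    using monic_division[OF additive_monoid_integral_points pL lead deg fW(1)] by blast
  have "p dvd f" unfolding p_def by (rule prod_roots_dvd[OF fin rootZ])
  hence "p dvd r" using qr(2) by (simp add: dvd_add_right_iff)
  hence "r = 0" using qr(3) dvd_imp_degree_le[of p r] by fastforce
  hence "f = p"
    using irreducible_eq_factor[OF irr fW(2), of p q] pL lead deg qr by (simp add: pseries_poly_eq mult.commute)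
  hence "z \<in> Z" using z fin by (auto simp: p_def poly_prod)
  thus ?thesis unfolding Z_def by blast
qed

text \<open>Write f = (y - z)(y - w) h. Then f(z) = 0 and f'(z) = (z - w) h(z) are both divisible by
  z - w, and so is the resultant of f and f'.\<close>

lemma root_difference_dvd_discriminant:
  fixes f :: "'a::idom poly"
  assumes "f \<noteq> 0" "poly f z = 0" "poly f w = 0" "z \<noteq> w"
  shows "z - w dvd discriminant f"
proof -
  obtain g where g: "f = [:- z, 1:] * g" using assms(2) by (auto simp: poly_eq_0_iff_dvd elim: dvdE)
  hence "poly g w = 0" using assms(3,4) by simp
  then obtain h where h: "g = [:- w, 1:] * h" by (auto simp: poly_eq_0_iff_dvd elim: dvdE)
  have "poly (pderiv f) z = (z - w) * poly h z"
    unfolding g pderiv_mult h by (simp add: pderiv_pCons algebra_simps)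
  moreover have "0 < Polynomial.degree f"
    using assms(1,2) by (auto elim!: degree_eq_zeroE intro!: gr0I)
  ultimately have "z - w dvd resultant f (pderiv f)"
    using assms(2) by (intro dvd_resultant[of _ _ z]) simp_all
  thus ?thesis by (simp add: discriminant_def)
qed

text \<open>The characteristic exponents are defined by all pairs of roots. As the roots form a
  single orbit, the pairs containing \<open>\<zeta>\<close> already produce all of them.\<close>

lemma conjugate_differences:
  fixes f :: "('d::finite) puiseux poly"
  assumes f: "quasi_ordinary f" and ls: "characteristic_exponents f ls" and \<zeta>: "poly f \<zeta> = 0"
  shows "\<And>t. t \<in> integral_points \<Longrightarrow> act t \<zeta> \<noteq> \<zeta> \<Longrightarrow> \<exists>l\<in>set ls. least (\<zeta> - act t \<zeta>) l"
    and "\<And>l. l \<in> set ls \<Longrightarrow> \<exists>t\<in>integral_points. least (\<zeta> - act t \<zeta>) l"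
proof -
  have fW: "f \<in> polys_over integral_points" "lead_coeff f = 1"
    using f by (auto simp: quasi_ordinary_def weierstrass_def pseries_poly_eq)
  obtain u e where u: "u \<in> grid 1" "e \<in> Units (subring_on pseries)" "discriminant f = puis_monom u * e"
    using f by (auto simp: quasi_ordinary_def)
  have e: "e dvd 1" using u(2) by (auto simp: Units_def subring_on_def dvd_def)
  have set_ls: "set ls = {u. 0 \<le> u \<and> (\<exists>\<zeta> \<zeta>' e. poly f \<zeta> = 0 \<and> poly f \<zeta>' = 0 \<and> \<zeta> \<noteq> \<zeta>' \<and>
      e dvd 1 \<and> \<zeta> - \<zeta>' = puis_monom u * e)}"
    using ls by (simp add: characteristic_exponents_def)
  show "\<exists>l\<in>set ls. least (\<zeta> - act t \<zeta>) l" if t: "t \<in> integral_points" "act t \<zeta> \<noteq> \<zeta>" for t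
  proof -
    have root: "poly f (act t \<zeta>) = 0"
    proof -
      have "poly (map_poly (act t) f) (act t \<zeta>) = 0" using \<zeta> by simp
      thus ?thesis using act_poly_integral_fixed[OF t(1) fW(1)] by simp
    qed
    have "f \<noteq> 0" using fW(2) by auto
    hence "\<zeta> - act t \<zeta> dvd puis_monom u * e"
      using root_difference_dvd_discriminant[OF _ \<zeta> root] t(2) u(3) by metis
    then obtain l e' where l: "least (\<zeta> - act t \<zeta>) l" "e' dvd 1" "\<zeta> - act t \<zeta> = puis_monom l * e'"
      using e grid_nonneg[OF u(1)] by (rule dvd_monom_unit)
    have "l \<in> set ls" unfolding set_ls
    proof (intro CollectI conjI exI)
      show "poly f \<zeta> = 0" "poly f (act t \<zeta>) = 0" "\<zeta> \<noteq> act t \<zeta>" "e' dvd 1"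
        using \<zeta> root t(2) l(2) by auto
    qed (use l least_nonneg in auto)
    thus ?thesis using l(1) by blast
  qed
  show "\<exists>t\<in>integral_points. least (\<zeta> - act t \<zeta>) l" if l: "l \<in> set ls" for l
  proof -
    obtain z z' e' where z: "0 \<le> l" "poly f z = 0" "poly f z' = 0" "e' dvd 1" "z - z' = puis_monom l * e'"
      using l unfolding set_ls by blast
    obtain t where t: "t \<in> integral_points" "z = act t \<zeta>"
      using quasi_ordinary_roots[OF f \<zeta> z(2)] by blast
    obtain t' where t': "t' \<in> integral_points" "z' = act t' \<zeta>"
      using quasi_ordinary_roots[OF f \<zeta> z(3)] by blast
    \<comment> \<open>Acting by \<open>- t\<close> brings the first root of the pair back to
      \<open>\<zeta>\<close> and does not change which coefficients vanish.\<close>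
    have "least (act (- t) (z - z')) l" using least_monom_mult[OF z(1,4)] z(5) by simp
    moreover have "act (- t) (z - z') = \<zeta> - act (t' - t) \<zeta>"
      unfolding t(2) t'(2) by (simp add: act.hom_minus act_act)
    ultimately show ?thesis using add_subgroupD(2)[OF add_subgroup_integral_points t'(1) t(1)] by metis
  qed
qed

section \<open>The lattices of a branch\<close>

lemma coset_eq_iff:
  assumes "add_subgroup L" shows "(+) a ` L = (+) b ` L \<longleftrightarrow> a - b \<in> L"
proof
  assume "(+) a ` L = (+) b ` L"
  moreover have "a \<in> (+) a ` L" using add_subgroupD(1)[OF assms] by force
  ultimately obtain l where "l \<in> L" "a = b + l" by blast
  thus "a - b \<in> L" by simp
next
  assume ab: "a - b \<in> L"
  have "(+) c ` L \<subseteq> (+) d ` L" if "c - d \<in> L" for c d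
  proof
    fix x assume "x \<in> (+) c ` L"
    then obtain l where l: "l \<in> L" "x = c + l" by blast
    have "(c - d) + l \<in> L" using add_subgroupD(4)[OF assms that l(1)] .
    moreover have "x = d + ((c - d) + l)" using l(2) by simp
    ultimately show "x \<in> (+) d ` L" by blast
  qed
  moreover have "b - a \<in> L" using add_subgroupD(3)[OF assms ab] by simp
  ultimately show "(+) a ` L = (+) b ` L" using ab by (intro equalityI) blast+
qed

text \<open>The quotient of L + Z u by L is cyclic, generated by the class of \<open>u\<close>, so
  its cosets are represented by k u with k < m.\<close>

lemma lattice_index_eq_order:
  fixes L :: "(rat ^ 'd::finite) set"
  assumes L: "add_subgroup L" and m: "m > 0" "of_nat m *s u \<in> L" "\<And>k. of_int k *s u \<in> L \<Longrightarrow> int m dvd k"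
  shows "lattice_index {w + of_int k *s u | w k. w \<in> L} L = m"
proof -
  let ?c = "\<lambda>a. (+) a ` L"
  have "?c ` {w + of_int k *s u | w k. w \<in> L} = (\<lambda>k. ?c (of_nat k *s u)) ` {..<m}"
  proof (intro equalityI subsetI)
    fix X assume "X \<in> ?c ` {w + of_int k *s u | w k. w \<in> L}"
    then obtain w k where w: "w \<in> L" "X = ?c (w + of_int k *s u)" by blast
    define r where "r = nat (k mod int m)"
    have r: "int r = k mod int m" "r < m" unfolding r_def using m(1) by (simp_all add: nat_less_iff)
    have "w + of_int (k div int m) *s (of_nat m *s u) \<in> L"
      by (rule add_subgroupD(4)[OF L w(1) add_subgroup_smult[OF L m(2)]])
    also have "w + of_int (k div int m) *s (of_nat m *s u) = w + of_int k *s u - of_int (k - k div int m * int m) *s u"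
      by (simp add: vec_eq_iff algebra_simps)
    also have "k - k div int m * int m = int r" unfolding r by (simp add: minus_div_mult_eq_mod)
    finally have "X = ?c (of_nat r *s u)" unfolding w(2) coset_eq_iff[OF L] by simp
    thus "X \<in> (\<lambda>k. ?c (of_nat k *s u)) ` {..<m}" using r(2) by blast
  next
    fix X assume "X \<in> (\<lambda>k. ?c (of_nat k *s u)) ` {..<m}"
    then obtain k :: nat where "X = ?c (0 + of_int (int k) *s u)" by auto
    thus "X \<in> ?c ` {w + of_int k *s u | w k. w \<in> L}" using add_subgroupD(1)[OF L] by blast
  qed
  moreover have "inj_on (\<lambda>k. ?c (of_nat k *s u)) {..<m}"
  proof (rule inj_onI)
    fix i j assume ij: "i \<in> {..<m}" "j \<in> {..<m}" and "?c (of_nat i *s u) = ?c (of_nat j *s u)"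
    hence "of_nat i *s u - of_nat j *s u \<in> L" unfolding coset_eq_iff[OF L] by simp
    also have "of_nat i *s u - of_nat j *s u = of_int (int i - int j) *s u"
      by (simp add: vec_eq_iff algebra_simps)
    finally have "int m dvd int i - int j" by (rule m(3))
    hence "int i mod int m = int j mod int m" by (simp add: mod_eq_dvd_iff)
    thus "i = j" using ij by simp
  qed
  ultimately show ?thesis by (simp add: lattice_index_def card_image)
qed

lemma lattice_of_Nil: "lattice_of [] = integral_points"
  by (simp add: lattice_of_def integral_points_def)

lemma integral_points_subset:
  fixes ls :: "(rat ^ 'd::finite) list"
  shows "integral_points \<subseteq> lattice_of ls"
proof
  fix u :: "rat ^ 'd" assume "u \<in> integral_points"
  hence "\<forall>i. u $ i \<in> \<int>" by (simp add: integral_points_def)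
  moreover have "u = u + (\<Sum>j<length ls. of_int ((\<lambda>_. 0) j) *s ls ! j)" by simp
  ultimately show "u \<in> lattice_of ls" unfolding lattice_of_def
    by (intro CollectI exI[of _ u] exI[of _ "\<lambda>_. 0"] conjI)
qed

lemma add_subgroup_lattice_of:
  fixes ls :: "(rat ^ 'd::finite) list"
  shows "add_subgroup (lattice_of ls)"
  unfolding add_subgroup_def
proof (intro conjI ballI)
  show "0 \<in> lattice_of ls"
    using subsetD[OF integral_points_subset add_subgroupD(1)[OF add_subgroup_integral_points]] .
  fix x y assume "x \<in> lattice_of ls" "y \<in> lattice_of ls"
  then obtain m k m' k' where xy: "x = m + (\<Sum>j<length ls. of_int (k j) *s ls ! j)" "\<forall>i. m $ i \<in> \<int>"
    "y = m' + (\<Sum>j<length ls. of_int (k' j) *s ls ! j)" "\<forall>i. m' $ i \<in> \<int>"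
    unfolding lattice_of_def by blast
  have "x - y = (m - m') + (\<Sum>j<length ls. of_int ((\<lambda>j. k j - k' j) j) *s ls ! j)"
    unfolding xy by (simp add: vec_eq_iff sum_subtractf algebra_simps)
  moreover have "\<forall>i. (m - m') $ i \<in> \<int>" using xy by simp
  ultimately show "x - y \<in> lattice_of ls" unfolding lattice_of_def
    by (intro CollectI exI[of _ "m - m'"] exI[of _ "\<lambda>j. k j - k' j"] conjI)
qed

lemma lattice_of_Suc:
  assumes "j < length ls"
  shows "lattice_of (take (Suc j) ls) = {w + of_int k *s ls ! j | w k. w \<in> lattice_of (take j ls)}"
proof -
  have len: "length (take (Suc j) ls) = Suc j" "length (take j ls) = j" using assms by auto
  have s: "(\<Sum>i<Suc j. of_int (k i) *s take (Suc j) ls ! i)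
      = (\<Sum>i<j. of_int (k i) *s take j ls ! i) + of_int (k j) *s ls ! j" for k :: "nat \<Rightarrow> int"
    using assms by simp
  show ?thesis
  proof (intro equalityI subsetI)
    fix u assume "u \<in> lattice_of (take (Suc j) ls)"
    then obtain m k where mk: "\<forall>i. m $ i \<in> \<int>" "u = m + (\<Sum>i<Suc j. of_int (k i) *s take (Suc j) ls ! i)"
      unfolding lattice_of_def len by blast
    have "m + (\<Sum>i<j. of_int (k i) *s take j ls ! i) \<in> lattice_of (take j ls)"
      unfolding lattice_of_def len using mk(1) by blast
    moreover have "u = (m + (\<Sum>i<j. of_int (k i) *s take j ls ! i)) + of_int (k j) *s ls ! j"
      unfolding mk(2) s by (simp only: add.assoc)
    ultimately show "u \<in> {w + of_int k *s ls ! j | w k. w \<in> lattice_of (take j ls)}" by blast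
  next
    fix u assume "u \<in> {w + of_int k *s ls ! j | w k. w \<in> lattice_of (take j ls)}"
    then obtain m k c where mk: "\<forall>i. m $ i \<in> \<int>" "u = m + (\<Sum>i<j. of_int (k i) *s take j ls ! i) + of_int c *s ls ! j"
      unfolding lattice_of_def len by blast
    have "u = m + (\<Sum>i<Suc j. of_int ((k(j := c)) i) *s take (Suc j) ls ! i)"
      unfolding mk(2) s by (simp add: add.assoc)
    thus "u \<in> lattice_of (take (Suc j) ls)" unfolding lattice_of_def len using mk(1) by blast
  qed
qed

section \<open>Truncations of series and products over boxes\<close>

lift_definition restr :: "(rat ^ 'd) set \<Rightarrow> ('d::finite) puiseux \<Rightarrow> 'd puiseux"
  is "\<lambda>A f u. if u \<in> A then f u else 0"
  by (auto simp: on_grid_def)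

lift_definition scale :: "complex \<Rightarrow> ('d::finite) puiseux \<Rightarrow> 'd puiseux"
  is "\<lambda>c f u. c * f u"
  by (auto simp: on_grid_def)

text \<open>The product of \<open>h\<close> over the points k_0 T_0 + ... + k_(j-1) T_(j-1) with 0
  <= k_i < n_i. Peeling off the last coordinate turns \<open>h\<close> into its translates, so
  inductions over \<open>j\<close> generalise \<open>h\<close>. For the vectors \<open>tt\<close>
  below this is a norm, descending one lattice at a time.\<close>

primrec box_prod :: "(nat \<Rightarrow> rat ^ 'd) \<Rightarrow> (nat \<Rightarrow> nat) \<Rightarrow> nat \<Rightarrow> (rat ^ 'd \<Rightarrow> 'a::comm_monoid_mult) \<Rightarrow> 'a" where
  "box_prod T n 0 h = h 0"
| "box_prod T n (Suc j) h = (\<Prod>k<n j. box_prod T n j (\<lambda>s. h (s + of_nat k *s T j)))"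

lemma box_prod_prod:
  "box_prod T n j (\<lambda>s. \<Prod>k<N. h k s) = (\<Prod>k<N. box_prod T n j (h k))"
  by (induction j arbitrary: h) (auto intro: prod.swap)

lemma box_prod_hom:
  assumes "F 1 = 1" "\<And>x y. F (x * y) = F x * F y"
  shows "F (box_prod T n j h) = box_prod T n j (\<lambda>s. F (h s))"
proof (induction j arbitrary: h)
  case (Suc j)
  have "F (\<Prod>k<N. p k) = (\<Prod>k<N. F (p k))" for N :: nat and p
    by (induction N) (auto simp: assms)
  thus ?case by (simp add: Suc)
qed simp

lemma box_prod_zero:
  fixes h :: "rat ^ 'd \<Rightarrow> 'a::comm_semiring_1"
  assumes "h 0 = 0" "\<And>i. i < j \<Longrightarrow> n i > 0"
  shows "box_prod T n j h = 0"
  using assms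
proof (induction j arbitrary: h)
  case (Suc j)
  have "box_prod T n j (\<lambda>s. h (s + of_nat 0 *s T j)) = 0"
    using Suc.prems by (intro Suc.IH) auto
  thus ?case using Suc.prems(2)[of j] by (auto intro!: prod_zero bexI[of _ "0 :: nat"])
qed simp

lemma box_prod_monic:
  fixes h :: "rat ^ 'd \<Rightarrow> 'a::idom poly"
  assumes "\<And>s. lead_coeff (h s) = 1" "\<And>s. Polynomial.degree (h s) = 1"
  shows "lead_coeff (box_prod T n j h) = 1 \<and> Polynomial.degree (box_prod T n j h) = (\<Prod>i<j. n i)"
  using assms
proof (induction j arbitrary: h)
  case (Suc j)
  let ?B = "\<lambda>k. box_prod T n j (\<lambda>s. h (s + of_nat k *s T j))"
  have B: "lead_coeff (?B k) = 1" "Polynomial.degree (?B k) = (\<Prod>i<j. n i)" for k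
    using Suc.IH[of "\<lambda>s. h (s + of_nat k *s T j)"] Suc.prems by auto
  hence nz: "?B k \<noteq> 0" for k by (metis leading_coeff_0_iff zero_neq_one)
  have "lead_coeff (\<Prod>k<n j. ?B k) = 1" unfolding Polynomial.lead_coeff_prod by (rule prod.neutral) (use B(1) in blast)
  moreover have "Polynomial.degree (\<Prod>k<n j. ?B k) = (\<Prod>i<Suc j. n i)"
    using nz B by (simp add: degree_prod_eq_sum_degree)
  ultimately show ?case by simp
qed simp

text \<open>From here on \<open>f\<close> is forgotten: these facts on the differences between
  \<open>\<zeta>\<close> and its conjugates are all that is kept of it.\<close>

locale branch =
  fixes \<zeta> :: "('d::finite) puiseux" and ls :: "(rat ^ 'd) list"
  assumes sorted: "sorted_wrt (<) ls"
    and difference_exponent: "\<And>t. t \<in> integral_points \<Longrightarrow> act t \<zeta> \<noteq> \<zeta> \<Longrightarrow> \<exists>l\<in>set ls. least (\<zeta> - act t \<zeta>) l"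
    and exponent_difference: "\<And>l. l \<in> set ls \<Longrightarrow> \<exists>t\<in>integral_points. least (\<zeta> - act t \<zeta>) l"
begin

abbreviation "M j \<equiv> lattice_of (take j ls)"
abbreviation "g \<equiv> length ls"

lemma coeff_difference: "puis_coeff (\<zeta> - act t \<zeta>) u \<noteq> 0 \<longleftrightarrow> puis_coeff \<zeta> u \<noteq> 0 \<and> pairing t u \<notin> \<int>"
proof -
  have "puis_coeff (\<zeta> - act t \<zeta>) u = (1 - chi t u) * puis_coeff \<zeta> u"
    by (simp add: puis_coeff_diff puis_coeff_act algebra_simps)
  thus ?thesis using chi_eq_1_iff[of t u] by auto
qed

lemma exponent_in_supp: "i < g \<Longrightarrow> puis_coeff \<zeta> (ls ! i) \<noteq> 0"
  using exponent_difference[of "ls ! i"] coeff_difference by (auto simp: least_def)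

lemma exponent_less: "i < j \<Longrightarrow> j < g \<Longrightarrow> ls ! i < ls ! j"
  using sorted by (simp add: sorted_wrt_iff_nth_less)

lemma exponent_le: "i \<le> j \<Longrightarrow> j < g \<Longrightarrow> ls ! i \<le> ls ! j"
  using exponent_less[of i j] by (cases "i = j") auto

lemma M_Suc: "j < g \<Longrightarrow> M (Suc j) = {w + of_int k *s ls ! j | w k. w \<in> M j}"
  by (rule lattice_of_Suc)

lemma M_step: "j < g \<Longrightarrow> M j \<subseteq> M (Suc j)"
proof
  fix u assume "j < g" "u \<in> M j"
  moreover have "u = u + of_int 0 *s ls ! j" by simp
  ultimately show "u \<in> M (Suc j)" unfolding M_Suc[OF \<open>j < g\<close>] by blast
qed

lemma M_mono: "i \<le> j \<Longrightarrow> j \<le> g \<Longrightarrow> M i \<subseteq> M j"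
proof (induction j)
  case (Suc j)
  thus ?case using M_step[of j] by (cases "i = Suc j") auto
qed simp

lemma exponent_in_M_Suc: "j < g \<Longrightarrow> ls ! j \<in> M (Suc j)"
proof -
  assume j: "j < g"
  have "ls ! j = 0 + of_int 1 *s ls ! j" by simp
  moreover have "0 \<in> M j" by (rule add_subgroupD(1)[OF add_subgroup_lattice_of])
  ultimately show ?thesis unfolding M_Suc[OF j] by blast
qed

lemma exponent_in_M: "i < j \<Longrightarrow> j \<le> g \<Longrightarrow> ls ! i \<in> M j"
  using exponent_in_M_Suc[of i] M_mono[of "Suc i" j] by auto

text \<open>The characteristic exponents lie in the support of \<open>\<zeta>\<close>, so a common
  denominator of the support also serves for every M_j.\<close>

lemma denominator:
  obtains n where "n > 0" "\<And>u i. puis_coeff \<zeta> u \<noteq> 0 \<Longrightarrow> of_nat n * u $ i \<in> \<int>"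
    "\<And>j u i. j \<le> g \<Longrightarrow> u \<in> M j \<Longrightarrow> of_nat n * u $ i \<in> \<int>"
proof -
  obtain n where n: "n > 0" "\<forall>u. puis_coeff \<zeta> u \<noteq> 0 \<longrightarrow> u \<in> grid n" using puis_grid by blast
  have z: "of_nat n * u $ i \<in> \<int>" if "puis_coeff \<zeta> u \<noteq> 0" for u i
    using n(2) that by (simp add: grid_def)
  have "of_nat n * u $ i \<in> \<int>" if "j \<le> g" "u \<in> M j" for j u i
    using that
  proof (induction j arbitrary: u)
    case 0
    thus ?case by (simp add: lattice_of_Nil integral_points_def)
  next
    case (Suc j)
    obtain w k where w: "w \<in> M j" "u = w + of_int k *s ls ! j"
      using Suc.prems M_Suc[of j] by auto
    have "of_nat n * w $ i \<in> \<int>" using Suc.IH[OF _ w(1)] Suc.prems(1) by simp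
    moreover have "of_int k * (of_nat n * ls ! j $ i) \<in> \<int>"
      using z[OF exponent_in_supp[of j]] Suc.prems(1) by (intro Ints_mult[OF Ints_of_int]) auto
    ultimately have "of_nat n * w $ i + of_int k * (of_nat n * ls ! j $ i) \<in> \<int>" by (rule Ints_add)
    thus ?case unfolding w(2) by (simp add: algebra_simps)
  qed
  thus thesis using that n(1) z by blast
qed

text \<open>As lists are indexed from 0, this is n_(j+1), the index of M_j in M_(j+1).\<close>

definition "nn j = lattice_index (M (Suc j)) (M j)"

lemma order_exists:
  assumes u: "puis_coeff \<zeta> u \<noteq> 0"
  obtains m where "m > 0" "of_nat m *s u \<in> M j" "\<And>k. of_int k *s u \<in> M j \<Longrightarrow> int m dvd k"
proof -
  obtain n where n: "n > 0" "\<And>u i. puis_coeff \<zeta> u \<noteq> 0 \<Longrightarrow> of_nat n * u $ i \<in> \<int>" by (rule denominator) blast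
  have "of_nat n *s u \<in> integral_points" using n(2)[OF u] by (simp add: integral_points_def)
  hence "of_nat n *s u \<in> M j" using integral_points_subset by blast
  from add_subgroup_order[OF add_subgroup_lattice_of n(1) this] that show thesis by blast
qed

lemma nn:
  assumes j: "j < g"
  shows "nn j > 0" "of_nat (nn j) *s ls ! j \<in> M j" "\<And>k. of_int k *s ls ! j \<in> M j \<Longrightarrow> int (nn j) dvd k"
proof -
  obtain m where m: "m > 0" "of_nat m *s ls ! j \<in> M j" "\<And>k. of_int k *s ls ! j \<in> M j \<Longrightarrow> int m dvd k"
    by (rule order_exists[OF exponent_in_supp[OF j]]) blast
  have "nn j = m"
    unfolding nn_def M_Suc[OF j] by (rule lattice_index_eq_order[OF add_subgroup_lattice_of m])
  thus "nn j > 0" "of_nat (nn j) *s ls ! j \<in> M j" "\<And>k. of_int k *s ls ! j \<in> M j \<Longrightarrow> int (nn j) dvd k"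
    using m by auto
qed

lemma character:
  assumes u: "puis_coeff \<zeta> u \<noteq> 0" and j: "j \<le> g"
    and m: "m > 0" "of_nat m *s u \<in> M j" "\<And>k. of_int k *s u \<in> M j \<Longrightarrow> int m dvd k"
  shows "\<exists>t\<in>integral_points. (\<forall>l\<in>M j. pairing t l \<in> \<int>) \<and> pairing t u - 1 / of_nat m \<in> \<int>"
proof -
  obtain n where n: "n > 0" "\<And>u i. puis_coeff \<zeta> u \<noteq> 0 \<Longrightarrow> of_nat n * u $ i \<in> \<int>"
    "\<And>j u i. j \<le> g \<Longrightarrow> u \<in> M j \<Longrightarrow> of_nat n * u $ i \<in> \<int>" by (rule denominator) blast
  have Z: "w \<in> M j" if "\<forall>i. w $ i \<in> \<int>" for w
    using that integral_points_subset by (auto simp: integral_points_def)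
  have d: "of_nat n * w $ i \<in> \<int>" if "w \<in> insert u (M j)" for w i
    using that n(2)[OF u] n(3)[OF j] by blast
  obtain t where "\<forall>i. t $ i \<in> \<int>" "\<And>l. l \<in> M j \<Longrightarrow> pairing t l \<in> \<int>" "pairing t u - 1 / of_nat m \<in> \<int>"
    using separating_character[OF add_subgroup_lattice_of Z n(1) d m] by blast
  thus ?thesis by (auto simp: integral_points_def)
qed

text \<open>Trivial on M_j and of value 1/n_(j+1) at \<lambda>_(j+1), hence a generator of the dual
  of the cyclic group M_(j+1)/M_j.\<close>

definition "tt j = (SOME t. t \<in> integral_points \<and> (\<forall>l\<in>M j. pairing t l \<in> \<int>) \<and>
  pairing t (ls ! j) - 1 / of_nat (nn j) \<in> \<int>)"

lemma tt:
  assumes j: "j < g"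
  shows "tt j \<in> integral_points" "\<And>l. l \<in> M j \<Longrightarrow> pairing (tt j) l \<in> \<int>"
    "pairing (tt j) (ls ! j) - 1 / of_nat (nn j) \<in> \<int>"
proof -
  have "\<exists>t. t \<in> integral_points \<and> (\<forall>l\<in>M j. pairing t l \<in> \<int>) \<and> pairing t (ls ! j) - 1 / of_nat (nn j) \<in> \<int>"
    using character[OF exponent_in_supp[OF j] less_imp_le[OF j] nn[OF j]] by blast
  from someI_ex[OF this]
  show "tt j \<in> integral_points" "\<And>l. l \<in> M j \<Longrightarrow> pairing (tt j) l \<in> \<int>"
    "pairing (tt j) (ls ! j) - 1 / of_nat (nn j) \<in> \<int>"
    unfolding tt_def by blast+
qed

lemma int_div_imp_dvd:
  assumes "of_int k / of_nat m \<in> (\<int> :: rat set)" "m > 0" shows "int m dvd k"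
proof -
  obtain z where "of_int k / of_nat m = (of_int z :: rat)" using assms(1) by (auto elim: Ints_cases)
  hence "(of_int k :: rat) = of_int (int m * z)" using assms(2) by (simp add: field_simps)
  hence "k = int m * z" by (simp only: of_int_eq_iff)
  thus ?thesis by simp
qed

lemma pairing_tt_multiple:
  assumes j: "j < g" shows "of_int k * pairing (tt j) (ls ! j) \<in> \<int> \<longleftrightarrow> int (nn j) dvd k"
proof -
  obtain z where z: "pairing (tt j) (ls ! j) - 1 / of_nat (nn j) = of_int z"
    using tt(3)[OF j] by (auto elim: Ints_cases)
  have e: "of_int k * pairing (tt j) (ls ! j) = of_int k / of_nat (nn j) + of_int (k * z)"
    using z by (simp add: algebra_simps diff_eq_eq)
  have "of_int k * pairing (tt j) (ls ! j) \<in> \<int> \<longleftrightarrow> of_int k / of_nat (nn j) \<in> (\<int> :: rat set)"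
    unfolding e using Ints_add[OF _ Ints_of_int[of "k * z"]] Ints_diff[OF _ Ints_of_int[of "k * z"]]
    by (metis add_diff_cancel_right')
  also have "\<dots> \<longleftrightarrow> int (nn j) dvd k"
  proof
    show "int (nn j) dvd k" if "of_int k / of_nat (nn j) \<in> (\<int> :: rat set)"
      using int_div_imp_dvd that nn(1)[OF j] by blast
    show "of_int k / of_nat (nn j) \<in> (\<int> :: rat set)" if "int (nn j) dvd k"
      using that nn(1)[OF j] by (auto elim!: dvdE)
  qed
  finally show ?thesis .
qed

text \<open>If \<open>u\<close> were outside M_j, some \<open>t\<close> trivial on M_j would move
  x^u, so \<open>u\<close> would be an exponent of the difference of \<open>\<zeta>\<close> and its
  conjugate. The least exponent of that difference is a characteristic exponent moved by
  \<open>t\<close>, so it is none of the first j; hence it is at least \<open>ls ! j\<close>, and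
  \<open>ls ! j\<close> would be at most \<open>u\<close>. For \<open>j = g\<close> no such exponent
  is left, so the whole support lies in M.\<close>

lemma supp_in_lattice:
  assumes u: "puis_coeff \<zeta> u \<noteq> 0" and j: "j \<le> g" and nle: "j < g \<Longrightarrow> \<not> ls ! j \<le> u"
  shows "u \<in> M j"
proof (rule ccontr)
  assume uM: "u \<notin> M j"
  obtain m where m: "m > 0" "of_nat m *s u \<in> M j" "\<And>k. of_int k *s u \<in> M j \<Longrightarrow> int m dvd k"
    by (rule order_exists[OF u]) blast
  obtain t where t: "t \<in> integral_points" "\<forall>l\<in>M j. pairing t l \<in> \<int>" "pairing t u - 1 / of_nat m \<in> \<int>"
    using character[OF u j m] by blast
  have "pairing t u \<notin> \<int>"
  proof
    assume "pairing t u \<in> \<int>"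
    from Ints_diff[OF this t(3)] have "of_int 1 / of_nat m \<in> (\<int> :: rat set)" by simp
    hence "m = 1" using int_div_imp_dvd m(1) by fastforce
    thus False using m(2) uM by simp
  qed
  hence cu: "puis_coeff (\<zeta> - act t \<zeta>) u \<noteq> 0" using u coeff_difference by blast
  hence "act t \<zeta> \<noteq> \<zeta>" by (auto simp: zero_puiseux.rep_eq)
  then obtain i where i: "i < g" "least (\<zeta> - act t \<zeta>) (ls ! i)"
    using difference_exponent[OF t(1)] by (auto simp: in_set_conv_nth)
  have "pairing t (ls ! i) \<notin> \<int>" using i(2) coeff_difference by (simp add: least_def)
  hence "\<not> i < j" using exponent_in_M j t(2) by blast
  hence "ls ! j \<le> ls ! i" "j < g" using exponent_le i(1) by auto
  moreover have "ls ! i \<le> u" using i(2) cu by (simp add: least_def)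
  ultimately show False using nle by (meson order_trans)
qed

end

section \<open>Semiroots\<close>

lemma sum_const_smult: "(\<Sum>k<n. c) = of_nat n *s (c :: rat ^ 'd)"
  by (induction n) (simp_all add: vec_eq_iff algebra_simps)

context branch
begin

text \<open>Exponents incomparable with \<open>ls ! j\<close> are kept, so that the difference to
  \<open>\<zeta>\<close> has \<open>ls ! j\<close> as its least exponent. At \<open>g\<close>
  nothing is cut off, which makes the last semiroot vanish at \<open>\<zeta>\<close>.\<close>

definition "truncation j = restr (if j < g then {u. \<not> ls ! j \<le> u} else UNIV) \<zeta>"
definition "semiroot j = box_prod tt nn j (\<lambda>s. [:- act s (truncation j), 1:])"
text \<open>For j > 0 this is n_j \<gamma>_j - \<lambda>_j, by which \<gamma>_(j+1) and
  \<lambda>_(j+1) differ. It is the part of the value of a box product that does not depend on how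
  well the series in it approximates \<open>\<zeta>\<close>.\<close>

definition "offset j = (case j of 0 \<Rightarrow> 0 | Suc i \<Rightarrow> of_nat (nn i) *s gam ls i - ls ! i)"
definition "dd j = (\<Prod>i<j. nn i)"

lemma truncation_last: "truncation g = \<zeta>"
  by (rule puis_eqI) (simp add: truncation_def restr.rep_eq)

lemma truncation_supported: "j \<le> g \<Longrightarrow> truncation j \<in> supported (M j)"
proof (rule supportedI)
  fix u assume j: "j \<le> g" and "puis_coeff (truncation j) u \<noteq> 0"
  hence "puis_coeff \<zeta> u \<noteq> 0" "j < g \<Longrightarrow> \<not> ls ! j \<le> u"
    by (auto simp: truncation_def restr.rep_eq split: if_splits)
  thus "u \<in> M j" using supp_in_lattice j by blast
qed

lemma supported_last: "\<zeta> \<in> supported (lattice_of ls)"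
  using truncation_supported[of g] truncation_last by simp

lemma least_truncation: "j < g \<Longrightarrow> least (\<zeta> - truncation j) (ls ! j)"
  using exponent_in_supp[of j]
  by (auto simp: least_def puis_coeff_diff truncation_def restr.rep_eq split: if_splits)

lemma gam_eq: "j < g \<Longrightarrow> gam ls j = offset j + ls ! j"
  by (cases j) (simp_all add: offset_def nn_def)

lemma tt_multiple_integral: "j < g \<Longrightarrow> of_nat k *s tt j \<in> integral_points"
  using add_subgroup_smult[OF add_subgroup_integral_points tt(1), of j "int k"] by simp

lemma pairing_tt_M: "j < g \<Longrightarrow> l \<in> M j \<Longrightarrow> pairing (of_nat k *s tt j) l \<in> \<int>"
  using tt(2)[of j l] by (auto simp: pairing_smult_left)

text \<open>Such a multiple of \<open>tt j\<close> fixes the earlier characteristic exponents and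
  moves \<open>ls ! j\<close>, which is therefore where \<open>\<zeta>\<close> and its conjugate
  separate. Replacing \<open>\<zeta>\<close> by \<open>\<theta>\<close> in the conjugate only
  affects strictly larger exponents.\<close>

lemma least_conjugate:
  assumes j: "j < g" and k: "0 < k" "k < nn j"
    and \<theta>: "\<And>u. puis_coeff (\<zeta> - \<theta>) u \<noteq> 0 \<Longrightarrow> ls ! j < u"
  shows "least (\<zeta> - act (of_nat k *s tt j) \<theta>) (ls ! j)"
proof -
  let ?t = "of_nat k *s tt j"
  have "\<not> int (nn j) dvd int k" using k by (auto dest: dvd_imp_le)
  hence "pairing ?t (ls ! j) \<notin> \<int>" using pairing_tt_multiple[OF j, of "int k"] by (simp add: pairing_smult_left)
  hence c: "puis_coeff (\<zeta> - act ?t \<zeta>) (ls ! j) \<noteq> 0" using exponent_in_supp[OF j] coeff_difference by blast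
  hence "act ?t \<zeta> \<noteq> \<zeta>" by (auto simp: zero_puiseux.rep_eq)
  then obtain i where i: "i < g" "least (\<zeta> - act ?t \<zeta>) (ls ! i)"
    using difference_exponent[OF tt_multiple_integral[OF j] \<open>act ?t \<zeta> \<noteq> \<zeta>\<close>]
    by (auto simp: in_set_conv_nth)
  have "pairing ?t (ls ! i) \<notin> \<int>" using i(2) coeff_difference by (simp add: least_def)
  hence "\<not> i < j" using exponent_in_M[of i j] pairing_tt_M[OF j] j by auto
  hence "ls ! j \<le> ls ! i" using exponent_le i(1) by auto
  moreover have "ls ! i \<le> ls ! j" using i(2) c by (simp add: least_def)
  ultimately have "least (\<zeta> - act ?t \<zeta>) (ls ! j)" using i(2) by (metis order_antisym)
  moreover have "ls ! j < w" if "puis_coeff (act ?t (\<zeta> - \<theta>)) w \<noteq> 0" for w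
    using that \<theta> by (simp add: puis_coeff_act)
  ultimately have "least ((\<zeta> - act ?t \<zeta>) + act ?t (\<zeta> - \<theta>)) (ls ! j)" by (rule least_add)
  thus ?thesis by (simp add: act.hom_minus)
qed

text \<open>The factor of index \<open>k > 0\<close> in the new variable of the box contributes \<open>\<lambda>_(j+1)\<close> instead of
  \<open>\<beta>\<close>, which is the recursion defining the \<open>\<gamma>_j\<close>.\<close>

lemma least_box_prod:
  assumes "j \<le> g" "least (\<zeta> - \<theta>) \<beta>" "\<And>i. i < j \<Longrightarrow> ls ! i < \<beta>"
  shows "least (box_prod tt nn j (\<lambda>s. \<zeta> - act s \<theta>)) (offset j + \<beta>)"
  using assms
proof (induction j arbitrary: \<theta> \<beta>)
  case 0
  thus ?case by (simp add: offset_def)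
next
  case (Suc j)
  have j: "j < g" using Suc.prems(1) by simp
  define b where "b k = (if k = 0 then \<beta> else ls ! j)" for k :: nat
  have lt: "ls ! j < u" if "puis_coeff (\<zeta> - \<theta>) u \<noteq> 0" for u
    using that Suc.prems(2) Suc.prems(3)[of j] unfolding least_def by (meson lessI less_le_trans)
  have "least (box_prod tt nn j (\<lambda>s. \<zeta> - act s (act (of_nat k *s tt j) \<theta>))) (offset j + b k)"
    if k: "k < nn j" for k
  proof (rule Suc.IH)
    show "least (\<zeta> - act (of_nat k *s tt j) \<theta>) (b k)"
      using least_conjugate[OF j _ k lt] Suc.prems(2) by (cases "k = 0") (simp_all add: b_def)
    show "ls ! i < b k" if "i < j" for i
      using Suc.prems(3)[of i] exponent_less[OF that j] that by (simp add: b_def)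
  qed (use j in simp)
  hence "least (\<Prod>k<nn j. box_prod tt nn j (\<lambda>s. \<zeta> - act s (act (of_nat k *s tt j) \<theta>))) (\<Sum>k<nn j. offset j + b k)"
    by (intro least_prod) auto
  moreover have "(\<Sum>k<nn j. offset j + b k) = offset (Suc j) + \<beta>"
  proof -
    obtain n where n: "nn j = Suc n" using nn(1)[OF j] gr0_implies_Suc by blast
    have "(\<Sum>k<Suc n. offset j + b k) = (offset j + \<beta>) + of_nat n *s (offset j + ls ! j)"
      unfolding sum.lessThan_Suc_shift by (simp add: b_def sum_const_smult del: sum_constant)
    thus ?thesis unfolding n by (simp add: offset_def gam_eq[OF j] n vec_eq_iff algebra_simps)
  qed
  ultimately show ?case by (simp add: act_act)
qed

lemma poly_semiroot: "poly (semiroot j) \<zeta> = box_prod tt nn j (\<lambda>s. \<zeta> - act s (truncation j))"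
  unfolding semiroot_def by (subst box_prod_hom[of "\<lambda>p. poly p \<zeta>"]) simp_all

lemma least_semiroot: "j < g \<Longrightarrow> least (poly (semiroot j) \<zeta>) (gam ls j)"
  unfolding poly_semiroot gam_eq
  by (rule least_box_prod) (simp_all add: least_truncation exponent_less)

text \<open>The factor at the origin of the box is \<zeta> - \<zeta>. The last semiroot thus serves
  as a monic equation of \<open>\<zeta>\<close> over C[[x]], of degree n_1 ... n_g.\<close>

lemma semiroot_last: "poly (semiroot g) \<zeta> = 0"
  unfolding poly_semiroot truncation_last by (rule box_prod_zero) (simp_all add: nn(1))

lemma semiroot_monic: "lead_coeff (semiroot j) = 1" "Polynomial.degree (semiroot j) = dd j"
proof -
  have "lead_coeff (semiroot j) = 1 \<and> Polynomial.degree (semiroot j) = dd j"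
    unfolding semiroot_def dd_def by (rule box_prod_monic) simp_all
  thus "lead_coeff (semiroot j) = 1" "Polynomial.degree (semiroot j) = dd j" by blast+
qed

lemma dd_pos: "j \<le> g \<Longrightarrow> 0 < dd j"
  unfolding dd_def by (rule prod_pos) (simp add: nn(1))

text \<open>On M_(j+1) the vector \<open>tt j\<close> is trivial exactly on M_j, because it
  separates the multiples of the generator \<open>ls ! j\<close> modulo \<open>nn j\<close>. So
  invariance under a single vector brings exponents down one lattice.\<close>

lemma M_fixed:
  assumes j: "j < g" and u: "u \<in> M (Suc j)" "pairing (tt j) u \<in> \<int>" shows "u \<in> M j"
proof -
  obtain w k where w: "w \<in> M j" "u = w + of_int k *s ls ! j" using u(1) M_Suc[OF j] by auto
  have "pairing (tt j) u - pairing (tt j) w \<in> \<int>" using u(2) tt(2)[OF j w(1)] by (rule Ints_diff)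
  hence "of_int k * pairing (tt j) (ls ! j) \<in> \<int>" unfolding w(2) by (simp add: pairing_add pairing_smult)
  hence "int (nn j) dvd k" using pairing_tt_multiple[OF j] by simp
  then obtain c where c: "k = int (nn j) * c" by (rule dvdE)
  have "w + of_int c *s (of_nat (nn j) *s ls ! j) \<in> M j"
    by (rule add_subgroupD(4)[OF add_subgroup_lattice_of w(1) add_subgroup_smult[OF add_subgroup_lattice_of nn(2)[OF j]]])
  moreover have "of_int c *s (of_nat (nn j) *s ls ! j) = of_int k *s ls ! j" unfolding c by (simp add: vec_eq_iff)
  ultimately show ?thesis using w(2) by simp
qed

text \<open>The product of the conjugates of \<open>p\<close> by the multiples of
  \<open>tt j\<close> is fixed by \<open>tt j\<close>, which brings its exponents from M_(j+1) down
  to M_j. The remaining box, of one dimension less, continues the descent to M_0.\<close>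

lemma box_prod_polys_over:
  assumes "j \<le> g" "p \<in> polys_over (M j)"
  shows "box_prod tt nn j (\<lambda>s. map_poly (act s) p) \<in> polys_over integral_points"
  using assms
proof (induction j arbitrary: p)
  case 0
  have "map_poly (act 0) p = p" by (rule poly_eqI) simp
  thus ?case using 0 by (simp add: lattice_of_Nil)
next
  case (Suc j)
  have j: "j < g" using Suc.prems(1) by simp
  let ?t = "tt j"
  define P where "P = (\<Prod>k<nn j. map_poly (act (of_nat k *s ?t)) p)"
  have comp: "map_poly (act s) (map_poly (act t) q) = map_poly (act (s + t)) q" for s t q
    by (rule poly_eqI) (simp add: act_act)
  have "box_prod tt nn (Suc j) (\<lambda>s. map_poly (act s) p) = box_prod tt nn j (\<lambda>s. map_poly (act s) P)"
    by (simp add: P_def act_poly.hom_prod comp box_prod_prod)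
  moreover have "P \<in> polys_over (M j)"
  proof (rule polys_overI)
    fix i
    have "P \<in> polys_over (M (Suc j))"
      unfolding P_def
      by (intro polys_over_prod add_subgroup_monoid add_subgroup_lattice_of polys_overI)
        (use polys_overD[OF Suc.prems(2)] in \<open>simp add: supported_def\<close>)
    hence PS: "Polynomial.coeff P i \<in> supported (M (Suc j))" by (rule polys_overD)
    \<comment> \<open>\<open>nn j\<close> times \<open>tt j\<close> pairs integrally with all of
      M_(j+1), so the factors form a cycle and acting by \<open>tt j\<close> only permutes
      them.\<close>
    have period: "map_poly (act (of_nat (nn j) *s ?t)) p = map_poly (act (of_nat 0 *s ?t)) p"
    proof (rule poly_eqI)
      fix i
      have "pairing (of_nat (nn j) *s ?t) u \<in> \<int>" if u: "u \<in> M (Suc j)" for u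
      proof -
        obtain w k where w: "w \<in> M j" "u = w + of_int k *s ls ! j" using u M_Suc[OF j] by auto
        have "pairing (of_nat (nn j) *s ?t) w \<in> \<int>" by (rule pairing_tt_M[OF j w(1)])
        moreover have "of_int k * (of_nat (nn j) * pairing ?t (ls ! j)) \<in> \<int>"
          using pairing_tt_multiple[OF j, of "int (nn j)"] by (intro Ints_mult[OF Ints_of_int]) simp
        ultimately show ?thesis unfolding w(2)
          by (simp add: pairing_add pairing_smult pairing_smult_left mult_ac)
      qed
      hence "act (of_nat (nn j) *s ?t) (Polynomial.coeff p i) = Polynomial.coeff p i"
        using polys_overD[OF Suc.prems(2), of i] unfolding act_fixed_iff supported_def by blast
      thus "Polynomial.coeff (map_poly (act (of_nat (nn j) *s ?t)) p) i =
          Polynomial.coeff (map_poly (act (of_nat 0 *s ?t)) p) i" by simp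
    qed
    have "map_poly (act ?t) P = P"
    proof -
      obtain n where n: "nn j = Suc n" using nn(1)[OF j] gr0_implies_Suc by blast
      have "map_poly (act ?t) (map_poly (act (of_nat k *s ?t)) p) = map_poly (act (of_nat (Suc k) *s ?t)) p" for k
        unfolding comp by (intro arg_cong[of _ _ "\<lambda>s. map_poly (act s) p"]) (simp add: vec_eq_iff algebra_simps)
      hence "map_poly (act ?t) P = (\<Prod>k<Suc n. map_poly (act (of_nat (Suc k) *s ?t)) p)"
        unfolding P_def act_poly.hom_prod n by (intro prod.cong refl)
      also have "\<dots> = (\<Prod>k<n. map_poly (act (of_nat (Suc k) *s ?t)) p) * map_poly (act (of_nat 0 *s ?t)) p"
        unfolding prod.lessThan_Suc using period n by metis
      also have "\<dots> = P" unfolding P_def n prod.lessThan_Suc_shift by (simp only: mult.commute)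
      finally show ?thesis .
    qed
    hence "act ?t (Polynomial.coeff P i) = Polynomial.coeff P i" by (metis act.coeff_map_poly_hom)
    hence "\<forall>u\<in>puis_supp (Polynomial.coeff P i). pairing ?t u \<in> \<int>" by (simp add: act_fixed_iff)
    thus "Polynomial.coeff P i \<in> supported (M j)"
      using PS M_fixed[OF j] unfolding supported_def by blast
  qed
  ultimately show ?case using Suc.IH[of P] j by simp
qed

lemma semiroot_polys_over: "j \<le> g \<Longrightarrow> semiroot j \<in> polys_over integral_points"
proof -
  assume j: "j \<le> g"
  have "[:- truncation j, 1:] \<in> polys_over (M j)"
    by (intro polys_over_pCons supported_uminus truncation_supported j polys_over_0 supported_1
        add_subgroup_monoid add_subgroup_lattice_of)
  from box_prod_polys_over[OF j this] show ?thesis by (simp add: semiroot_def act.hom_uminus)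
qed

lemma gam_in_M:
  assumes "j < g" shows "offset j \<in> M j" "gam ls j \<in> M (Suc j)"
proof -
  have "(j < g \<longrightarrow> offset j \<in> M j)" for j
  proof (induction j)
    case 0
    show ?case by (simp add: offset_def add_subgroupD(1)[OF add_subgroup_lattice_of])
  next
    case (Suc j)
    show ?case
    proof
      assume j: "Suc j < g"
      have "gam ls j \<in> M (Suc j)"
        using add_subgroupD(4)[OF add_subgroup_lattice_of _ exponent_in_M_Suc[of j], of "offset j"]
          Suc j M_step[of j] gam_eq[of j] by auto
      hence "of_nat (nn j) *s gam ls j \<in> M (Suc j)"
        using add_subgroup_smult[OF add_subgroup_lattice_of, of "gam ls j" _ "int (nn j)"] by simp
      thus "offset (Suc j) \<in> M (Suc j)"
        using add_subgroupD(2)[OF add_subgroup_lattice_of _ exponent_in_M_Suc[of j]] j by (simp add: offset_def)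
    qed
  qed
  thus o: "offset j \<in> M j" using assms by blast
  show "gam ls j \<in> M (Suc j)"
    using add_subgroupD(4)[OF add_subgroup_lattice_of subsetD[OF M_step[OF assms] o] exponent_in_M_Suc[OF assms]]
      gam_eq[OF assms] by simp
qed

text \<open>\<open>gam ls j\<close> and \<open>ls ! j\<close> differ by \<open>offset j\<close>, an
  element of M_j, so they have the same order modulo M_j.\<close>

lemma gam_multiple_in_M:
  assumes j: "j < g" and k: "of_int k *s gam ls j \<in> M j" shows "int (nn j) dvd k"
proof (rule nn(3)[OF j])
  have "of_int k *s gam ls j - of_int k *s offset j \<in> M j"
    by (rule add_subgroupD(2)[OF add_subgroup_lattice_of k add_subgroup_smult[OF add_subgroup_lattice_of gam_in_M(1)[OF j]]])
  moreover have "of_int k *s gam ls j - of_int k *s offset j = of_int k *s ls ! j"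
    unfolding gam_eq[OF j] by (simp add: vec_eq_iff algebra_simps)
  ultimately show "of_int k *s ls ! j \<in> M j" by simp
qed

end

section \<open>Initial exponents\<close>

definition init_exponents :: "rat ^ 'd::finite \<Rightarrow> 'd puiseux \<Rightarrow> (rat ^ 'd) set"
  where "init_exponents v \<phi> = {u. puis_coeff \<phi> u \<noteq> 0 \<and> (\<forall>w. puis_coeff \<phi> w \<noteq> 0 \<longrightarrow> pairing v u \<le> pairing v w)}"

lemma init_exponents_nonempty:
  assumes "v \<in> sigma" "\<phi> \<noteq> 0" shows "init_exponents v \<phi> \<noteq> {}"
proof -
  obtain n where "n > 0" "\<forall>u. puis_coeff \<phi> u \<noteq> 0 \<longrightarrow> u \<in> grid n" using puis_grid by blast
  moreover obtain u where "puis_coeff \<phi> u \<noteq> 0" using puis_nonzeroD[OF assms(2)] by blast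
  ultimately show ?thesis using pairing_minimal[OF assms(1), of n "{u. puis_coeff \<phi> u \<noteq> 0}"]
    unfolding init_exponents_def by blast
qed

lemma pairing_less:
  assumes "\<forall>i. 0 < v $ i" "a \<le> b" "pairing v b \<le> pairing v a" shows "a = b"
proof (rule ccontr)
  assume "a \<noteq> b"
  hence "0 < pairing v (b - a)" using assms(1,2) by (intro pairing_pos) (auto simp: less_eq_vec_def)
  thus False using assms(3) by (simp add: pairing_diff)
qed

text \<open>For an interior weight \<open>c\<close> is the only exponent of \<open>\<psi>\<close> of
  minimal weight, so multiplication by \<open>\<psi>\<close> merely translates initial exponents by
  \<open>c\<close>.\<close>

lemma init_exponents_mult:
  assumes v: "\<forall>i. 0 < v $ i" and c: "least \<psi> c"
  shows "init_exponents v (\<phi> * \<psi>) \<subseteq> (\<lambda>u. u + c) ` init_exponents v \<phi>"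
proof
  fix u assume u: "u \<in> init_exponents v (\<phi> * \<psi>)"
  have vs: "v \<in> sigma" using v by (simp add: sigma_def less_imp_le)
  have mono: "pairing v a \<le> pairing v b" if "a \<le> b" for a b
  proof -
    have "0 \<le> b - a" using that by (simp add: less_eq_vec_def)
    from pairing_nonneg[OF vs this] show ?thesis by (simp add: pairing_diff)
  qed
  have unz: "puis_coeff (\<phi> * \<psi>) u \<noteq> 0" using u by (simp add: init_exponents_def)
  have "\<phi> \<noteq> 0" using unz by (auto simp: zero_puiseux.rep_eq)
  then obtain s0 where s0: "s0 \<in> init_exponents v \<phi>" using init_exponents_nonempty[OF vs] by blast
  have "puis_coeff (\<phi> * \<psi>) (s0 + c) = puis_coeff \<phi> s0 * puis_coeff \<psi> c"
    unfolding times_puiseux.rep_eq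
  proof (rule cauchy_single)
    fix s assume s: "puis_coeff \<phi> s \<noteq> 0" "puis_coeff \<psi> (s0 + c - s) \<noteq> 0"
    have "c \<le> s0 + c - s" using c s(2) by (simp add: least_def)
    hence "s \<le> s0" by (simp add: less_eq_vec_def)
    moreover have "pairing v s0 \<le> pairing v s" using s0 s(1) by (simp add: init_exponents_def)
    ultimately show "s = s0" by (rule pairing_less[OF v])
  qed
  hence "puis_coeff (\<phi> * \<psi>) (s0 + c) \<noteq> 0" using s0 c by (simp add: init_exponents_def least_def)
  hence le: "pairing v u \<le> pairing v s0 + pairing v c"
    using u by (auto simp: init_exponents_def pairing_add[symmetric])
  obtain s where s: "puis_coeff \<phi> s \<noteq> 0" "puis_coeff \<psi> (u - s) \<noteq> 0"
    using unz by (rule puis_coeff_mult_nonzeroD)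
  have cs: "c \<le> u - s" using c s(2) by (simp add: least_def)
  have ss: "pairing v s0 \<le> pairing v s" using s0 s(1) by (simp add: init_exponents_def)
  have "pairing v (u - s) \<le> pairing v c" using le ss by (simp add: pairing_diff)
  hence us: "c = u - s" using pairing_less[OF v cs] by simp
  have "pairing v s \<le> pairing v s0" using le mono[OF cs] by (simp add: pairing_diff)
  hence "s \<in> init_exponents v \<phi>" using s(1) s0 by (auto simp: init_exponents_def intro: order_trans)
  thus "u \<in> (\<lambda>u. u + c) ` init_exponents v \<phi>" using us by (intro image_eqI[of _ _ s]) simp_all
qed

text \<open>At the minimal weight, terms can cancel only at an exponent that is initial for at least
  two of them.\<close>

lemma init_exponents_sum:
  assumes v: "v \<in> sigma" and I: "finite I"
    and disj: "\<And>i j. i \<in> I \<Longrightarrow> j \<in> I \<Longrightarrow> i \<noteq> j \<Longrightarrow> init_exponents v (h i) \<inter> init_exponents v (h j) = {}"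
  shows "init_exponents v (\<Sum>i\<in>I. h i) \<subseteq> (\<Union>i\<in>I. init_exponents v (h i))"
proof
  fix u assume u: "u \<in> init_exponents v (\<Sum>i\<in>I. h i)"
  define J where "J = {i\<in>I. h i \<noteq> 0}"
  have "\<forall>i\<in>J. \<exists>x. x \<in> init_exponents v (h i)"
    unfolding J_def using init_exponents_nonempty[OF v] by blast
  then obtain x where x: "\<And>i. i \<in> J \<Longrightarrow> x i \<in> init_exponents v (h i)" by metis
  have su: "(\<Sum>i\<in>I. puis_coeff (h i) u) \<noteq> 0" using u by (simp add: init_exponents_def puis_coeff_sum)
  then obtain i1 where i1: "i1 \<in> I" "puis_coeff (h i1) u \<noteq> 0" by (rule sum.not_neutral_contains_not_neutral)
  hence i1J: "i1 \<in> J" unfolding J_def by (auto simp: zero_puiseux.rep_eq)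
  have "finite ((\<lambda>i. pairing v (x i)) ` J)" "(\<lambda>i. pairing v (x i)) ` J \<noteq> {}" using I i1J by (auto simp: J_def)
  note fin = this
  obtain i0 where i0J: "i0 \<in> J" "Min ((\<lambda>i. pairing v (x i)) ` J) = pairing v (x i0)"
    using Min_in[OF fin] by blast
  have i0: "i0 \<in> J" "\<And>i. i \<in> J \<Longrightarrow> pairing v (x i0) \<le> pairing v (x i)"
    using i0J(1) Min_le[OF fin(1)] unfolding i0J(2)[symmetric] by blast+
  have low: "pairing v (x i0) \<le> pairing v w" if "i \<in> I" "puis_coeff (h i) w \<noteq> 0" for i w
  proof -
    have "i \<in> J" using that by (auto simp: J_def zero_puiseux.rep_eq)
    hence "pairing v (x i0) \<le> pairing v (x i)" "pairing v (x i) \<le> pairing v w"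
      using i0(2) x[of i] that(2) by (auto simp: init_exponents_def)
    thus ?thesis by (rule order_trans)
  qed
  have init: "w \<in> init_exponents v (h i)" if "i \<in> I" "puis_coeff (h i) w \<noteq> 0" "pairing v w \<le> pairing v (x i0)" for i w
    unfolding init_exponents_def using that low order_trans by blast
  \<comment> \<open>\<open>x i0\<close> has the lowest weight among all exponents of all terms. If
    another term contained it, it would be initial there too, against disjointness; so it survives
    in the sum.\<close>
  have "puis_coeff (h i) (x i0) = 0" if i: "i \<in> I - {i0}" for i
  proof (rule ccontr)
    assume "puis_coeff (h i) (x i0) \<noteq> 0"
    hence "x i0 \<in> init_exponents v (h i)" using i by (intro init) auto
    moreover have "x i0 \<in> init_exponents v (h i0)" using x i0(1) by blast
    ultimately show False using disj[of i i0] i i0(1) by (auto simp: J_def)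
  qed
  hence "(\<Sum>i\<in>I. puis_coeff (h i) (x i0)) = puis_coeff (h i0) (x i0)"
    using sum.remove[OF I, of i0 "\<lambda>i. puis_coeff (h i) (x i0)"] i0(1) by (simp add: J_def)
  moreover have "puis_coeff (h i0) (x i0) \<noteq> 0" using x[OF i0(1)] by (simp add: init_exponents_def)
  ultimately have "pairing v u \<le> pairing v (x i0)"
    using u by (simp add: init_exponents_def puis_coeff_sum)
  hence "u \<in> init_exponents v (h i1)" by (intro init i1)
  thus "u \<in> (\<Union>i\<in>I. init_exponents v (h i))" using i1(1) by blast
qed

text \<open>Repeated division by \<open>m\<close> produces the digits, and the bound on the degree
  of \<open>p\<close> leaves room for \<open>n\<close> of them.\<close>

lemma adic_expansion:
  assumes L: "additive_monoid L" and m: "m \<in> polys_over L" "lead_coeff m = 1" "0 < Polynomial.degree m"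
    and p: "p \<in> polys_over L" "Polynomial.degree p < n * Polynomial.degree m"
  shows "\<exists>a. (\<forall>i<n. a i \<in> polys_over L \<and> Polynomial.degree (a i) < Polynomial.degree m) \<and> p = (\<Sum>i<n. a i * m ^ i)"
  using p
proof (induction n arbitrary: p)
  case (Suc n)
  obtain q r where qr: "q \<in> polys_over L" "r \<in> polys_over L" "p = q * m + r"
    "Polynomial.degree r < Polynomial.degree m" using monic_division[OF L m Suc.prems(1)] by blast
  have "\<exists>a. (\<forall>i<n. a i \<in> polys_over L \<and> Polynomial.degree (a i) < Polynomial.degree m) \<and> q = (\<Sum>i<n. a i * m ^ i)"
  proof (cases "q = 0")
    case True
    thus ?thesis using m(3) by (intro exI[of _ "\<lambda>_. 0"]) simp
  next
    case False
    have "m \<noteq> 0" using m(2) by auto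
    hence "Polynomial.degree q + Polynomial.degree m = Polynomial.degree (p - r)"
      using qr(3) False by (simp add: Polynomial.degree_mult_eq)
    also have "\<dots> \<le> max (Polynomial.degree p) (Polynomial.degree r)" by (rule degree_diff_le_max)
    also have "\<dots> < Suc n * Polynomial.degree m" using Suc.prems(2) qr(4) by simp
    finally show ?thesis using Suc.IH[OF qr(1)] by simp
  qed
  then obtain a where a: "\<forall>i<n. a i \<in> polys_over L \<and> Polynomial.degree (a i) < Polynomial.degree m"
    "q = (\<Sum>i<n. a i * m ^ i)" by blast
  define b where "b i = (case i of 0 \<Rightarrow> r | Suc i \<Rightarrow> a i)" for i
  have "p = (\<Sum>i<Suc n. b i * m ^ i)"
    unfolding sum.lessThan_Suc_shift qr(3) a(2) by (simp add: b_def sum_distrib_left mult_ac)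
  moreover have "\<forall>i<Suc n. b i \<in> polys_over L \<and> Polynomial.degree (b i) < Polynomial.degree m"
    using a(1) qr by (auto simp: b_def split: nat.split)
  ultimately show ?case by blast
qed simp

section \<open>The semigroup Gamma and the initial exponents of elements of O_S\<close>

lemma grid_1_eq:
  "grid 1 = {u \<in> integral_points. 0 \<le> u}" "grid (Suc 0) = {u \<in> integral_points. 0 \<le> u}"
  by (auto simp: grid_def integral_points_def less_eq_vec_def)

context branch
begin

definition "Gamma j = {m + (\<Sum>i<j. of_nat (k i) *s gam ls i) | m k. m \<in> grid 1}"

lemma Gam_eq: "Gam ls = Gamma g"
  by (simp add: Gam_def Gamma_def)

lemma Gamma_Suc:
  assumes "w \<in> Gamma j" shows "w + of_nat c *s gam ls j \<in> Gamma (Suc j)"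
proof -
  obtain m k where mk: "m \<in> grid 1" "w = m + (\<Sum>i<j. of_nat (k i) *s gam ls i)"
    using assms by (auto simp: Gamma_def)
  have "w + of_nat c *s gam ls j = m + (\<Sum>i<Suc j. of_nat ((k(j := c)) i) *s gam ls i)"
    unfolding mk(2) by (simp add: add.assoc)
  thus ?thesis unfolding Gamma_def using mk(1) by (intro CollectI exI conjI)
qed

lemma Gamma_subset_M:
  assumes "j \<le> g" shows "Gamma j \<subseteq> M j"
proof
  fix w assume "w \<in> Gamma j"
  then obtain m k where mk: "m \<in> grid 1" "w = m + (\<Sum>i<j. of_nat (k i) *s gam ls i)"
    by (auto simp: Gamma_def)
  have "m \<in> M j" using mk(1) subsetD[OF integral_points_subset, of m "take j ls"] by (simp add: grid_1_eq)
  moreover have "of_int (int (k i)) *s gam ls i \<in> M j" if "i < j" for i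
    using gam_in_M(2)[of i] M_mono[of "Suc i" j] that assms
    by (intro add_subgroup_smult add_subgroup_lattice_of) auto
  hence "(\<Sum>i<j. of_nat (k i) *s gam ls i) \<in> M j"
    by (intro add_subgroup_sum[OF add_subgroup_lattice_of]) auto
  ultimately show "w \<in> M j" unfolding mk(2) by (rule add_subgroupD(4)[OF add_subgroup_lattice_of])
qed

lemma Gam_subset_lattice: "Gam ls \<subseteq> lattice_of ls"
  using Gamma_subset_M[of g] by (simp add: Gam_eq)

lemma gam_nonneg: "j < g \<Longrightarrow> 0 \<le> gam ls j"
  using least_semiroot least_nonneg by blast

lemma Gam_nonneg:
  assumes "u \<in> Gam ls" shows "0 \<le> u"
proof -
  obtain m k where mk: "m \<in> grid 1" "u = m + (\<Sum>i<g. of_nat (k i) *s gam ls i)"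
    using assms by (auto simp: Gam_eq Gamma_def)
  have "0 \<le> m $ i + (\<Sum>j<g. of_nat (k j) * gam ls j $ i)" for i
    using grid_nonneg[OF mk(1)] gam_nonneg by (intro add_nonneg_nonneg sum_nonneg) (auto simp: less_eq_vec_def)
  thus ?thesis unfolding mk(2) by (simp add: less_eq_vec_def)
qed

lemma additive_monoid_Gam: "additive_monoid (Gam ls)"
  unfolding additive_monoid_def
proof (intro conjI ballI)
  have "0 = 0 + (\<Sum>i<g. of_nat ((\<lambda>_. 0) i) *s gam ls i)" by simp
  thus "0 \<in> Gam ls" unfolding Gam_eq Gamma_def using grid_0 by (intro CollectI exI conjI)
  fix u w assume "u \<in> Gam ls" "w \<in> Gam ls"
  then obtain m k m' k' where mk: "m \<in> grid 1" "u = m + (\<Sum>i<g. of_nat (k i) *s gam ls i)"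
    "m' \<in> grid 1" "w = m' + (\<Sum>i<g. of_nat (k' i) *s gam ls i)"
    unfolding Gam_eq Gamma_def by blast
  have "u + w = (m + m') + (\<Sum>i<g. of_nat ((\<lambda>i. k i + k' i) i) *s gam ls i)"
    unfolding mk by (simp add: vec_eq_iff sum.distrib algebra_simps)
  thus "u + w \<in> Gam ls" unfolding Gam_eq Gamma_def using grid_add[OF mk(1,3)] by (intro CollectI exI conjI)
qed

text \<open>The degree of \<open>p\<close> allows only \<open>nn j\<close> digits in its expansion
  by \<open>semiroot j\<close>. A digit contributes exponents of \<open>Gamma j\<close>, which lie
  in M_j, and the i-th power adds \<open>i\<close> times \<open>gam ls j\<close>; for i <
  \<open>nn j\<close> these multiples are distinct modulo M_j. The terms therefore have disjoint
  initial exponents.\<close>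

lemma init_exponents_Gamma:
  assumes v: "\<forall>i. 0 < v $ i"
  shows "j \<le> g \<Longrightarrow> p \<in> polys_over integral_points \<Longrightarrow> Polynomial.degree p < dd j \<Longrightarrow>
    init_exponents v (poly p \<zeta>) \<subseteq> Gamma j"
proof (induction j arbitrary: p)
  case 0
  then obtain a where a: "p = [:a:]" using degree_eq_zeroE by (auto simp: dd_def)
  have "a \<in> supported integral_points" using polys_overD[OF 0(2), of 0] a by simp
  hence "u \<in> grid 1" if "puis_coeff a u \<noteq> 0" for u
    using supportedD[OF _ that] puis_coeff_nonneg[OF that] by (simp add: grid_1_eq)
  thus ?case by (auto simp: a init_exponents_def Gamma_def)
next
  case (Suc j)
  have j: "j < g" using Suc.prems(1) by simp
  let ?q = "poly (semiroot j) \<zeta>"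
  have vs: "v \<in> sigma" using v by (simp add: sigma_def less_imp_le)
  have "Polynomial.degree p < nn j * Polynomial.degree (semiroot j)"
    using Suc.prems(3) by (simp add: semiroot_monic dd_def mult.commute)
  then obtain a where a: "\<forall>i<nn j. a i \<in> polys_over integral_points \<and> Polynomial.degree (a i) < dd j"
    "p = (\<Sum>i<nn j. a i * semiroot j ^ i)"
    using adic_expansion[OF additive_monoid_integral_points semiroot_polys_over[of j] semiroot_monic(1) _ Suc.prems(2), of "nn j"]
      dd_pos[of j] j by (auto simp: semiroot_monic(2))
  define h where "h i = poly (a i) \<zeta> * ?q ^ i" for i
  have ph: "poly p \<zeta> = (\<Sum>i<nn j. h i)" unfolding a(2) h_def by (simp add: poly_sum)
  have init: "init_exponents v (h i) \<subseteq> (\<lambda>u. u + of_nat i *s gam ls j) ` Gamma j" if i: "i < nn j" for i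
    using init_exponents_mult[OF v least_power[OF least_semiroot[OF j]], of "poly (a i) \<zeta>" i]
      Suc.IH[of "a i"] a(1) i j unfolding h_def by fastforce
  have "init_exponents v (\<Sum>i<nn j. h i) \<subseteq> (\<Union>i<nn j. init_exponents v (h i))"
  proof (rule init_exponents_sum[OF vs])
    fix i i' assume i: "i \<in> {..<nn j}" "i' \<in> {..<nn j}" "i \<noteq> i'"
    show "init_exponents v (h i) \<inter> init_exponents v (h i') = {}"
    proof (rule ccontr)
      assume "init_exponents v (h i) \<inter> init_exponents v (h i') \<noteq> {}"
      then obtain x y where xy: "x \<in> Gamma j" "y \<in> Gamma j"
        "x + of_nat i *s gam ls j = y + of_nat i' *s gam ls j" using init[of i] init[of i'] i by fastforce
      have "y - x \<in> M j" using xy Gamma_subset_M[of j] j by (intro add_subgroupD(2)[OF add_subgroup_lattice_of]) auto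
      moreover have "y - x = of_nat i *s gam ls j - of_nat i' *s gam ls j"
        using xy(3) by (metis add_diff_cancel_left' add_diff_eq diff_add_eq diff_diff_eq2)
      moreover have "of_nat i *s gam ls j - of_nat i' *s gam ls j = of_int (int i - int i') *s gam ls j"
        by (simp add: vec_eq_iff algebra_simps)
      ultimately have "int (nn j) dvd int i - int i'" using gam_multiple_in_M[OF j] by metis
      hence "int i mod int (nn j) = int i' mod int (nn j)" by (simp add: mod_eq_dvd_iff)
      thus False using i by simp
    qed
  qed simp
  also have "\<dots> \<subseteq> Gamma (Suc j)"
  proof (intro UN_least)
    fix i assume "i \<in> {..<nn j}"
    hence "init_exponents v (h i) \<subseteq> (\<lambda>u. u + of_nat i *s gam ls j) ` Gamma j" using init by simp
    also have "\<dots> \<subseteq> Gamma (Suc j)" by (intro image_subsetI Gamma_Suc)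
    finally show "init_exponents v (h i) \<subseteq> Gamma (Suc j)" .
  qed
  finally show ?case unfolding ph .
qed

text \<open>The last semiroot vanishes at \<open>\<zeta>\<close>, so a polynomial may be replaced by
  its remainder modulo it, whose degree is small enough for the expansion.\<close>

lemma init_exponents_O_S:
  assumes v: "\<forall>i. 0 < v $ i" and p: "p \<in> polys_over integral_points"
  shows "init_exponents v (poly p \<zeta>) \<subseteq> Gam ls"
proof -
  obtain q r where qr: "q \<in> polys_over integral_points" "r \<in> polys_over integral_points"
    "p = q * semiroot g + r" "Polynomial.degree r < dd g"
    using monic_division[OF additive_monoid_integral_points semiroot_polys_over[of g] semiroot_monic(1) _ p]
      dd_pos[of g] by (auto simp: semiroot_monic(2))
  have "poly p \<zeta> = poly r \<zeta>" unfolding qr(3) by (simp add: semiroot_last)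
  thus ?thesis using init_exponents_Gamma[OF v _ qr(2,4)] by (simp add: Gam_eq)
qed

text \<open>A monomial x^m times powers of semiroots has least exponent m plus the corresponding
  multiples of the \<gamma>'s.\<close>

lemma Gam_attained:
  assumes u: "u \<in> Gam ls"
  shows "\<exists>p\<in>polys_over integral_points. least (poly p \<zeta>) u \<and> puis_coeff (poly p \<zeta>) u = 1"
proof -
  obtain m k where mk: "m \<in> grid 1" "u = m + (\<Sum>i<g. of_nat (k i) *s gam ls i)"
    using u by (auto simp: Gam_eq Gamma_def)
  define q where "q = (\<Prod>i<g. semiroot i ^ k i)"
  have q: "q \<in> polys_over integral_points"
    unfolding q_def
    by (intro polys_over_prod polys_over_power additive_monoid_integral_points semiroot_polys_over) auto
  have lq: "least (poly q \<zeta>) (\<Sum>i<g. of_nat (k i) *s gam ls i)"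
    unfolding q_def poly_prod poly_power by (intro least_prod least_power least_semiroot) auto
  define c where "c = puis_coeff (poly q \<zeta>) (\<Sum>i<g. of_nat (k i) *s gam ls i)"
  have c: "c \<noteq> 0" using lq by (simp add: least_def c_def)
  \<comment> \<open>With leading coefficient 1 these elements can be combined linearly to produce
    any prescribed initial form.\<close>
  define a where "a = scale (1 / c) (puis_monom m)"
  have m0: "0 \<le> m" using grid_nonneg[OF mk(1)] .
  have la: "least a m" "puis_coeff a m = 1 / c"
    using c m0 by (auto simp: a_def scale.rep_eq puis_monom.rep_eq least_def)
  have aS: "a \<in> supported integral_points"
    using mk(1) by (intro supportedI) (auto simp: a_def scale.rep_eq puis_monom.rep_eq grid_1_eq split: if_splits)
  have "least (poly ([:a:] * q) \<zeta>) u" using least_mult[OF la(1) lq] mk(2) by simp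
  moreover have "puis_coeff (poly ([:a:] * q) \<zeta>) u = 1"
    using least_coeff_mult[OF la(1) lq] c unfolding mk(2) la(2) c_def[symmetric] by simp
  moreover have "[:a:] * q \<in> polys_over integral_points"
    by (intro polys_over_mult polys_over_pCons aS q additive_monoid_integral_points polys_over_0)
  ultimately show ?thesis by blast
qed

lemma O_S_supported: "p \<in> polys_over integral_points \<Longrightarrow> poly p \<zeta> \<in> supported (lattice_of ls)"
proof -
  assume p: "p \<in> polys_over integral_points"
  have "p \<in> polys_over (lattice_of ls)"
    using p integral_points_subset unfolding polys_over_def supported_def by blast
  thus ?thesis by (intro supported_poly add_subgroup_monoid add_subgroup_lattice_of supported_last)
qed

end

section \<open>Monomial valuations\<close>

lemma min_pairing_antimono: "U \<subseteq> W \<Longrightarrow> min_pairing v W \<le> min_pairing v U"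
  unfolding min_pairing_def by (rule INF_superset_mono) auto

lemma min_pairing_eq_infinity_iff: "min_pairing v U = \<infinity> \<longleftrightarrow> U = {}"
proof
  assume "min_pairing v U = \<infinity>"
  hence "\<not> (\<exists>u. u \<in> U)" unfolding min_pairing_def
    using INF_lower[of _ U "\<lambda>u. enat (nat \<lfloor>pairing v u\<rfloor>)"] by fastforce
  thus "U = {}" by blast
qed (simp add: min_pairing_def top_enat_def)

lemma min_pairing_Un: "U \<subseteq> S \<union> T \<Longrightarrow> min (min_pairing v S) (min_pairing v T) \<le> min_pairing v U"
  using min_pairing_antimono[of U "S \<union> T" v]
  by (simp add: min_pairing_def INF_union inf_min)

lemma min_pairing_attained:
  assumes "u \<in> U" "\<And>w. w \<in> U \<Longrightarrow> pairing v u \<le> pairing v w"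
  shows "min_pairing v U = enat (nat \<lfloor>pairing v u\<rfloor>)"
  unfolding min_pairing_def
  by (intro order_antisym INF_lower INF_greatest assms) (simp add: assms nat_mono floor_mono)

text \<open>Stated for coefficient functions, so that it covers series as well as elements of a
  semigroup algebra. Integrality makes the floor inside \<open>min_pairing\<close> additive.\<close>

lemma min_pairing_cauchy:
  assumes n: "n > 0" and f: "on_grid n f" and g: "on_grid n g" and v: "v \<in> sigma"
    and int: "\<And>u. f u \<noteq> 0 \<Longrightarrow> pairing v u \<in> \<int>" "\<And>u. g u \<noteq> 0 \<Longrightarrow> pairing v u \<in> \<int>"
  shows "min_pairing v {u. cauchy f g u \<noteq> 0} = min_pairing v {u. f u \<noteq> 0} + min_pairing v {u. g u \<noteq> 0}"
proof (cases "(\<exists>a. f a \<noteq> 0) \<and> (\<exists>b. g b \<noteq> 0)")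
  case True
  then obtain a b where ab: "f a \<noteq> 0" "g b \<noteq> 0" by blast
  obtain u w where uw: "f u \<noteq> 0" "g w \<noteq> 0" "cauchy f g (u + w) \<noteq> 0"
    "\<And>s. f s \<noteq> 0 \<Longrightarrow> pairing v u \<le> pairing v s" "\<And>s. g s \<noteq> 0 \<Longrightarrow> pairing v w \<le> pairing v s"
    by (rule cauchy_minimal[OF n f ab(1) g ab(2) v]) blast
  have "min_pairing v {u. cauchy f g u \<noteq> 0} = enat (nat \<lfloor>pairing v (u + w)\<rfloor>)"
  proof (rule min_pairing_attained)
    fix x assume "x \<in> {u. cauchy f g u \<noteq> 0}"
    then obtain s where "f s \<noteq> 0" "g (x - s) \<noteq> 0" by (auto elim: cauchy_nonzeroD)
    hence "pairing v u \<le> pairing v s" "pairing v w \<le> pairing v (x - s)" using uw by auto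
    thus "pairing v (u + w) \<le> pairing v x" by (simp add: pairing_add pairing_diff)
  qed (use uw in simp)
  moreover have "min_pairing v {u. f u \<noteq> 0} = enat (nat \<lfloor>pairing v u\<rfloor>)"
    "min_pairing v {u. g u \<noteq> 0} = enat (nat \<lfloor>pairing v w\<rfloor>)"
    using uw by (auto intro!: min_pairing_attained)
  moreover have "nat \<lfloor>pairing v (u + w)\<rfloor> = nat \<lfloor>pairing v u\<rfloor> + nat \<lfloor>pairing v w\<rfloor>"
  proof -
    have "0 \<le> pairing v u" "0 \<le> pairing v w"
      using uw(1,2) f g pairing_nonneg[OF v grid_nonneg] by (auto simp: on_grid_def)
    moreover obtain i j where "pairing v u = of_int i" "pairing v w = of_int j"
      using int uw(1,2) by (meson Ints_cases)
    ultimately show ?thesis by (simp add: pairing_add nat_add_distrib)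
  qed
  ultimately show ?thesis by simp
next
  case False
  hence "{u. cauchy f g u \<noteq> 0} = {}" by (auto elim: cauchy_nonzeroD)
  thus ?thesis using False min_pairing_eq_infinity_iff[of v "{}"] by auto
qed

section \<open>Transport of gradings and valuations\<close>

lemma cring_type_operations:
  fixes R :: "('a::comm_ring_1, 'm) ring_scheme" (structure)
  assumes ops: "mult R = (*)" "one R = 1" "zero R = 0" "add R = (+)"
    and cl: "0 \<in> carrier R" "1 \<in> carrier R" "\<And>x y. x \<in> carrier R \<Longrightarrow> y \<in> carrier R \<Longrightarrow> x + y \<in> carrier R"
      "\<And>x y. x \<in> carrier R \<Longrightarrow> y \<in> carrier R \<Longrightarrow> x * y \<in> carrier R" "\<And>x. x \<in> carrier R \<Longrightarrow> - x \<in> carrier R"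
  shows "cring R"
proof (rule cringI)
  show "abelian_group R"
    by (rule abelian_groupI) (auto simp: ops cl add_ac intro!: bexI[of _ "- x" for x])
  show "comm_monoid R" by (rule comm_monoidI) (auto simp: ops cl mult_ac)
qed (simp add: ops ring_distribs)

lemma finsum_type_operations:
  fixes R :: "('a::comm_ring_1, 'm) ring_scheme" (structure)
  assumes R: "cring R" and ops: "zero R = 0" "add R = (+)" and I: "finite I" "\<And>i. i \<in> I \<Longrightarrow> h i \<in> carrier R"
  shows "finsum R h I = sum h I"
proof -
  interpret cring R by (rule R)
  show ?thesis using I
  proof (induction I rule: finite_induct)
    case (insert i I)
    have "finsum R h (insert i I) = h i \<oplus> finsum R h I"
      using insert by (intro finsum_insert) auto
    thus ?case using insert by (simp add: ops)
  qed (simp add: ops)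
qed

lemma (in cring) additive_subgroupI:
  assumes "H \<subseteq> carrier R" "\<zero> \<in> H" "\<And>x y. x \<in> H \<Longrightarrow> y \<in> H \<Longrightarrow> x \<oplus> y \<in> H" "\<And>x. x \<in> H \<Longrightarrow> \<ominus> x \<in> H"
  shows "additive_subgroup H R"
  by (intro additive_subgroup.intro add.subgroupI) (use assms in \<open>auto simp: a_inv_def[symmetric]\<close>)

text \<open>An isomorphism of graded rings from \<open>B\<close> to \<open>A\<close> in which only
  \<open>B\<close> will be known to be a ring. The zero of \<open>A\<close> is then a mere field of
  a record, so its compatibility is demanded separately; that \<open>A\<close> is a multi-graded
  ring becomes a conclusion.\<close>

definition graded_transport :: "('a, 'm) graded_ring_scheme \<Rightarrow> ('b, 'n) graded_ring_scheme \<Rightarrow> ('a \<Rightarrow> 'b) \<Rightarrow> bool"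
  where "graded_transport B A \<Phi> \<longleftrightarrow> bij_betw \<Phi> (carrier B) (carrier A) \<and>
    (\<forall>x\<in>carrier B. \<forall>y\<in>carrier B. \<Phi> (x \<otimes>\<^bsub>B\<^esub> y) = \<Phi> x \<otimes>\<^bsub>A\<^esub> \<Phi> y \<and> \<Phi> (x \<oplus>\<^bsub>B\<^esub> y) = \<Phi> x \<oplus>\<^bsub>A\<^esub> \<Phi> y) \<and>
    \<Phi> \<one>\<^bsub>B\<^esub> = \<one>\<^bsub>A\<^esub> \<and> \<Phi> \<zero>\<^bsub>B\<^esub> = \<zero>\<^bsub>A\<^esub> \<and> grank A = grank B \<and>
    (\<forall>a. length a = grank B \<longrightarrow> component A a = \<Phi> ` component B a)"

locale graded_transport_loc =
  fixes B :: "('a, 'm) graded_ring_scheme" and A :: "('b, 'n) graded_ring_scheme" and \<Phi>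
  assumes B: "multi_graded B" and transport: "graded_transport B A \<Phi>"
begin

lemma cring_B: "cring B" using B by (simp add: multi_graded_def)

sublocale B: cring B by (rule cring_B)

lemma bij: "bij_betw \<Phi> (carrier B) (carrier A)"
  and mult: "x \<in> carrier B \<Longrightarrow> y \<in> carrier B \<Longrightarrow> \<Phi> (x \<otimes>\<^bsub>B\<^esub> y) = \<Phi> x \<otimes>\<^bsub>A\<^esub> \<Phi> y"
  and add: "x \<in> carrier B \<Longrightarrow> y \<in> carrier B \<Longrightarrow> \<Phi> (x \<oplus>\<^bsub>B\<^esub> y) = \<Phi> x \<oplus>\<^bsub>A\<^esub> \<Phi> y"
  and one: "\<Phi> \<one>\<^bsub>B\<^esub> = \<one>\<^bsub>A\<^esub>" and zero: "\<Phi> \<zero>\<^bsub>B\<^esub> = \<zero>\<^bsub>A\<^esub>"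
  and grank: "grank A = grank B"
  and comp: "length a = grank B \<Longrightarrow> component A a = \<Phi> ` component B a"
  using transport by (auto simp: graded_transport_def)

lemma inj: "x \<in> carrier B \<Longrightarrow> y \<in> carrier B \<Longrightarrow> \<Phi> x = \<Phi> y \<longleftrightarrow> x = y"
  using bij by (auto simp: bij_betw_def inj_on_def)

lemma in_carrier: "x \<in> carrier B \<Longrightarrow> \<Phi> x \<in> carrier A"
  using bij by (auto simp: bij_betw_def)

lemma carrier_A: "carrier A = \<Phi> ` carrier B"
  using bij by (auto simp: bij_betw_def)

lemma eq_zero_iff: "x \<in> carrier B \<Longrightarrow> \<Phi> x = \<zero>\<^bsub>A\<^esub> \<longleftrightarrow> x = \<zero>\<^bsub>B\<^esub>"
  using inj[of x "\<zero>\<^bsub>B\<^esub>"] zero by simp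

lemma cring_A: "cring A"
proof -
  have "\<Phi> \<in> ring_iso B A"
    using bij by (auto simp: ring_iso_def ring_hom_def in_carrier mult add one)
  from B.ring_iso_imp_img_cring[OF this] show ?thesis by (simp add: zero)
qed

sublocale A: cring A by (rule cring_A)

sublocale hom: ring_hom_cring B A \<Phi>
  by unfold_locales (auto simp: ring_hom_def in_carrier mult add one)

lemma component_subset: "length a = grank B \<Longrightarrow> component B a \<subseteq> carrier B"
  using B by (auto simp: multi_graded_def additive_subgroup.a_Hcarr)

lemma decomposition_carrier: "decomposition B y x \<Longrightarrow> y a \<in> carrier B"
  using component_subset unfolding decomposition_def by (metis B.zero_closed singletonD subsetD)

lemma decomposition_transport:
  assumes x: "x \<in> carrier B" and y: "\<And>a. y a \<in> carrier B"
  shows "decomposition A (\<Phi> \<circ> y) (\<Phi> x) \<longleftrightarrow> decomposition B y x"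
proof -
  have 1: "(\<Phi> \<circ> y) a \<in> (if length a = grank A then component A a else {\<zero>\<^bsub>A\<^esub>}) \<longleftrightarrow>
      y a \<in> (if length a = grank B then component B a else {\<zero>\<^bsub>B\<^esub>})" for a
  proof (cases "length a = grank B")
    case True
    have "y a \<in> component B a" if m: "\<Phi> (y a) \<in> \<Phi> ` component B a"
    proof -
      obtain w where w: "w \<in> component B a" "\<Phi> (y a) = \<Phi> w" using m by blast
      thus ?thesis using inj[of "y a" w] y component_subset[OF True] by blast
    qed
    hence "\<Phi> (y a) \<in> \<Phi> ` component B a \<longleftrightarrow> y a \<in> component B a" by blast
    thus ?thesis using True by (simp add: grank comp)
  qed (use y eq_zero_iff in \<open>simp add: grank\<close>)
  have nz: "{a. (\<Phi> \<circ> y) a \<noteq> \<zero>\<^bsub>A\<^esub>} = {a. y a \<noteq> \<zero>\<^bsub>B\<^esub>}" using y eq_zero_iff by simp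
  have 3: "\<Phi> x = (\<Oplus>\<^bsub>A\<^esub>a\<in>{a. y a \<noteq> \<zero>\<^bsub>B\<^esub>}. (\<Phi> \<circ> y) a) \<longleftrightarrow> x = (\<Oplus>\<^bsub>B\<^esub>a\<in>{a. y a \<noteq> \<zero>\<^bsub>B\<^esub>}. y a)"
    using hom.hom_finsum[of y "{a. y a \<noteq> \<zero>\<^bsub>B\<^esub>}"] y x inj[of x "(\<Oplus>\<^bsub>B\<^esub>a\<in>{a. y a \<noteq> \<zero>\<^bsub>B\<^esub>}. y a)"]
    by auto
  show ?thesis unfolding decomposition_def nz 1 3 by (rule refl)
qed

lemma unique_decomposition:
  assumes x: "x \<in> carrier B" shows "\<exists>!y. decomposition B y x"
  using B x by (simp add: multi_graded_def)

lemma decomposition_hcomp: "x \<in> carrier B \<Longrightarrow> decomposition B (hcomp B x) x"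
  unfolding hcomp_def by (rule theI'[of "\<lambda>y. decomposition B y x"]) (rule unique_decomposition)

lemma decomposition_A:
  assumes x: "x \<in> carrier B" shows "decomposition A z (\<Phi> x) \<longleftrightarrow> z = \<Phi> \<circ> hcomp B x"
proof
  assume z: "decomposition A z (\<Phi> x)"
  have "z a \<in> \<Phi> ` carrier B" for a
  proof -
    have za: "z a \<in> (if length a = grank A then component A a else {\<zero>\<^bsub>A\<^esub>})"
      using z unfolding decomposition_def by blast
    show ?thesis
    proof (cases "length a = grank B")
      case True
      thus ?thesis using za comp[OF True] component_subset[OF True] by (auto simp: grank)
    next
      case False
      hence "z a = \<Phi> \<zero>\<^bsub>B\<^esub>" using za by (simp add: grank zero)
      thus ?thesis by blast
    qed
  qed
  hence "\<forall>a. \<exists>y. y \<in> carrier B \<and> z a = \<Phi> y" by blast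
  then obtain y where y: "\<And>a. y a \<in> carrier B" "\<And>a. z a = \<Phi> (y a)" by metis
  hence "z = \<Phi> \<circ> y" by auto
  moreover from this have "decomposition B y x" using z decomposition_transport[OF x y(1)] by simp
  hence "y = hcomp B x" using unique_decomposition[OF x] decomposition_hcomp[OF x] by blast
  ultimately show "z = \<Phi> \<circ> hcomp B x" by simp
next
  show "z = \<Phi> \<circ> hcomp B x \<Longrightarrow> decomposition A z (\<Phi> x)"
    using decomposition_transport[OF x, of "hcomp B x"] decomposition_hcomp[OF x] decomposition_carrier by blast
qed

lemma hcomp_transport: "x \<in> carrier B \<Longrightarrow> hcomp A (\<Phi> x) = \<Phi> \<circ> hcomp B x"
  unfolding hcomp_def[of A] by (rule the_equality) (simp_all add: decomposition_A)

lemma multi_graded_A: "multi_graded A"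
  unfolding multi_graded_def
proof (intro conjI allI impI ballI)
  show "cring A" by (rule cring_A)
  fix a :: "nat list" assume a: "length a = grank A"
  hence aB: "additive_subgroup (component B a) B" using B by (simp add: multi_graded_def grank)
  show "additive_subgroup (component A a) A"
  proof (rule A.additive_subgroupI)
    note [simp] = comp[OF a[unfolded grank]]
    show "component A a \<subseteq> carrier A" using component_subset[OF a[unfolded grank]] in_carrier by auto
    show "\<zero>\<^bsub>A\<^esub> \<in> component A a" using additive_subgroup.zero_closed[OF aB] zero by (metis comp a grank imageI)
    fix x assume x: "x \<in> component A a"
    then obtain x' where x': "x' \<in> component B a" "x = \<Phi> x'" by auto
    have "\<ominus>\<^bsub>B\<^esub> x' \<in> component B a" 
      unfolding a_inv_def by (rule subgroup.m_inv_closed[OF additive_subgroup.a_subgroup[OF aB] x'(1)])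
    moreover have "\<ominus>\<^bsub>A\<^esub> x = \<Phi> (\<ominus>\<^bsub>B\<^esub> x')" using x' component_subset[OF a[unfolded grank]] by auto
    ultimately show "\<ominus>\<^bsub>A\<^esub> x \<in> component A a" by auto
    fix y assume "y \<in> component A a"
    then obtain y' where y': "y' \<in> component B a" "y = \<Phi> y'" by auto
    have "x' \<oplus>\<^bsub>B\<^esub> y' \<in> component B a" by (rule additive_subgroup.a_closed[OF aB x'(1) y'(1)])
    moreover have "x \<oplus>\<^bsub>A\<^esub> y = \<Phi> (x' \<oplus>\<^bsub>B\<^esub> y')"
      unfolding x'(2) y'(2) using x'(1) y'(1) component_subset[OF a[unfolded grank]]
      by (intro add[symmetric]) blast+
    ultimately show "x \<oplus>\<^bsub>A\<^esub> y \<in> component A a" by auto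
  qed
next
  fix x assume "x \<in> carrier A"
  then obtain x' where x': "x' \<in> carrier B" "x = \<Phi> x'" unfolding carrier_A by blast
  show "\<exists>!y. decomposition A y x" unfolding x'(2) by (simp add: decomposition_A[OF x'(1)])
next
  have "\<one>\<^bsub>B\<^esub> \<in> component B (replicate (grank B) 0)" using B by (simp add: multi_graded_def)
  thus "\<one>\<^bsub>A\<^esub> \<in> component A (replicate (grank A) 0)" using comp[of "replicate (grank B) 0"] one by (auto simp: grank intro: rev_image_eqI)
next
  fix a b :: "nat list" and x y assume ab: "length a = grank A" "length b = grank A" and "x \<in> component A a" "y \<in> component A b"
  then obtain x' y' where xy: "x' \<in> component B a" "x = \<Phi> x'" "y' \<in> component B b" "y = \<Phi> y'"
    using comp by (auto simp: grank)
  have "x' \<otimes>\<^bsub>B\<^esub> y' \<in> component B (map2 (+) a b)" using B ab xy by (simp add: multi_graded_def grank)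
  moreover have "x \<otimes>\<^bsub>A\<^esub> y = \<Phi> (x' \<otimes>\<^bsub>B\<^esub> y')"
    unfolding xy(2,4) using xy(1,3) component_subset[of a] component_subset[of b] ab unfolding grank
    by (intro mult[symmetric]) blast+
  ultimately show "x \<otimes>\<^bsub>A\<^esub> y \<in> component A (map2 (+) a b)" using comp[of "map2 (+) a b"] ab by (auto simp: grank)
qed

context
  fixes \<nu> :: "'a \<Rightarrow> enat" and \<omega> :: "'b \<Rightarrow> enat"
  assumes val: "\<And>x. x \<in> carrier B \<Longrightarrow> \<omega> (\<Phi> x) = \<nu> x"
begin

lemma filt_transport: "filt A \<omega> b = \<Phi> ` filt B \<nu> b"
  unfolding filt_def carrier_A using val by auto

lemma discrete_valuation_transport:
  assumes \<nu>: "discrete_valuation B \<nu>" shows "discrete_valuation A \<omega>"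
  unfolding discrete_valuation_def carrier_A
proof (intro conjI ballI)
  fix x assume "x \<in> \<Phi> ` carrier B"
  then obtain x' where x': "x' \<in> carrier B" "x = \<Phi> x'" by blast
  show "\<omega> x = \<infinity> \<longleftrightarrow> x = \<zero>\<^bsub>A\<^esub>"
    using \<nu> x' eq_zero_iff[OF x'(1)] val by (simp add: discrete_valuation_def)
  fix y assume "y \<in> \<Phi> ` carrier B"
  then obtain y' where y': "y' \<in> carrier B" "y = \<Phi> y'" by blast
  show "\<omega> (x \<otimes>\<^bsub>A\<^esub> y) = \<omega> x + \<omega> y"
    using \<nu> x' y' val mult[of x' y'] by (metis B.m_closed discrete_valuation_def)
  show "min (\<omega> x) (\<omega> y) \<le> \<omega> (x \<oplus>\<^bsub>A\<^esub> y)"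
    using \<nu> x' y' val add[of x' y'] by (metis B.a_closed discrete_valuation_def)
next
  show "\<exists>x\<in>\<Phi> ` carrier B. \<omega> x \<noteq> 0 \<and> \<omega> x \<noteq> \<infinity>"
    using \<nu> val by (auto simp: discrete_valuation_def)
qed

lemma compatible_val_transport: "compatible_val B \<nu> \<Longrightarrow> compatible_val A \<omega>"
  unfolding compatible_val_def filt_transport
  by (auto simp: hcomp_transport filt_def)

end

end

section \<open>Composition of transports and carrying along injections\<close>

lemma graded_transport_comp:
  assumes "graded_transport C B \<Psi>" "graded_transport B A \<Phi>" "\<one>\<^bsub>C\<^esub> \<in> carrier C" "\<zero>\<^bsub>C\<^esub> \<in> carrier C"
  shows "graded_transport C A (\<Phi> \<circ> \<Psi>)"
proof -
  have im: "\<Psi> ` carrier C = carrier B" using assms(1) by (auto simp: graded_transport_def bij_betw_def)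
  hence c: "\<Psi> x \<in> carrier B" if "x \<in> carrier C" for x using that by blast
  show ?thesis unfolding graded_transport_def
  proof (intro conjI)
    show "bij_betw (\<Phi> \<circ> \<Psi>) (carrier C) (carrier A)"
      using assms by (auto simp: graded_transport_def intro: bij_betw_trans)
  qed (use assms c in \<open>auto simp: graded_transport_def\<close>)
qed

lemma carry_ring_simps:
  "carrier (carry_ring f A) = f ` carrier A"
  "mult (carry_ring f A) = (\<lambda>a b. f (inv_into (carrier A) f a \<otimes>\<^bsub>A\<^esub> inv_into (carrier A) f b))"
  "add (carry_ring f A) = (\<lambda>a b. f (inv_into (carrier A) f a \<oplus>\<^bsub>A\<^esub> inv_into (carrier A) f b))"
  "one (carry_ring f A) = f \<one>\<^bsub>A\<^esub>" "zero (carry_ring f A) = f \<zero>\<^bsub>A\<^esub>"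
  "grank (carry_ring f A) = grank A" "component (carry_ring f A) = (\<lambda>a. f ` component A a)"
  by (simp_all add: carry_ring_def ring.extend_def graded_ring.fields_def image_ring_def image_group_def
      monoid.extend_def)

lemma graded_transport_carry:
  assumes "inj_on f (carrier A)"
  shows "graded_transport A (carry_ring f A) f"
  using assms by (auto simp: graded_transport_def carry_ring_simps bij_betw_def)

lemma carry_val_apply: "inj_on f (carrier A) \<Longrightarrow> x \<in> carrier A \<Longrightarrow> carry_val f A \<omega> (f x) = \<omega> x"
  by (simp add: carry_val_def)

section \<open>Semigroup algebras\<close>

text \<open>Identifies the product with that of series, so that \<open>min_pairing_cauchy\<close>
  also gives multiplicativity of the valuations here.\<close>

lemma lookup_mult_cauchy:
  fixes p q :: "(rat ^ 'd) \<Rightarrow>\<^sub>0 complex"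
  shows "Poly_Mapping.lookup (p * q) = cauchy (Poly_Mapping.lookup p) (Poly_Mapping.lookup q)"
proof
  fix u
  have "(Poly_Mapping.lookup q w when u = s + w) = (Poly_Mapping.lookup q w when w = u - s)" for s w
    by (simp add: when_def algebra_simps)
  hence "Poly_Mapping.lookup (p * q) u = (\<Sum>s. Poly_Mapping.lookup p s * Poly_Mapping.lookup q (u - s))"
    by (simp add: lookup_mult)
  thus "Poly_Mapping.lookup (p * q) u = cauchy (Poly_Mapping.lookup p) (Poly_Mapping.lookup q) u"
    by (simp add: Sum_any.expand_set cauchy_def)
qed

lemma lookup_mult_sum:
  fixes p q :: "(rat ^ 'd) \<Rightarrow>\<^sub>0 complex"
  assumes "finite K" "Poly_Mapping.keys p \<subseteq> K"
  shows "Poly_Mapping.lookup (p * q) u = (\<Sum>s\<in>K. Poly_Mapping.lookup p s * Poly_Mapping.lookup q (u - s))"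
  unfolding lookup_mult_cauchy cauchy_def
  by (rule sum.mono_neutral_left) (use assms in \<open>auto simp: in_keys_iff\<close>)

lift_definition pm_restrict :: "'a set \<Rightarrow> ('a \<Rightarrow>\<^sub>0 'b::zero) \<Rightarrow> ('a \<Rightarrow>\<^sub>0 'b)"
  is "\<lambda>A f u. if u \<in> A then f u else 0"
  by (auto elim: finite_subset[rotated])

lemma keys_pm_restrict: "Poly_Mapping.keys (pm_restrict A p) = Poly_Mapping.keys p \<inter> A"
  by (auto simp: in_keys_iff pm_restrict.rep_eq split: if_splits)

lemma pm_restrict_id: "Poly_Mapping.keys p \<subseteq> A \<Longrightarrow> pm_restrict A p = p"
  by (rule poly_mapping_eqI) (auto simp: pm_restrict.rep_eq in_keys_iff)

lemma pm_restrict_0: "Poly_Mapping.keys p \<inter> A = {} \<Longrightarrow> pm_restrict A p = 0"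
  by (rule poly_mapping_eqI) (auto simp: pm_restrict.rep_eq in_keys_iff)

lemma pm_restrict_add: "pm_restrict A (p + q) = pm_restrict A p + pm_restrict A (q :: 'a \<Rightarrow>\<^sub>0 'b::monoid_add)"
  by (rule poly_mapping_eqI) (simp add: pm_restrict.rep_eq lookup_add)

lemma pm_restrict_sum: "pm_restrict A (sum h I) = (\<Sum>i\<in>I. pm_restrict A (h i :: 'a \<Rightarrow>\<^sub>0 'b::comm_monoid_add))"
  by (induction I rule: infinite_finite_induct) (simp_all add: pm_restrict_add pm_restrict_0)

lemma keys_1: "Poly_Mapping.keys (1 :: ('a::zero) \<Rightarrow>\<^sub>0 'b::zero_neq_one) = {0}"
  by (auto simp: in_keys_iff lookup_one)

lemma semigroup_algebra_simps:
  "carrier (semigroup_algebra G us) = {p. Poly_Mapping.keys p \<subseteq> G}"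
  "mult (semigroup_algebra G us) = (*)" "add (semigroup_algebra G us) = (+)"
  "one (semigroup_algebra G us) = 1" "zero (semigroup_algebra G us) = 0"
  "grank (semigroup_algebra G us) = length us"
  "component (semigroup_algebra G us) a =
    {p \<in> {p. Poly_Mapping.keys p \<subseteq> G}. \<forall>u\<in>Poly_Mapping.keys p. \<forall>j<length us. pairing (us ! j) u = of_nat (a ! j)}"
  by (simp_all add: semigroup_algebra_def ring.extend_def graded_ring.fields_def subring_on_def)

text \<open>\<open>G\<close> will be the semigroup Gamma and \<open>V\<close> the set of the given
  vectors. The common denominator makes minima exist, and \<open>nontrivial\<close> supplies the
  element of positive finite value that a discrete valuation must have.\<close>

locale weighted_monoid =
  fixes G V :: "(rat ^ 'd::finite) set"
  assumes G: "additive_monoid G" and grid: "\<exists>n>0. G \<subseteq> grid n" and sigma: "V \<subseteq> sigma"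
    and integral: "\<And>v u. v \<in> V \<Longrightarrow> u \<in> G \<Longrightarrow> pairing v u \<in> \<int>"
    and nontrivial: "\<And>v. v \<in> V \<Longrightarrow> \<exists>u\<in>G. pairing v u \<noteq> 0"
begin

lemma weight_nonneg: "v \<in> V \<Longrightarrow> u \<in> G \<Longrightarrow> 0 \<le> pairing v u"
  using sigma grid grid_nonneg pairing_nonneg by blast

definition weight :: "rat ^ 'd \<Rightarrow> rat ^ 'd \<Rightarrow> nat" where "weight v u = nat \<lfloor>pairing v u\<rfloor>"

lemma pairing_weight: "v \<in> V \<Longrightarrow> u \<in> G \<Longrightarrow> pairing v u = of_nat (weight v u)"
  using integral[of v u] weight_nonneg[of v u] by (auto simp: weight_def elim!: Ints_cases)

lemma pairing_eq_iff: "v \<in> V \<Longrightarrow> u \<in> G \<Longrightarrow> pairing v u = of_nat b \<longleftrightarrow> weight v u = b"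
  by (simp add: pairing_weight)

definition "mdeg us u = map (\<lambda>v. weight v u) us"

lemma length_mdeg [simp]: "length (mdeg us u) = length us"
  by (simp add: mdeg_def)

lemma component_eq:
  assumes us: "set us \<subseteq> V" and a: "length a = length us"
  shows "component (semigroup_algebra G us) a = {p. Poly_Mapping.keys p \<subseteq> {u \<in> G. mdeg us u = a}}"
proof -
  have "(\<forall>j<length us. pairing (us ! j) u = of_nat (a ! j)) \<longleftrightarrow> mdeg us u = a" if "u \<in> G" for u
    using that us a by (auto simp: list_eq_iff_nth_eq mdeg_def pairing_eq_iff subset_iff)
  thus ?thesis unfolding semigroup_algebra_simps by (auto simp: subset_iff)
qed

lemma cring_algebra: "cring (semigroup_algebra G us)"
proof (rule cring_type_operations)
  show "1 \<in> carrier (semigroup_algebra G us)"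
    using G by (simp add: semigroup_algebra_simps keys_1 additive_monoid_def)
  fix x y assume "x \<in> carrier (semigroup_algebra G us)" "y \<in> carrier (semigroup_algebra G us)"
  hence xy: "Poly_Mapping.keys x \<subseteq> G" "Poly_Mapping.keys y \<subseteq> G" by (simp_all add: semigroup_algebra_simps)
  show "x + y \<in> carrier (semigroup_algebra G us)"
    using Poly_Mapping.keys_add[of x y] xy by (auto simp: semigroup_algebra_simps)
  show "x * y \<in> carrier (semigroup_algebra G us)"
  proof -
    have "{a + b | a b. a \<in> Poly_Mapping.keys x \<and> b \<in> Poly_Mapping.keys y} \<subseteq> G"
      using xy G unfolding additive_monoid_def by blast
    thus ?thesis using Poly_Mapping.keys_mult[of x y] unfolding semigroup_algebra_simps by blast
  qed
qed (simp_all add: semigroup_algebra_simps)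

lemma mdeg_add:
  assumes us: "set us \<subseteq> V" and uw: "u \<in> G" "w \<in> G"
  shows "mdeg us (u + w) = map2 (+) (mdeg us u) (mdeg us w)"
proof -
  have "weight v (u + w) = weight v u + weight v w" if v: "v \<in> V" for v
  proof -
    have uwG: "u + w \<in> G" using G uw by (auto simp: additive_monoid_def)
    have "(of_nat (weight v (u + w)) :: rat) = of_nat (weight v u + weight v w)"
      unfolding of_nat_add pairing_weight[OF v uwG, symmetric] pairing_weight[OF v uw(1), symmetric]
        pairing_weight[OF v uw(2), symmetric] by (rule pairing_add)
    thus ?thesis by (simp only: of_nat_eq_iff)
  qed
  thus ?thesis using us by (auto simp: mdeg_def list_eq_iff_nth_eq subset_iff)
qed

text \<open>Exponents are partitioned by their multidegree, so the homogeneous components are the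
  restrictions to level sets. A list of the wrong length has an empty level set, in agreement with
  the zero that \<open>decomposition\<close> prescribes there.\<close>

lemma decomposition_algebra:
  assumes us: "set us \<subseteq> V" and p: "Poly_Mapping.keys p \<subseteq> G"
  shows "decomposition (semigroup_algebra G us) y p \<longleftrightarrow> y = (\<lambda>a. pm_restrict {u. mdeg us u = a} p)"
proof -
  let ?A = "semigroup_algebra G us"
  have comp: "x \<in> (if length a = grank ?A then component ?A a else {\<zero>\<^bsub>?A\<^esub>})
      \<longleftrightarrow> Poly_Mapping.keys x \<subseteq> {u \<in> G. mdeg us u = a}" for x a
  proof (cases "length a = length us")
    case False
    hence "mdeg us u \<noteq> a" for u by auto
    thus ?thesis using False by (simp add: semigroup_algebra_simps)
  qed (simp add: component_eq[OF us] semigroup_algebra_simps(6))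
  show ?thesis
  proof
    assume y: "decomposition ?A y p"
    hence ya: "Poly_Mapping.keys (y a) \<subseteq> {u \<in> G. mdeg us u = a}" for a
      using comp unfolding decomposition_def by blast
    have fin: "finite {a. y a \<noteq> 0}" and s: "p = finsum ?A y {a. y a \<noteq> 0}"
      using y by (simp_all add: decomposition_def semigroup_algebra_simps)
    have yc: "y a \<in> carrier ?A" for a using ya[of a] by (auto simp: semigroup_algebra_simps)
    have "p = (\<Sum>a | y a \<noteq> 0. y a)"
      using s fin yc by (subst (asm) finsum_type_operations[OF cring_algebra]) (simp_all add: semigroup_algebra_simps)
    hence "pm_restrict {u. mdeg us u = c} p = (\<Sum>a | y a \<noteq> 0. pm_restrict {u. mdeg us u = c} (y a))" for c
      by (metis pm_restrict_sum)
    also have "(\<Sum>a | y a \<noteq> 0. pm_restrict {u. mdeg us u = c} (y a)) = (\<Sum>a | y a \<noteq> 0. if a = c then y c else 0)" for c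
    proof (rule sum.cong)
      fix a
      show "pm_restrict {u. mdeg us u = c} (y a) = (if a = c then y c else 0)"
        using ya[of a] by (auto intro!: pm_restrict_id pm_restrict_0)
    qed simp
    also have "(\<Sum>a | y a \<noteq> 0. if a = c then y c else 0) = y c" for c using fin by (simp add: sum.delta)
    finally show "y = (\<lambda>a. pm_restrict {u. mdeg us u = a} p)" by auto
  next
    assume y: "y = (\<lambda>a. pm_restrict {u. mdeg us u = a} p)"
    have "{a. y a \<noteq> 0} \<subseteq> mdeg us ` Poly_Mapping.keys p"
    proof
      fix a assume "a \<in> {a. y a \<noteq> 0}"
      hence "Poly_Mapping.keys p \<inter> {u. mdeg us u = a} \<noteq> {}"
        using pm_restrict_0[of p "{u. mdeg us u = a}"] by (auto simp: y)
      thus "a \<in> mdeg us ` Poly_Mapping.keys p" by blast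
    qed
    hence fin: "finite {a. y a \<noteq> 0}" by (rule finite_subset) simp
    have yc: "y a \<in> carrier ?A" for a using p by (auto simp: y semigroup_algebra_simps keys_pm_restrict)
    have "p = (\<Sum>a | y a \<noteq> 0. y a)"
    proof (rule poly_mapping_eqI)
      fix u
      have "Poly_Mapping.lookup (\<Sum>a | y a \<noteq> 0. y a) u = (\<Sum>a | y a \<noteq> 0. if a = mdeg us u then Poly_Mapping.lookup p u else 0)"
        unfolding lookup_sum by (intro sum.cong refl) (auto simp: y pm_restrict.rep_eq)
      also have "\<dots> = Poly_Mapping.lookup p u"
      proof (cases "y (mdeg us u) = 0")
        case True
        hence "Poly_Mapping.lookup (y (mdeg us u)) u = 0" by simp
        hence "Poly_Mapping.lookup p u = 0" unfolding y pm_restrict.rep_eq by simp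
        thus ?thesis by (simp cong: if_cong)
      qed (use fin in simp)
      finally show "Poly_Mapping.lookup p u = Poly_Mapping.lookup (\<Sum>a | y a \<noteq> 0. y a) u" by simp
    qed
    hence "p = finsum ?A y {a. y a \<noteq> 0}"
      using fin yc by (subst finsum_type_operations[OF cring_algebra]) (simp_all add: semigroup_algebra_simps)
    moreover have "\<forall>a. y a \<in> (if length a = grank ?A then component ?A a else {\<zero>\<^bsub>?A\<^esub>})"
      unfolding comp using p by (auto simp: y keys_pm_restrict)
    ultimately show "decomposition ?A y p"
      unfolding decomposition_def using fin by (simp add: semigroup_algebra_simps(5))
  qed
qed

lemma hcomp_algebra:
  "set us \<subseteq> V \<Longrightarrow> Poly_Mapping.keys p \<subseteq> G \<Longrightarrow> hcomp (semigroup_algebra G us) p a = pm_restrict {u. mdeg us u = a} p"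
  by (simp add: hcomp_def decomposition_algebra)

lemma multi_graded_algebra:
  assumes us: "set us \<subseteq> V" shows "multi_graded (semigroup_algebra G us)"
  unfolding multi_graded_def
proof (intro conjI allI impI ballI)
  let ?A = "semigroup_algebra G us"
  show "cring ?A" by (rule cring_algebra)
  interpret cring ?A by (rule cring_algebra)
  {
    fix a :: "nat list" assume "length a = grank ?A"
    hence a: "length a = length us" by (simp add: semigroup_algebra_simps)
    have minus: "\<ominus>\<^bsub>?A\<^esub> x = - x" if "Poly_Mapping.keys x \<subseteq> G" for x
    proof -
      have "- x \<oplus>\<^bsub>?A\<^esub> x = \<zero>\<^bsub>?A\<^esub>" by (simp add: semigroup_algebra_simps)
      from minus_equality[OF this] that show ?thesis by (simp add: semigroup_algebra_simps)
    qed
    show "additive_subgroup (component ?A a) ?A"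
    proof (rule additive_subgroupI)
      fix x y assume xy: "x \<in> component ?A a" "y \<in> component ?A a"
      show "x \<oplus>\<^bsub>?A\<^esub> y \<in> component ?A a"
        using xy Poly_Mapping.keys_add[of x y] unfolding component_eq[OF us a] semigroup_algebra_simps by blast
    next
      fix x assume x: "x \<in> component ?A a"
      hence "Poly_Mapping.keys x \<subseteq> G" unfolding component_eq[OF us a] by blast
      thus "\<ominus>\<^bsub>?A\<^esub> x \<in> component ?A a" using x minus[of x] unfolding component_eq[OF us a] by simp
    qed (auto simp: component_eq[OF us a] semigroup_algebra_simps)
  }
  fix x assume "x \<in> carrier ?A"
  thus "\<exists>!y. decomposition ?A y x" using decomposition_algebra[OF us] by (simp add: semigroup_algebra_simps)
next
  let ?A = "semigroup_algebra G us"
  show "\<one>\<^bsub>?A\<^esub> \<in> component ?A (replicate (grank ?A) 0)"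
    using G by (simp add: semigroup_algebra_simps keys_1 additive_monoid_def)
  fix a b :: "nat list" and x y assume ab: "length a = grank ?A" "length b = grank ?A"
    and xy: "x \<in> component ?A a" "y \<in> component ?A b"
  hence l: "length a = length us" "length b = length us" "length (map2 (+) a b) = length us"
    by (simp_all add: semigroup_algebra_simps)
  have k: "Poly_Mapping.keys x \<subseteq> {u \<in> G. mdeg us u = a}" "Poly_Mapping.keys y \<subseteq> {u \<in> G. mdeg us u = b}"
    using xy unfolding component_eq[OF us l(1)] component_eq[OF us l(2)] by blast+
  have "u + w \<in> {u \<in> G. mdeg us u = map2 (+) a b}" if "u \<in> Poly_Mapping.keys x" "w \<in> Poly_Mapping.keys y" for u w
  proof -
    have "u \<in> G" "mdeg us u = a" "w \<in> G" "mdeg us w = b" using that k by blast+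
    thus ?thesis using mdeg_add[OF us, of u w] G by (simp add: additive_monoid_def)
  qed
  hence "Poly_Mapping.keys (x * y) \<subseteq> {u \<in> G. mdeg us u = map2 (+) a b}"
    using Poly_Mapping.keys_mult[of x y] by blast
  thus "x \<otimes>\<^bsub>?A\<^esub> y \<in> component ?A (map2 (+) a b)"
    unfolding component_eq[OF us l(3)] semigroup_algebra_simps(2) by (rule CollectI)
qed

lemma algebra_val_ge_iff:
  assumes "v \<in> V" "Poly_Mapping.keys p \<subseteq> G"
  shows "enat b \<le> algebra_val v p \<longleftrightarrow> (\<forall>u\<in>Poly_Mapping.keys p. b \<le> weight v u)"
  by (simp add: algebra_val_def min_pairing_def weight_def le_INF_iff)

lemma discrete_valuation_algebra:
  assumes v: "v \<in> V" shows "discrete_valuation (semigroup_algebra G us) (algebra_val v)"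
proof -
  let ?A = "semigroup_algebra G us"
  obtain n where n: "n > 0" "G \<subseteq> grid n" using grid by blast
  have keys: "Poly_Mapping.keys p = {u. Poly_Mapping.lookup p u \<noteq> 0}" for p :: "(rat ^ 'd) \<Rightarrow>\<^sub>0 complex"
    by (auto simp: in_keys_iff)
  have mult: "algebra_val v (x * y) = algebra_val v x + algebra_val v y"
    if xy: "Poly_Mapping.keys x \<subseteq> G" "Poly_Mapping.keys y \<subseteq> G" for x y
    unfolding algebra_val_def keys lookup_mult_cauchy
  proof (rule min_pairing_cauchy[OF n(1)])
    show "on_grid n (Poly_Mapping.lookup x)" "on_grid n (Poly_Mapping.lookup y)"
      using xy n by (auto simp: on_grid_def in_keys_iff subset_iff)
    show "v \<in> sigma" using v sigma by blast
  qed (use integral[OF v] xy in \<open>auto simp: in_keys_iff subset_iff\<close>)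
  have add: "min (algebra_val v x) (algebra_val v y) \<le> algebra_val v (x + y)" for x y
    unfolding algebra_val_def by (rule min_pairing_Un) (rule Poly_Mapping.keys_add)
  obtain u where u: "u \<in> G" "pairing v u \<noteq> 0" using nontrivial[OF v] by blast
  have "algebra_val v (Poly_Mapping.single u 1) = enat (weight v u)"
    by (simp add: algebra_val_def min_pairing_def weight_def)
  moreover have "weight v u \<noteq> 0" using u pairing_weight[OF v] by auto
  ultimately have "\<exists>x\<in>carrier ?A. algebra_val v x \<noteq> 0 \<and> algebra_val v x \<noteq> \<infinity>"
    using u by (intro bexI[of _ "Poly_Mapping.single u 1"]) (auto simp: semigroup_algebra_simps zero_enat_def)
  thus ?thesis
    unfolding discrete_valuation_def using mult add
    by (auto simp: semigroup_algebra_simps algebra_val_def min_pairing_eq_infinity_iff)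
qed

lemma compatible_val_algebra:
  assumes "set us \<subseteq> V" shows "compatible_val (semigroup_algebra G us) (algebra_val v)"
  unfolding compatible_val_def filt_def
proof (intro allI ballI)
  fix b x a assume "x \<in> {x \<in> carrier (semigroup_algebra G us). enat b \<le> algebra_val v x}"
  hence x: "Poly_Mapping.keys x \<subseteq> G" "enat b \<le> algebra_val v x" by (simp_all add: semigroup_algebra_simps)
  have "algebra_val v x \<le> algebra_val v (pm_restrict {u. mdeg us u = a} x)"
    unfolding algebra_val_def keys_pm_restrict by (rule min_pairing_antimono) auto
  thus "hcomp (semigroup_algebra G us) x a \<in> {x \<in> carrier (semigroup_algebra G us). enat b \<le> algebra_val v x}"
    using x order_trans[OF x(2)] by (auto simp: hcomp_algebra[OF assms x(1)] semigroup_algebra_simps keys_pm_restrict)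
qed

definition "part v b p = pm_restrict {u. weight v u = b} (p :: (rat ^ 'd) \<Rightarrow>\<^sub>0 complex)"

lemma keys_part: "Poly_Mapping.keys (part v b p) = {u \<in> Poly_Mapping.keys p. weight v u = b}"
  by (auto simp: part_def keys_pm_restrict)

lemma lookup_part: "Poly_Mapping.lookup (part v b p) u = (if weight v u = b then Poly_Mapping.lookup p u else 0)"
  by (simp add: part_def pm_restrict.rep_eq)

lemma part_ext:
  assumes "\<And>b. part v b p = part v b q" shows "p = q"
  by (rule poly_mapping_eqI) (metis assms lookup_part)

text \<open>Weights add along u = s + (u - s), so each product of two terms is counted for exactly
  one \<open>i\<close>.\<close>

lemma part_mult:
  assumes v: "v \<in> V" and pq: "Poly_Mapping.keys p \<subseteq> G" "Poly_Mapping.keys q \<subseteq> G"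
  shows "part v b (p * q) = (\<Sum>i\<le>b. part v i p * part v (b - i) q)"
proof (rule poly_mapping_eqI)
  fix u
  let ?K = "Poly_Mapping.keys p"
  have t: "(\<Sum>i\<le>b. Poly_Mapping.lookup (part v i p) s * Poly_Mapping.lookup (part v (b - i) q) (u - s))
      = (if weight v u = b then Poly_Mapping.lookup p s * Poly_Mapping.lookup q (u - s) else 0)"
    if s: "s \<in> ?K" for s
  proof (cases "u - s \<in> Poly_Mapping.keys q")
    case True
    have sG: "s \<in> G" "u - s \<in> G" using s True pq by auto
    hence "s + (u - s) \<in> G" using G unfolding additive_monoid_def by blast
    hence uG: "u \<in> G" by simp
    have "(of_nat (weight v u) :: rat) = of_nat (weight v s + weight v (u - s))"
      using pairing_weight[OF v uG] pairing_weight[OF v sG(1)] pairing_weight[OF v sG(2)] by (simp add: pairing_diff)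
    hence w: "weight v u = weight v s + weight v (u - s)" by (simp only: of_nat_eq_iff)
    have "(\<Sum>i\<le>b. Poly_Mapping.lookup (part v i p) s * Poly_Mapping.lookup (part v (b - i) q) (u - s))
      = (\<Sum>i\<le>b. if weight v s = i then Poly_Mapping.lookup p s * Poly_Mapping.lookup (part v (b - i) q) (u - s) else 0)"
      by (intro sum.cong refl) (simp add: lookup_part)
    also have "\<dots> = (if weight v u = b then Poly_Mapping.lookup p s * Poly_Mapping.lookup q (u - s) else 0)"
      unfolding w by (auto simp: lookup_part)
    finally show ?thesis .
  next
    case False
    thus ?thesis by (auto simp: in_keys_iff lookup_part intro!: sum.neutral)
  qed
  have "Poly_Mapping.lookup (\<Sum>i\<le>b. part v i p * part v (b - i) q) u
    = (\<Sum>i\<le>b. \<Sum>s\<in>?K. Poly_Mapping.lookup (part v i p) s * Poly_Mapping.lookup (part v (b - i) q) (u - s))"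
    unfolding lookup_sum by (intro sum.cong refl lookup_mult_sum) (auto simp: keys_part)
  also have "\<dots> = (\<Sum>s\<in>?K. if weight v u = b then Poly_Mapping.lookup p s * Poly_Mapping.lookup q (u - s) else 0)"
    by (subst sum.swap) (intro sum.cong refl t)
  also have "\<dots> = Poly_Mapping.lookup (part v b (p * q)) u"
    by (simp add: lookup_part lookup_mult_sum[of ?K p q])
  finally show "Poly_Mapping.lookup (part v b (p * q)) u = Poly_Mapping.lookup (\<Sum>i\<le>b. part v i p * part v (b - i) q) u" by simp
qed

end

section \<open>Associated graded rings\<close>

locale valued_ring = cring A for A :: "('a, 'm) ring_scheme" (structure) +
  fixes \<nu> :: "'a \<Rightarrow> enat"
  assumes \<nu>: "discrete_valuation A \<nu>"
begin

lemma val_zero_iff: "x \<in> carrier A \<Longrightarrow> \<nu> x = \<infinity> \<longleftrightarrow> x = \<zero>"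
  and val_mult: "x \<in> carrier A \<Longrightarrow> y \<in> carrier A \<Longrightarrow> \<nu> (x \<otimes> y) = \<nu> x + \<nu> y"
  and val_add: "x \<in> carrier A \<Longrightarrow> y \<in> carrier A \<Longrightarrow> min (\<nu> x) (\<nu> y) \<le> \<nu> (x \<oplus> y)"
  using \<nu> by (auto simp: discrete_valuation_def)

lemma val_one: "\<nu> \<one> = 0"
proof -
  obtain x where x: "x \<in> carrier A" "\<nu> x \<noteq> \<infinity>" using \<nu> by (auto simp: discrete_valuation_def)
  have "\<nu> \<one> + \<nu> x = \<nu> x" using val_mult[of \<one> x] x by simp
  thus ?thesis using x(2) by (cases "\<nu> \<one>"; cases "\<nu> x") (auto simp: zero_enat_def)
qed

lemma val_minus: assumes "x \<in> carrier A" shows "\<nu> (\<ominus> x) = \<nu> x"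
proof -
  have "\<nu> (\<ominus> \<one>) + \<nu> (\<ominus> \<one>) = 0"
    using val_mult[of "\<ominus> \<one>" "\<ominus> \<one>"] val_one by (simp add: l_minus r_minus)
  hence "\<nu> (\<ominus> \<one>) = 0" by (cases "\<nu> (\<ominus> \<one>)") (auto simp: zero_enat_def)
  thus ?thesis using val_mult[of "\<ominus> \<one>" x] assms by (simp add: l_minus)
qed

lemma filt_carrier: "x \<in> filt A \<nu> b \<Longrightarrow> x \<in> carrier A"
  by (simp add: filt_def)

lemma filt_zero: "\<zero> \<in> filt A \<nu> b"
  using val_zero_iff[of \<zero>] by (simp add: filt_def)

lemma filt_add: "x \<in> filt A \<nu> b \<Longrightarrow> y \<in> filt A \<nu> b \<Longrightarrow> x \<oplus> y \<in> filt A \<nu> b"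
proof -
  assume "x \<in> filt A \<nu> b" "y \<in> filt A \<nu> b"
  hence xy: "x \<in> carrier A" "y \<in> carrier A" and "enat b \<le> min (\<nu> x) (\<nu> y)" by (simp_all add: filt_def)
  from order_trans[OF this(3) val_add[OF xy]] xy show ?thesis by (simp add: filt_def)
qed

lemma filt_minus: "x \<in> filt A \<nu> b \<Longrightarrow> \<ominus> x \<in> filt A \<nu> b"
  by (simp add: filt_def val_minus)

lemma filt_mult: "x \<in> filt A \<nu> b \<Longrightarrow> y \<in> filt A \<nu> c \<Longrightarrow> x \<otimes> y \<in> filt A \<nu> (b + c)"
  using add_mono[of "enat b" "\<nu> x" "enat c" "\<nu> y"] by (auto simp: filt_def val_mult)

lemma filt_one: "\<one> \<in> filt A \<nu> 0"
  by (simp add: filt_def val_one zero_enat_def)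

lemma filt_Suc: "x \<in> filt A \<nu> (Suc b) \<Longrightarrow> x \<in> filt A \<nu> b"
  by (auto simp: filt_def intro: order_trans[rotated])

lemma additive_subgroup_filt: "additive_subgroup (filt A \<nu> b) A"
  by (rule additive_subgroupI) (use filt_carrier filt_zero filt_add filt_minus in auto)

lemma filt_finsum: "finite I \<Longrightarrow> (\<And>i. i \<in> I \<Longrightarrow> f i \<in> filt A \<nu> b) \<Longrightarrow> finsum A f I \<in> filt A \<nu> b"
proof (induction I rule: finite_induct)
  case (insert i I)
  have "finsum A f (insert i I) = f i \<oplus> finsum A f I"
    using insert filt_carrier by (intro finsum_insert) auto
  thus ?case using insert filt_add by simp
qed (simp add: filt_zero)

end

text \<open>\<open>inn b\<close> is the map taking an element of \<open>I(b)\<close> to its initial form in the semigroup algebra; the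
  grading \<open>us\<close> of \<open>A\<close> is extended by the weight \<open>v\<close>.\<close>

locale initial_forms = weighted_monoid G V for G V :: "(rat ^ 'd::finite) set" +
  fixes A :: "('a, 'm) graded_ring_scheme" (structure) and \<nu> :: "'a \<Rightarrow> enat"
    and us :: "(rat ^ 'd) list" and v :: "rat ^ 'd" and inn :: "nat \<Rightarrow> 'a \<Rightarrow> ((rat ^ 'd) \<Rightarrow>\<^sub>0 complex)"
  assumes us: "set us \<subseteq> V" and v: "v \<in> V" and A: "multi_graded A" and grank: "grank A = length us"
    and val: "discrete_valuation A \<nu>"
    and in_range: "\<And>b x. x \<in> filt A \<nu> b \<Longrightarrow> Poly_Mapping.keys (inn b x) \<subseteq> {u \<in> G. weight v u = b}"
    and in_add: "\<And>b x y. x \<in> filt A \<nu> b \<Longrightarrow> y \<in> filt A \<nu> b \<Longrightarrow> inn b (x \<oplus> y) = inn b x + inn b y"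
    and in_zero_iff: "\<And>b x. x \<in> filt A \<nu> b \<Longrightarrow> inn b x = 0 \<longleftrightarrow> x \<in> filt A \<nu> (Suc b)"
    and in_mult: "\<And>b c x y. x \<in> filt A \<nu> b \<Longrightarrow> y \<in> filt A \<nu> c \<Longrightarrow> inn (b + c) (x \<otimes> y) = inn b x * inn c y"
    and in_one: "inn 0 \<one> = 1"
    and in_component: "\<And>a b. length a = length us \<Longrightarrow>
      inn b ` (filt A \<nu> b \<inter> component A a) = {p. Poly_Mapping.keys p \<subseteq> {u \<in> G. weight v u = b \<and> mdeg us u = a}}"
    and in_surj: "\<And>b p. Poly_Mapping.keys p \<subseteq> {u \<in> G. weight v u = b} \<Longrightarrow> \<exists>x\<in>filt A \<nu> b. inn b x = p"
begin

sublocale valued_ring A \<nu>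
  by (intro valued_ring.intro valued_ring_axioms.intro) (use A val in \<open>simp_all add: multi_graded_def\<close>)

abbreviation "B \<equiv> semigroup_algebra G (us @ [v])"

text \<open>By \<open>coset_eq_fibre\<close> the cosets of I(b+1) in I(b) are the fibres of
  \<open>inn b\<close>. So \<open>\<Phi> p\<close> is the family of cosets whose initial forms are
  the homogeneous parts of \<open>p\<close>: the inverse of taking initial forms.\<close>

definition "fibre b p = {x \<in> filt A \<nu> b. inn b x = p}"
definition "\<Phi> p = (\<lambda>b. fibre b (part v b p))"

lemma in_zero: "inn b \<zero> = 0"
  using in_zero_iff filt_zero by blast

lemma in_minus: "x \<in> filt A \<nu> b \<Longrightarrow> inn b (\<ominus> x) = - inn b x"
proof -
  assume x: "x \<in> filt A \<nu> b"
  have "inn b (\<ominus> x) + inn b x = 0"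
    using in_add[OF filt_minus[OF x] x] filt_carrier[OF x] by (simp add: l_neg in_zero)
  thus ?thesis by (simp add: eq_neg_iff_add_eq_0)
qed

lemma in_finsum:
  "finite I \<Longrightarrow> (\<And>i. i \<in> I \<Longrightarrow> f i \<in> filt A \<nu> b) \<Longrightarrow> inn b (finsum A f I) = (\<Sum>i\<in>I. inn b (f i))"
proof (induction I rule: finite_induct)
  case (insert i I)
  have "finsum A f (insert i I) = f i \<oplus> finsum A f I"
    using insert filt_carrier by (intro finsum_insert) auto
  thus ?case using insert filt_finsum[of I f b] by (simp add: in_add)
qed (simp add: in_zero)

lemma coset_eq_fibre:
  assumes x: "x \<in> filt A \<nu> b" shows "filt A \<nu> (Suc b) +> x = fibre b (inn b x)"
proof (intro equalityI subsetI)
  fix y assume "y \<in> filt A \<nu> (Suc b) +> x"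
  then obtain h where h: "h \<in> filt A \<nu> (Suc b)" "y = h \<oplus> x" by (auto simp: a_r_coset_def')
  have "inn b h = 0" using h(1) filt_Suc in_zero_iff by blast
  thus "y \<in> fibre b (inn b x)"
    using in_add[OF filt_Suc[OF h(1)] x] filt_add[OF filt_Suc[OF h(1)] x] by (simp add: fibre_def h(2))
next
  fix y assume "y \<in> fibre b (inn b x)"
  hence y: "y \<in> filt A \<nu> b" "inn b y = inn b x" by (simp_all add: fibre_def)
  have d: "y \<oplus> \<ominus> x \<in> filt A \<nu> b" by (rule filt_add[OF y(1) filt_minus[OF x]])
  have "inn b (y \<oplus> \<ominus> x) = 0" using in_add[OF y(1) filt_minus[OF x]] in_minus[OF x] y(2) by simp
  hence "y \<oplus> \<ominus> x \<in> filt A \<nu> (Suc b)" using in_zero_iff[OF d] by simp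
  moreover have "y = (y \<oplus> \<ominus> x) \<oplus> x"
    using filt_carrier[OF y(1)] filt_carrier[OF x] by (simp add: a_assoc l_neg)
  ultimately show "y \<in> filt A \<nu> (Suc b) +> x" by (auto simp: a_r_coset_def')
qed

lemma filt_Suc_eq_fibre: "filt A \<nu> (Suc b) = fibre b 0"
  using in_zero_iff filt_Suc by (auto simp: fibre_def)

lemma fibre_nonempty: "Poly_Mapping.keys p \<subseteq> {u \<in> G. weight v u = b} \<Longrightarrow> fibre b p \<noteq> {}"
  using in_surj[of p b] by (auto simp: fibre_def)

lemma fibre_inject:
  "Poly_Mapping.keys p \<subseteq> {u \<in> G. weight v u = b} \<Longrightarrow> fibre b p = fibre b q \<Longrightarrow> p = q"
  using fibre_nonempty[of p b] by (auto simp: fibre_def)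

lemma carrier_B: "carrier B = {p. Poly_Mapping.keys p \<subseteq> G}"
  by (simp add: semigroup_algebra_simps)

lemma part_range: "p \<in> carrier B \<Longrightarrow> Poly_Mapping.keys (part v b p) \<subseteq> {u \<in> G. weight v u = b}"
  by (auto simp: carrier_B keys_part)

lemma part_id: "Poly_Mapping.keys p \<subseteq> {u \<in> G. weight v u = b} \<Longrightarrow> part v c p = (if c = b then p else 0)"
  by (auto simp: part_def intro!: pm_restrict_id pm_restrict_0)

lemma gr_simps:
  "carrier (gr A \<nu>) = {F. (\<forall>b. F b \<in> (\<lambda>x. filt A \<nu> (Suc b) +> x) ` filt A \<nu> b) \<and> finite {b. F b \<noteq> filt A \<nu> (Suc b)}}"
  "mult (gr A \<nu>) = (\<lambda>F H b. \<Union>x\<in>{x. \<forall>i. x i \<in> F i}. \<Union>y\<in>{y. \<forall>i. y i \<in> H i}.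
     filt A \<nu> (Suc b) +> (\<Oplus>i\<in>{..b}. x i \<otimes> y (b - i)))"
  "add (gr A \<nu>) = (\<lambda>F H b. F b <+>\<^bsub>A\<^esub> H b)"
  "one (gr A \<nu>) = (\<lambda>b. if b = 0 then filt A \<nu> 1 +> \<one> else filt A \<nu> (Suc b))"
  "zero (gr A \<nu>) = (\<lambda>b. filt A \<nu> (Suc b))"
  "grank (gr A \<nu>) = Suc (grank A)"
  "component (gr A \<nu>) c = {F. F (last c) \<in>
          (\<lambda>x. filt A \<nu> (Suc (last c)) +> x) ` (filt A \<nu> (last c) \<inter> component A (butlast c)) \<and>
        (\<forall>b. b \<noteq> last c \<longrightarrow> F b = filt A \<nu> (Suc b))}"
  by (simp_all add: gr_def)

lemma bij_\<Phi>: "bij_betw \<Phi> (carrier B) (carrier (gr A \<nu>))"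
  unfolding bij_betw_def
proof (intro conjI equalityI subsetI inj_onI)
  fix p q assume p: "p \<in> carrier B" and pq: "\<Phi> p = \<Phi> q"
  have "part v b p = part v b q" for b
    using fibre_inject[OF part_range[OF p]] fun_cong[OF pq, of b] by (simp add: \<Phi>_def)
  thus "p = q" by (rule part_ext)
next
  fix F assume "F \<in> \<Phi> ` carrier B"
  then obtain p where p: "p \<in> carrier B" "F = \<Phi> p" by blast
  have "F b \<in> (\<lambda>x. filt A \<nu> (Suc b) +> x) ` filt A \<nu> b" for b
  proof -
    obtain x where "x \<in> filt A \<nu> b" "inn b x = part v b p" using in_surj[OF part_range[OF p(1)]] by blast
    thus ?thesis using coset_eq_fibre[of x b] by (auto simp: p(2) \<Phi>_def)
  qed
  moreover have "{b. F b \<noteq> filt A \<nu> (Suc b)} \<subseteq> weight v ` Poly_Mapping.keys p"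
  proof
    fix b assume "b \<in> {b. F b \<noteq> filt A \<nu> (Suc b)}"
    hence "part v b p \<noteq> 0" by (auto simp: p(2) \<Phi>_def filt_Suc_eq_fibre)
    hence "Poly_Mapping.keys (part v b p) \<noteq> {}" by simp
    thus "b \<in> weight v ` Poly_Mapping.keys p" unfolding keys_part by blast
  qed
  hence "finite {b. F b \<noteq> filt A \<nu> (Suc b)}" by (rule finite_subset) simp
  ultimately show "F \<in> carrier (gr A \<nu>)" by (simp add: gr_simps)
next
  fix F assume F: "F \<in> carrier (gr A \<nu>)"
  have "\<exists>q. Poly_Mapping.keys q \<subseteq> {u \<in> G. weight v u = b} \<and> F b = fibre b q" for b
  proof -
    obtain x where "x \<in> filt A \<nu> b" "F b = filt A \<nu> (Suc b) +> x" using F by (auto simp: gr_simps)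
    thus ?thesis using coset_eq_fibre in_range by metis
  qed
  then obtain q where q: "\<And>b. Poly_Mapping.keys (q b) \<subseteq> {u \<in> G. weight v u = b}" "\<And>b. F b = fibre b (q b)"
    by metis
  have "{b. q b \<noteq> 0} \<subseteq> {b. F b \<noteq> filt A \<nu> (Suc b)}"
    using fibre_inject[OF q(1)] by (auto simp: q(2) filt_Suc_eq_fibre)
  hence fin: "finite {b. q b \<noteq> 0}" using F finite_subset by (auto simp: gr_simps)
  define p where "p = (\<Sum>b | q b \<noteq> 0. q b)"
  have pq: "part v b p = q b" for b
  proof -
    have "part v b p = (\<Sum>c | q c \<noteq> 0. part v b (q c))" by (simp add: p_def part_def pm_restrict_sum)
    also have "\<dots> = (\<Sum>c | q c \<noteq> 0. if c = b then q b else 0)"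
      by (intro sum.cong refl) (auto simp: part_id[OF q(1)])
    also have "\<dots> = q b" using fin by simp
    finally show ?thesis .
  qed
  have "Poly_Mapping.keys p \<subseteq> G"
  proof
    fix u assume "u \<in> Poly_Mapping.keys p"
    hence "u \<in> Poly_Mapping.keys (part v (weight v u) p)" by (simp add: keys_part)
    thus "u \<in> G" using pq q(1) by auto
  qed
  moreover have "F = \<Phi> p" by (simp add: \<Phi>_def pq q(2) fun_eq_iff)
  ultimately show "F \<in> \<Phi> ` carrier B" by (simp add: carrier_B)
qed

text \<open>Multiplication in \<open>gr\<close> is a union over all choices of representatives. Each
  choice yields the same coset, since initial forms multiply, and the union of equal sets collapses
  because at least one choice exists.\<close>

lemma \<Phi>_mult:
  assumes p: "p \<in> carrier B" and q: "q \<in> carrier B"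
  shows "\<Phi> (p * q) = \<Phi> p \<otimes>\<^bsub>gr A \<nu>\<^esub> \<Phi> q"
proof
  fix b
  let ?X = "\<lambda>p. {x. \<forall>i. x i \<in> \<Phi> p i}"
  have ne: "?X p \<noteq> {}" if "p \<in> carrier B" for p
  proof -
    have "\<forall>i. \<exists>x. x \<in> \<Phi> p i" using fibre_nonempty[OF part_range[OF that]] by (auto simp: \<Phi>_def)
    thus ?thesis by (auto dest: choice)
  qed
  have "filt A \<nu> (Suc b) +> (\<Oplus>i\<in>{..b}. x i \<otimes> y (b - i)) = \<Phi> (p * q) b" if xy: "x \<in> ?X p" "y \<in> ?X q" for x y
  proof -
    have x: "x i \<in> filt A \<nu> i" "inn i (x i) = part v i p" for i using xy(1) by (auto simp: \<Phi>_def fibre_def)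
    have y: "y i \<in> filt A \<nu> i" "inn i (y i) = part v i q" for i using xy(2) by (auto simp: \<Phi>_def fibre_def)
    have xy': "x i \<otimes> y (b - i) \<in> filt A \<nu> b" "inn b (x i \<otimes> y (b - i)) = part v i p * part v (b - i) q"
      if "i \<in> {..b}" for i
      using filt_mult[OF x(1)[of i] y(1)[of "b - i"]] in_mult[OF x(1)[of i] y(1)[of "b - i"]] that x(2) y(2) by auto
    have "inn b (\<Oplus>i\<in>{..b}. x i \<otimes> y (b - i)) = (\<Sum>i\<in>{..b}. part v i p * part v (b - i) q)"
      by (subst in_finsum) (auto intro!: xy' sum.cong)
    also have "\<dots> = part v b (p * q)" using p q by (subst part_mult[OF v]) (auto simp: carrier_B)
    finally have s: "inn b (\<Oplus>i\<in>{..b}. x i \<otimes> y (b - i)) = part v b (p * q)" .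
    have "(\<Oplus>i\<in>{..b}. x i \<otimes> y (b - i)) \<in> filt A \<nu> b" by (rule filt_finsum) (simp_all add: xy'(1))
    from coset_eq_fibre[OF this] show ?thesis by (simp add: \<Phi>_def s)
  qed
  hence "(\<Phi> p \<otimes>\<^bsub>gr A \<nu>\<^esub> \<Phi> q) b = (\<Union>x\<in>?X p. \<Union>y\<in>?X q. \<Phi> (p * q) b)"
    unfolding gr_simps by (intro SUP_cong refl)
  thus "\<Phi> (p * q) b = (\<Phi> p \<otimes>\<^bsub>gr A \<nu>\<^esub> \<Phi> q) b"
    using ne[OF p] ne[OF q] by (simp only: UN_constant if_False)
qed

lemma \<Phi>_add:
  assumes p: "p \<in> carrier B" and q: "q \<in> carrier B"
  shows "\<Phi> (p + q) = \<Phi> p \<oplus>\<^bsub>gr A \<nu>\<^esub> \<Phi> q"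
proof
  fix b
  interpret sub: abelian_subgroup "filt A \<nu> (Suc b)" A
    by (rule abelian_subgroupI3[OF additive_subgroup_filt]) (rule abelian_group_axioms)
  obtain x where x: "x \<in> filt A \<nu> b" "inn b x = part v b p" using in_surj[OF part_range[OF p]] by blast
  obtain y where y: "y \<in> filt A \<nu> b" "inn b y = part v b q" using in_surj[OF part_range[OF q]] by blast
  have "\<Phi> p b <+>\<^bsub>A\<^esub> \<Phi> q b = (filt A \<nu> (Suc b) +> x) <+>\<^bsub>A\<^esub> (filt A \<nu> (Suc b) +> y)"
    using x y by (simp add: \<Phi>_def coset_eq_fibre)
  also have "\<dots> = filt A \<nu> (Suc b) +> (x \<oplus> y)" using x y filt_carrier by (intro sub.a_rcos_sum) auto
  also have "\<dots> = fibre b (inn b x + inn b y)" using x y by (simp add: coset_eq_fibre filt_add in_add)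
  also have "\<dots> = \<Phi> (p + q) b" using x y by (simp add: \<Phi>_def part_def pm_restrict_add)
  finally show "\<Phi> (p + q) b = (\<Phi> p \<oplus>\<^bsub>gr A \<nu>\<^esub> \<Phi> q) b" by (simp add: gr_simps)
qed

lemma \<Phi>_zero: "\<Phi> 0 = \<zero>\<^bsub>gr A \<nu>\<^esub>"
  by (simp add: \<Phi>_def gr_simps filt_Suc_eq_fibre part_def pm_restrict_0)

lemma \<Phi>_one: "\<Phi> 1 = \<one>\<^bsub>gr A \<nu>\<^esub>"
proof
  fix b
  have k: "Poly_Mapping.keys (1 :: (rat ^ 'd) \<Rightarrow>\<^sub>0 complex) \<subseteq> {u \<in> G. weight v u = 0}"
    using G by (simp add: keys_1 additive_monoid_def weight_def)
  have "filt A \<nu> 1 +> \<one> = fibre 0 1" using coset_eq_fibre[OF filt_one] in_one by simp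
  thus "\<Phi> 1 b = \<one>\<^bsub>gr A \<nu>\<^esub> b" by (simp add: \<Phi>_def gr_simps part_id[OF k] filt_Suc_eq_fibre)
qed

lemma mdeg_snoc: "mdeg (us @ [v]) u = c \<longleftrightarrow> length c = Suc (length us) \<and> mdeg us u = butlast c \<and> weight v u = last c"
proof -
  have "mdeg (us @ [v]) u = mdeg us u @ [weight v u]" by (simp add: mdeg_def)
  thus ?thesis by (cases c rule: rev_cases) auto
qed

lemma us_v: "set (us @ [v]) \<subseteq> V"
  using us v by simp

lemma component_B:
  assumes "length c = Suc (length us)"
  shows "component B c = {p. Poly_Mapping.keys p \<subseteq> {u \<in> G. weight v u = last c \<and> mdeg us u = butlast c}}"
  using component_eq[OF us_v, of c] assms by (simp add: mdeg_snoc conj_commute)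

lemma \<Phi>_component:
  assumes c: "length c = Suc (length us)"
  shows "component (gr A \<nu>) c = \<Phi> ` component B c"
proof (intro equalityI subsetI)
  fix F assume "F \<in> component (gr A \<nu>) c"
  then obtain x where x: "x \<in> filt A \<nu> (last c) \<inter> component A (butlast c)" "F (last c) = filt A \<nu> (Suc (last c)) +> x"
    and F: "\<And>b. b \<noteq> last c \<Longrightarrow> F b = filt A \<nu> (Suc b)" by (auto simp: gr_simps)
  define p where "p = inn (last c) x"
  have "p \<in> inn (last c) ` (filt A \<nu> (last c) \<inter> component A (butlast c))" unfolding p_def using x(1) by blast
  hence p: "Poly_Mapping.keys p \<subseteq> {u \<in> G. weight v u = last c \<and> mdeg us u = butlast c}"
    using in_component[of "butlast c" "last c"] c by simp
  hence p': "Poly_Mapping.keys p \<subseteq> {u \<in> G. weight v u = last c}" by blast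
  have xp: "F (last c) = fibre (last c) p" using x coset_eq_fibre[of x "last c"] by (simp add: p_def)
  have "F = \<Phi> p"
  proof
    fix b show "F b = \<Phi> p b"
      using xp F[of b] by (cases "b = last c") (simp_all add: \<Phi>_def part_id[OF p'] filt_Suc_eq_fibre)
  qed
  thus "F \<in> \<Phi> ` component B c" using p component_B[OF c] by blast
next
  fix F assume "F \<in> \<Phi> ` component B c"
  then obtain p where p: "Poly_Mapping.keys p \<subseteq> {u \<in> G. weight v u = last c \<and> mdeg us u = butlast c}" "F = \<Phi> p"
    using component_B[OF c] by blast
  hence p': "Poly_Mapping.keys p \<subseteq> {u \<in> G. weight v u = last c}" by blast
  have "p \<in> inn (last c) ` (filt A \<nu> (last c) \<inter> component A (butlast c))"
    using in_component[of "butlast c" "last c"] c p(1) by simp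
  then obtain x where x: "x \<in> filt A \<nu> (last c) \<inter> component A (butlast c)" "inn (last c) x = p" by blast
  have "F (last c) = filt A \<nu> (Suc (last c)) +> x" using x by (simp add: p(2) \<Phi>_def part_id[OF p'] coset_eq_fibre)
  moreover have "F b = filt A \<nu> (Suc b)" if "b \<noteq> last c" for b
    using that by (simp add: p(2) \<Phi>_def part_id[OF p'] filt_Suc_eq_fibre)
  ultimately show "F \<in> component (gr A \<nu>) c" using x(1) by (auto simp: gr_simps)
qed

lemma transport_gr: "graded_transport B (gr A \<nu>) \<Phi>"
  unfolding graded_transport_def
proof (intro conjI ballI allI impI)
  fix a :: "nat list" assume "length a = grank B"
  thus "component (gr A \<nu>) a = \<Phi> ` component B a" by (intro \<Phi>_component) (simp add: semigroup_algebra_simps)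
qed (use bij_\<Phi> \<Phi>_mult \<Phi>_add \<Phi>_one \<Phi>_zero grank in \<open>simp_all add: semigroup_algebra_simps(2-6) gr_simps(6)\<close>)

sublocale gr: graded_transport_loc B "gr A \<nu>" \<Phi>
  by unfold_locales (rule multi_graded_algebra[OF us_v], rule transport_gr)

text \<open>\<open>upper\<close> bounds the value of every representative of a coset by that of the
  common initial form, and \<open>lower\<close> supplies one that reaches it. As the multidegrees
  partition the exponents of \<open>p\<close>, the minimum over components is the minimum over all
  exponents.\<close>

lemma induced_val_eq:
  fixes \<omega> :: "'a \<Rightarrow> enat" and w :: "rat ^ 'd"
  assumes upper: "\<And>b x. x \<in> filt A \<nu> b \<Longrightarrow> \<omega> x \<le> algebra_val w (inn b x)"
    and lower: "\<And>b p. Poly_Mapping.keys p \<subseteq> {u \<in> G. weight v u = b} \<Longrightarrow>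
      \<exists>x\<in>filt A \<nu> b. inn b x = p \<and> algebra_val w p \<le> \<omega> x"
    and p: "p \<in> carrier B"
  shows "induced_val A \<nu> \<omega> (\<Phi> p) = algebra_val w p"
proof -
  let ?q = "\<lambda>c. pm_restrict {u. mdeg (us @ [v]) u = c} p"
  have pG: "Poly_Mapping.keys p \<subseteq> G" using p by (simp add: carrier_B)
  have h: "hcomp (gr A \<nu>) (\<Phi> p) c = \<Phi> (?q c)" for c
    using gr.hcomp_transport[OF p] hcomp_algebra[OF us_v pG] by simp
  have qc: "?q c \<in> carrier B" for c using pG by (auto simp: carrier_B keys_pm_restrict)
  have nz: "hcomp (gr A \<nu>) (\<Phi> p) c \<noteq> \<zero>\<^bsub>gr A \<nu>\<^esub> \<longleftrightarrow> ?q c \<noteq> 0" for c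
    unfolding h using gr.eq_zero_iff[OF qc] by (simp add: semigroup_algebra_simps)
  have sup: "(SUP x\<in>hcomp (gr A \<nu>) (\<Phi> p) c (last c). \<omega> x) = algebra_val w (?q c)" for c
  proof -
    have r: "Poly_Mapping.keys (?q c) \<subseteq> {u \<in> G. weight v u = last c}"
      using pG by (auto simp: keys_pm_restrict mdeg_snoc)
    have e: "hcomp (gr A \<nu>) (\<Phi> p) c (last c) = fibre (last c) (?q c)"
      unfolding h by (simp add: \<Phi>_def part_id[OF r])
    obtain x where x: "x \<in> fibre (last c) (?q c)" "algebra_val w (?q c) \<le> \<omega> x"
      using lower[OF r] by (auto simp: fibre_def)
    have "\<omega> y \<le> algebra_val w (?q c)" if "y \<in> fibre (last c) (?q c)" for y
      using upper[of y "last c"] that by (simp add: fibre_def)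
    thus ?thesis unfolding e by (intro order_antisym SUP_least SUP_upper2[where f = \<omega>, OF x])
  qed
  have "induced_val A \<nu> \<omega> (\<Phi> p) = (INF c\<in>{c. ?q c \<noteq> 0}. algebra_val w (?q c))"
    unfolding induced_val_def sup nz ..
  also have "\<dots> = algebra_val w p"
  proof (rule order_antisym)
    have "(INF c\<in>{c. ?q c \<noteq> 0}. algebra_val w (?q c)) \<le> enat (nat \<lfloor>pairing w u\<rfloor>)" if u: "u \<in> Poly_Mapping.keys p" for u
    proof (rule INF_lower2)
      have k: "u \<in> Poly_Mapping.keys (?q (mdeg (us @ [v]) u))" using u by (simp add: keys_pm_restrict)
      thus "mdeg (us @ [v]) u \<in> {c. ?q c \<noteq> 0}" by auto
      show "algebra_val w (?q (mdeg (us @ [v]) u)) \<le> enat (nat \<lfloor>pairing w u\<rfloor>)"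
        unfolding algebra_val_def min_pairing_def using k by (rule INF_lower)
    qed
    thus "(INF c\<in>{c. ?q c \<noteq> 0}. algebra_val w (?q c)) \<le> algebra_val w p"
      unfolding algebra_val_def[of w p] min_pairing_def by (intro INF_greatest)
    show "algebra_val w p \<le> (INF c\<in>{c. ?q c \<noteq> 0}. algebra_val w (?q c))"
      unfolding algebra_val_def by (intro INF_greatest min_pairing_antimono) (auto simp: keys_pm_restrict)
  qed
  finally show ?thesis .
qed

end

text \<open>The representative chosen in a coset still determines its initial form, so
  \<open>encode_family\<close> loses nothing.\<close>

lemma (in initial_forms) inj_on_some:
  assumes "\<And>b. (SOME h. h \<in> \<Phi> p b) = (SOME h. h \<in> \<Phi> q b)" "p \<in> carrier B" "q \<in> carrier B"
  shows "p = q"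
proof (rule part_ext)
  fix b
  have "inn b (SOME h. h \<in> \<Phi> r b) = part v b r" if "r \<in> carrier B" for r
  proof -
    have "\<exists>h. h \<in> \<Phi> r b" using fibre_nonempty[OF part_range[OF that]] by (auto simp: \<Phi>_def)
    from someI_ex[OF this] show ?thesis by (simp add: \<Phi>_def fibre_def)
  qed
  thus "part v b p = part v b q" using assms by metis
qed

text \<open>On C[Gamma] the homogeneous part of weight \<open>b\<close> serves as initial form of an
  element of I(b). Passing to the graded ring then reproduces the same algebra with one more
  degree.\<close>

lemma (in weighted_monoid) initial_forms_algebra:
  assumes us: "set us \<subseteq> V" and v: "v \<in> V"
  shows "initial_forms G V (semigroup_algebra G us) (algebra_val v) us v (part v)"
proof -
  let ?A = "semigroup_algebra G us"
  have filt: "x \<in> filt ?A (algebra_val v) b \<longleftrightarrow> Poly_Mapping.keys x \<subseteq> {u \<in> G. b \<le> weight v u}" for x b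
    using algebra_val_ge_iff[OF v, of x b] by (auto simp: filt_def semigroup_algebra_simps(1))
  have pid: "part v b p = p" if "Poly_Mapping.keys p \<subseteq> {u \<in> G. weight v u = b}" for b and p
    unfolding part_def using that by (intro pm_restrict_id) auto
  show ?thesis
  proof (intro initial_forms.intro weighted_monoid_axioms initial_forms_axioms.intro us v)
    show "multi_graded ?A" by (rule multi_graded_algebra[OF us])
    show "discrete_valuation ?A (algebra_val v)" by (rule discrete_valuation_algebra[OF v])
    show "grank ?A = length us" by (simp add: semigroup_algebra_simps)
    show "part v 0 \<one>\<^bsub>?A\<^esub> = 1"
      unfolding semigroup_algebra_simps using G
      by (intro pid) (simp add: keys_1 additive_monoid_def weight_def)
  next
    fix b x assume "x \<in> filt ?A (algebra_val v) b"
    hence x: "Poly_Mapping.keys x \<subseteq> {u \<in> G. b \<le> weight v u}" by (simp add: filt)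
    show "Poly_Mapping.keys (part v b x) \<subseteq> {u \<in> G. weight v u = b}" using x by (auto simp: keys_part)
    show "part v b x = 0 \<longleftrightarrow> x \<in> filt ?A (algebra_val v) (Suc b)"
    proof -
      have "part v b x = 0 \<longleftrightarrow> Poly_Mapping.keys (part v b x) = {}" by simp
      also have "\<dots> \<longleftrightarrow> Poly_Mapping.keys x \<subseteq> {u \<in> G. Suc b \<le> weight v u}"
        using x unfolding keys_part by (fastforce simp: Suc_le_eq order_less_le)
      finally show ?thesis by (simp only: filt)
    qed
    fix y
    show "part v b (x \<oplus>\<^bsub>?A\<^esub> y) = part v b x + part v b y"
      by (simp add: semigroup_algebra_simps part_def pm_restrict_add)
  next
    fix b c x y assume "x \<in> filt ?A (algebra_val v) b" "y \<in> filt ?A (algebra_val v) c"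
    hence xy: "Poly_Mapping.keys x \<subseteq> {u \<in> G. b \<le> weight v u}" "Poly_Mapping.keys y \<subseteq> {u \<in> G. c \<le> weight v u}"
      by (simp_all add: filt)
    \<comment> \<open>\<open>x\<close> has no terms of weight below \<open>b\<close> and
      \<open>y\<close> none below \<open>c\<close>, so only the summand with \<open>i = b\<close>
      survives.\<close>
    have z: "part v i x * part v (b + c - i) y = (if i = b then part v b x * part v c y else 0)" if "i \<le> b + c" for i
    proof -
      have "part v i x = 0" if "i < b" using xy(1) that by (auto simp: part_def intro!: pm_restrict_0)
      moreover have "part v (b + c - i) y = 0" if "b < i"
        using xy(2) that \<open>i \<le> b + c\<close> by (auto simp: part_def intro!: pm_restrict_0)
      ultimately show ?thesis by (cases i b rule: linorder_cases) auto
    qed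
    have "part v (b + c) (x * y) = (\<Sum>i\<le>b + c. part v i x * part v (b + c - i) y)"
      using xy by (intro part_mult[OF v]) auto
    also have "\<dots> = (\<Sum>i\<le>b + c. if i = b then part v b x * part v c y else 0)"
      by (intro sum.cong refl z) simp
    finally show "part v (b + c) (x \<otimes>\<^bsub>?A\<^esub> y) = part v b x * part v c y"
      by (simp add: semigroup_algebra_simps)
  next
    fix a :: "nat list" and b assume a: "length a = length us"
    show "part v b ` (filt ?A (algebra_val v) b \<inter> component ?A a) = {p. Poly_Mapping.keys p \<subseteq> {u \<in> G. weight v u = b \<and> mdeg us u = a}}"
    proof (intro equalityI subsetI)
      fix p :: "(rat ^ 'd) \<Rightarrow>\<^sub>0 complex" assume "p \<in> {p. Poly_Mapping.keys p \<subseteq> {u \<in> G. weight v u = b \<and> mdeg us u = a}}"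
      hence p: "Poly_Mapping.keys p \<subseteq> {u \<in> G. weight v u = b \<and> mdeg us u = a}" by simp
      have "p \<in> filt ?A (algebra_val v) b" "p \<in> component ?A a"
        unfolding filt component_eq[OF us a] using p by auto
      moreover have "part v b p = p" by (rule pid) (use p in blast)
      ultimately show "p \<in> part v b ` (filt ?A (algebra_val v) b \<inter> component ?A a)"
        by (intro image_eqI[of _ _ p]) simp_all
    qed (auto simp: component_eq[OF us a] keys_part)
  next
    fix b and p :: "(rat ^ 'd) \<Rightarrow>\<^sub>0 complex" assume p: "Poly_Mapping.keys p \<subseteq> {u \<in> G. weight v u = b}"
    have "p \<in> filt ?A (algebra_val v) b" unfolding filt using p by auto
    thus "\<exists>x\<in>filt ?A (algebra_val v) b. part v b x = p" using pid[OF p] by blast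
  qed
qed

section \<open>Transfer to the stages of the iteration\<close>

lemma inj_on_Base: "inj_on Base X"
  by (simp add: inj_on_def)

text \<open>A stage of the iteration is only isomorphic to a ring whose initial forms are
  understood, so the whole structure is moved along the isomorphism.\<close>

lemma (in initial_forms) transfer:
  fixes A' :: "('b, 'n) graded_ring_scheme"
  assumes T: "graded_transport A A' \<Psi>" and \<omega>: "\<And>x. x \<in> carrier A \<Longrightarrow> \<omega> (\<Psi> x) = \<nu> x"
  shows "initial_forms G V A' \<omega> us v (\<lambda>b x. inn b (inv_into (carrier A) \<Psi> x))"
proof -
  interpret T: graded_transport_loc A A' \<Psi> by unfold_locales (rule A, rule T)
  have inv: "inv_into (carrier A) \<Psi> (\<Psi> x) = x" if "x \<in> carrier A" for x
    using that T.bij by (simp add: bij_betw_def)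
  have filt: "filt A' \<omega> b = \<Psi> ` filt A \<nu> b" for b by (rule T.filt_transport) (rule \<omega>)
  have inv': "inv_into (carrier A) \<Psi> (\<Psi> x) = x" if "x \<in> filt A \<nu> b" for x b
    using inv filt_carrier[OF that] .
  have memb: "\<Psi> x \<in> filt A' \<omega> b \<longleftrightarrow> x \<in> filt A \<nu> b" if "x \<in> carrier A" for x b
    unfolding filt_def using that \<omega>[OF that] T.in_carrier[OF that] by simp
  show ?thesis
  proof (intro initial_forms.intro weighted_monoid_axioms initial_forms_axioms.intro us v)
    show "multi_graded A'" by (rule T.multi_graded_A)
    show "grank A' = length us" by (simp add: T.grank grank)
    show "discrete_valuation A' \<omega>" by (rule T.discrete_valuation_transport[OF _ val]) (rule \<omega>)
    show "inn 0 (inv_into (carrier A) \<Psi> \<one>\<^bsub>A'\<^esub>) = 1" using inv[of \<one>] in_one T.one by simp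
  next
    fix b x assume "x \<in> filt A' \<omega> b"
    then obtain x' where x': "x' \<in> filt A \<nu> b" "x = \<Psi> x'" unfolding filt by blast
    show "Poly_Mapping.keys (inn b (inv_into (carrier A) \<Psi> x)) \<subseteq> {u \<in> G. weight v u = b}"
      unfolding x'(2) inv'[OF x'(1)] by (rule in_range[OF x'(1)])
    show "inn b (inv_into (carrier A) \<Psi> x) = 0 \<longleftrightarrow> x \<in> filt A' \<omega> (Suc b)"
      unfolding x'(2) inv'[OF x'(1)] memb[OF filt_carrier[OF x'(1)]] by (rule in_zero_iff[OF x'(1)])
    fix y assume "y \<in> filt A' \<omega> b"
    then obtain y' where y': "y' \<in> filt A \<nu> b" "y = \<Psi> y'" unfolding filt by blast
    show "inn b (inv_into (carrier A) \<Psi> (x \<oplus>\<^bsub>A'\<^esub> y)) = inn b (inv_into (carrier A) \<Psi> x) + inn b (inv_into (carrier A) \<Psi> y)"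
      unfolding x'(2) y'(2) T.add[OF filt_carrier[OF x'(1)] filt_carrier[OF y'(1)], symmetric]
        inv'[OF x'(1)] inv'[OF y'(1)] inv'[OF filt_add[OF x'(1) y'(1)]]
      by (rule in_add[OF x'(1) y'(1)])
  next
    fix b c x y assume "x \<in> filt A' \<omega> b" "y \<in> filt A' \<omega> c"
    then obtain x' y' where x': "x' \<in> filt A \<nu> b" "x = \<Psi> x'" and y': "y' \<in> filt A \<nu> c" "y = \<Psi> y'"
      unfolding filt by blast
    show "inn (b + c) (inv_into (carrier A) \<Psi> (x \<otimes>\<^bsub>A'\<^esub> y)) = inn b (inv_into (carrier A) \<Psi> x) * inn c (inv_into (carrier A) \<Psi> y)"
      unfolding x'(2) y'(2) T.mult[OF filt_carrier[OF x'(1)] filt_carrier[OF y'(1)], symmetric]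
        inv'[OF x'(1)] inv'[OF y'(1)] inv'[OF filt_mult[OF x'(1) y'(1)]]
      by (rule in_mult[OF x'(1) y'(1)])
  next
    fix a :: "nat list" and b assume a: "length a = length us"
    hence aA: "length a = grank A" by (simp add: grank)
    have "filt A' \<omega> b \<inter> component A' a = \<Psi> ` (filt A \<nu> b \<inter> component A a)"
      unfolding T.comp[OF aA] using T.component_subset[OF aA] memb filt by blast
    moreover have "(\<lambda>x. inn b (inv_into (carrier A) \<Psi> x)) ` \<Psi> ` (filt A \<nu> b \<inter> component A a) = inn b ` (filt A \<nu> b \<inter> component A a)"
      unfolding image_image by (intro image_cong refl) (use inv' in auto)
    ultimately show "(\<lambda>x. inn b (inv_into (carrier A) \<Psi> x)) ` (filt A' \<omega> b \<inter> component A' a) =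
        {p. Poly_Mapping.keys p \<subseteq> {u \<in> G. weight v u = b \<and> mdeg us u = a}}"
      using in_component[OF a] by simp
  next
    fix b and p :: "(rat ^ 'd) \<Rightarrow>\<^sub>0 complex" assume "Poly_Mapping.keys p \<subseteq> {u \<in> G. weight v u = b}"
    then obtain x where x: "x \<in> filt A \<nu> b" "inn b x = p" using in_surj by blast
    thus "\<exists>x\<in>filt A' \<omega> b. inn b (inv_into (carrier A) \<Psi> x) = p" unfolding filt using inv' by force
  qed
qed

context initial_forms
begin

text \<open>The largest value of \<open>\<rho>\<close> on the elements with a given initial form is the \<open>w\<close>-value of that form.\<close>

definition "value_of_initial_form \<rho> w \<longleftrightarrow>
  (\<forall>b. \<forall>x\<in>filt A \<nu> b. \<rho> x \<le> algebra_val w (inn b x)) \<and>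
  (\<forall>b p. Poly_Mapping.keys p \<subseteq> {u \<in> G. weight v u = b} \<longrightarrow>
    (\<exists>x\<in>filt A \<nu> b. inn b x = p \<and> algebra_val w p \<le> \<rho> x))"

text \<open>\<open>A\<close> is the model in which initial forms are computed and \<open>A'\<close>
  its copy in the tower, whose graded ring is taken. The map \<open>\<Theta>\<close> precedes the
  quantifiers over the valuations, so that one isomorphism serves all of them.\<close>

lemma iteration_step:
  fixes A' :: "'b tower graded_ring"
  assumes T: "graded_transport A A' \<Psi>" and \<omega>: "\<And>x. x \<in> carrier A \<Longrightarrow> \<omega> (\<Psi> x) = \<nu> x"
  shows "\<exists>\<Theta>. graded_transport B (carry_ring encode_family (gr A' \<omega>)) \<Theta> \<and>
    (\<forall>\<rho> \<rho>' w. (\<forall>x\<in>carrier A. \<rho>' (\<Psi> x) = \<rho> x) \<longrightarrow> value_of_initial_form \<rho> w \<longrightarrow>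
      (\<forall>p\<in>carrier B. carry_val encode_family (gr A' \<omega>) (induced_val A' \<omega> \<rho>') (\<Theta> p) = algebra_val w p))"
proof -
  interpret A': initial_forms G V A' \<omega> us v "\<lambda>b x. inn b (inv_into (carrier A) \<Psi> x)"
    using T \<omega> by (rule transfer)
  have bij: "bij_betw \<Psi> (carrier A) (carrier A')" using T by (simp add: graded_transport_def)
  hence inv: "inv_into (carrier A) \<Psi> (\<Psi> x) = x" if "x \<in> carrier A" for x
    using that by (simp add: bij_betw_def)
  have filt: "filt A' \<omega> b = \<Psi> ` filt A \<nu> b" for b
  proof -
    have c: "carrier A' = \<Psi> ` carrier A" using bij by (simp add: bij_betw_def)
    show ?thesis unfolding filt_def c using \<omega> by auto
  qed
  have inj: "inj_on encode_family (carrier (gr A' \<omega>))"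
  proof (rule inj_onI)
    fix F H assume F: "F \<in> carrier (gr A' \<omega>)" and H: "H \<in> carrier (gr A' \<omega>)" and FH: "encode_family F = encode_family H"
    obtain p q where pq: "p \<in> carrier A'.B" "F = A'.\<Phi> p" "q \<in> carrier A'.B" "H = A'.\<Phi> q"
      using F H unfolding A'.gr.carrier_A by blast
    have "(SOME h. h \<in> F b) = (SOME h. h \<in> H b)" for b
      using FH by (simp add: encode_family_def fun_eq_iff)
    hence "p = q" unfolding pq(2,4) by (rule A'.inj_on_some) (rule pq)+
    thus "F = H" using pq by simp
  qed
  show ?thesis
  proof (intro exI[of _ "encode_family \<circ> A'.\<Phi>"] conjI allI impI ballI)
    show "graded_transport B (carry_ring encode_family (gr A' \<omega>)) (encode_family \<circ> A'.\<Phi>)"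
      by (rule graded_transport_comp[OF A'.transport_gr graded_transport_carry[OF inj]])
        (use cring.cring_simprules(2,6)[OF cring_algebra[of "us @ [v]"]] in simp_all)
    fix \<rho> \<rho>' w p
    assume \<rho>: "\<forall>x\<in>carrier A. \<rho>' (\<Psi> x) = \<rho> x" and w: "value_of_initial_form \<rho> w" and p: "p \<in> carrier B"
    have upper: "\<And>b x. x \<in> filt A \<nu> b \<Longrightarrow> \<rho> x \<le> algebra_val w (inn b x)"
      and lower: "\<And>b p. Poly_Mapping.keys p \<subseteq> {u \<in> G. weight v u = b} \<Longrightarrow> \<exists>x\<in>filt A \<nu> b. inn b x = p \<and> algebra_val w p \<le> \<rho> x"
      using w unfolding value_of_initial_form_def by blast+
    have "induced_val A' \<omega> \<rho>' (A'.\<Phi> p) = algebra_val w p"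
    proof (rule A'.induced_val_eq[OF _ _ p])
      fix b x assume "x \<in> filt A' \<omega> b"
      then obtain x' where x': "x' \<in> filt A \<nu> b" "x = \<Psi> x'" unfolding filt by blast
      thus "\<rho>' x \<le> algebra_val w (inn b (inv_into (carrier A) \<Psi> x))"
        using upper[OF x'(1)] \<rho> inv filt_carrier[OF x'(1)] by simp
    next
      fix b and p :: "(rat ^ 'd) \<Rightarrow>\<^sub>0 complex" assume "Poly_Mapping.keys p \<subseteq> {u \<in> G. weight v u = b}"
      then obtain x where x: "x \<in> filt A \<nu> b" "inn b x = p" "algebra_val w p \<le> \<rho> x" using lower by blast
      have "inn b (inv_into (carrier A) \<Psi> (\<Psi> x)) = p \<and> algebra_val w p \<le> \<rho>' (\<Psi> x)"
        using x inv \<rho> filt_carrier[OF x(1)] by simp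
      thus "\<exists>x\<in>filt A' \<omega> b. inn b (inv_into (carrier A) \<Psi> x) = p \<and> algebra_val w p \<le> \<rho>' x"
        unfolding filt using x(1) by blast
    qed
    moreover have "A'.\<Phi> p \<in> carrier (gr A' \<omega>)" using p by (rule A'.gr.in_carrier)
    ultimately show "carry_val encode_family (gr A' \<omega>) (induced_val A' \<omega> \<rho>') ((encode_family \<circ> A'.\<Phi>) p) = algebra_val w p"
      using carry_val_apply[OF inj] by simp
  qed
qed

end

section \<open>The ring of a quasi-ordinary branch\<close>

lemma ungraded_simps:
  "carrier (ungraded R) = carrier R" "mult (ungraded R) = mult R" "add (ungraded R) = add R"
  "one (ungraded R) = one R" "zero (ungraded R) = zero R" "grank (ungraded R) = 0"
  "component (ungraded R) a = carrier R"
  by (simp_all add: ungraded_def ring.extend_def graded_ring.fields_def)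

lemma cring_ungraded:
  assumes "cring R" shows "cring (ungraded R)"
proof -
  interpret R: cring R by (rule assms)
  show ?thesis
  proof (rule cringI)
    show "abelian_group (ungraded R)"
      by (rule abelian_groupI)
        (auto intro!: bexI[of _ "\<ominus>\<^bsub>R\<^esub> x" for x] simp: ungraded_simps R.a_ac R.r_neg)
    show "comm_monoid (ungraded R)" by (rule comm_monoidI) (auto simp: ungraded_simps R.m_ac)
  qed (simp add: ungraded_simps R.l_distr)
qed

lemma decomposition_ungraded:
  assumes R: "cring R" and x: "x \<in> carrier R"
  shows "decomposition (ungraded R) y x \<longleftrightarrow> y = (\<lambda>a. if a = [] then x else \<zero>\<^bsub>R\<^esub>)"
proof -
  interpret U: cring "ungraded R" by (rule cring_ungraded[OF R])
  have 0: "\<zero>\<^bsub>ungraded R\<^esub> = \<zero>\<^bsub>R\<^esub>" by (simp add: ungraded_simps)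
  have s: "finsum (ungraded R) y {a. y a \<noteq> \<zero>\<^bsub>R\<^esub>} = y []"
    if y: "\<And>a. a \<noteq> [] \<Longrightarrow> y a = \<zero>\<^bsub>R\<^esub>" "y [] \<in> carrier R" for y :: "nat list \<Rightarrow> 'a"
  proof (cases "y [] = \<zero>\<^bsub>R\<^esub>")
    case True
    have "y a = \<zero>\<^bsub>R\<^esub>" for a using True y(1) by (cases "a = []") simp_all
    hence "finsum (ungraded R) y {a. y a \<noteq> \<zero>\<^bsub>R\<^esub>} = \<zero>\<^bsub>ungraded R\<^esub>"
      by (simp only: not_True_eq_False refl Collect_const if_False U.finsum_empty)
    thus ?thesis unfolding True 0 .
  next
    case False
    have yU: "y [] \<in> carrier (ungraded R)" using y(2) by (simp only: ungraded_simps)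
    have e: "{a. y a \<noteq> \<zero>\<^bsub>R\<^esub>} = insert [] {}" using False y(1) by blast
    have "finsum (ungraded R) y (insert [] {}) = y [] \<oplus>\<^bsub>ungraded R\<^esub> finsum (ungraded R) y {}"
      by (rule U.finsum_insert) (use yU in auto)
    thus ?thesis unfolding e U.finsum_empty U.r_zero[OF yU] .
  qed
  show ?thesis
  proof
    assume d: "decomposition (ungraded R) y x"
    hence y: "y a \<in> (if length a = 0 then carrier R else {\<zero>\<^bsub>R\<^esub>})" for a
      unfolding decomposition_def ungraded_simps by blast
    have y0: "y a = \<zero>\<^bsub>R\<^esub>" if "a \<noteq> []" for a using y[of a] that by simp
    have "y [] \<in> carrier R" using y[of "[]"] by simp
    hence "finsum (ungraded R) y {a. y a \<noteq> \<zero>\<^bsub>R\<^esub>} = y []" using y0 by (intro s)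
    moreover have "x = finsum (ungraded R) y {a. y a \<noteq> \<zero>\<^bsub>R\<^esub>}"
      using d unfolding decomposition_def ungraded_simps(5) by blast
    ultimately have "x = y []" by (rule trans[rotated])
    thus "y = (\<lambda>a. if a = [] then x else \<zero>\<^bsub>R\<^esub>)" using y0 by auto
  next
    assume y: "y = (\<lambda>a. if a = [] then x else \<zero>\<^bsub>R\<^esub>)"
    have "{a. y a \<noteq> \<zero>\<^bsub>R\<^esub>} \<subseteq> {[]}" unfolding y by auto
    hence "finite {a. y a \<noteq> \<zero>\<^bsub>R\<^esub>}" by (rule finite_subset) simp
    moreover have "finsum (ungraded R) y {a. y a \<noteq> \<zero>\<^bsub>R\<^esub>} = y []"
      by (rule s) (use x in \<open>simp_all add: y\<close>)
    hence "x = finsum (ungraded R) y {a. y a \<noteq> \<zero>\<^bsub>R\<^esub>}" by (rule trans[rotated, OF sym]) (simp add: y)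
    moreover have "\<forall>a. y a \<in> (if length a = 0 then carrier R else {\<zero>\<^bsub>R\<^esub>})" using x by (simp add: y)
    ultimately show "decomposition (ungraded R) y x"
      unfolding decomposition_def ungraded_simps by blast
  qed
qed

lemma multi_graded_ungraded:
  assumes R: "cring R" shows "multi_graded (ungraded R)"
proof -
  interpret U: cring "ungraded R" by (rule cring_ungraded[OF R])
  have "additive_subgroup (carrier R) (ungraded R)"
    by (rule U.additive_subgroupI)
      (use U.zero_closed U.a_closed U.a_inv_closed in \<open>simp_all add: ungraded_simps(1)\<close>)
  moreover have "\<exists>!y. decomposition (ungraded R) y x" if "x \<in> carrier R" for x
    using decomposition_ungraded[OF R that] by simp
  ultimately show ?thesis
    unfolding multi_graded_def using cring_ungraded[OF R] cring.cring_simprules(5,6)[OF R]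
    by (auto simp: ungraded_simps)
qed

lemma compatible_val_ungraded:
  assumes R: "cring R" and \<nu>: "discrete_valuation (ungraded R) \<nu>"
  shows "compatible_val (ungraded R) \<nu>"
proof -
  have "hcomp (ungraded R) x a = (if a = [] then x else \<zero>\<^bsub>R\<^esub>)" if "x \<in> carrier R" for x a
    unfolding hcomp_def by (simp add: decomposition_ungraded[OF R that])
  moreover have "\<zero>\<^bsub>R\<^esub> \<in> filt (ungraded R) \<nu> b" for b
  proof -
    have "\<zero>\<^bsub>R\<^esub> \<in> carrier (ungraded R)"
      using cring.cring_simprules(2)[OF R] by (simp add: ungraded_simps)
    moreover from this have "\<nu> \<zero>\<^bsub>R\<^esub> = \<infinity>" using \<nu> by (simp add: discrete_valuation_def ungraded_simps(5))
    ultimately show ?thesis by (simp add: filt_def)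
  qed
  ultimately show ?thesis by (simp add: compatible_val_def filt_def ungraded_simps(1))
qed

text \<open>Positive coordinates of \<open>v\<close> bound every coordinate of an exponent of given
  weight, and a grid has finitely many points below a bound. For \<open>v\<close> on the boundary a
  level can be infinite.\<close>

lemma finite_weight:
  assumes v: "\<forall>i. 0 < v $ i"
  shows "finite {u. puis_coeff \<phi> u \<noteq> 0 \<and> nat \<lfloor>pairing v u\<rfloor> = b}"
proof -
  obtain n where n: "n > 0" "\<forall>u. puis_coeff \<phi> u \<noteq> 0 \<longrightarrow> u \<in> grid n" using puis_grid by blast
  \<comment> \<open>The weight is a floor, so the pairing is less than \<open>b + 1\<close> and the
    i-th coordinate less than (b + 1)/v_i; adding these bounds gives one for all
    coordinates.\<close>
  define N where "N = (\<Sum>i\<in>UNIV. nat \<lceil>(of_nat b + 1) / v $ i\<rceil>)"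
  have "{u. puis_coeff \<phi> u \<noteq> 0 \<and> nat \<lfloor>pairing v u\<rfloor> = b} \<subseteq> grid_below n (\<chi> i. of_nat N)"
  proof
    fix u assume "u \<in> {u. puis_coeff \<phi> u \<noteq> 0 \<and> nat \<lfloor>pairing v u\<rfloor> = b}"
    hence u: "puis_coeff \<phi> u \<noteq> 0" "nat \<lfloor>pairing v u\<rfloor> = b" by auto
    have ug: "u \<in> grid n" using u n by blast
    have u0: "0 \<le> u $ i" for i using ug by (simp add: grid_def)
    have lt: "pairing v u < of_nat b + 1" using u(2) by linarith
    have "u $ i \<le> of_nat N" for i
    proof -
      have "v $ i * u $ i \<le> pairing v u"
        unfolding pairing_def using v u0 by (intro member_le_sum) (auto intro: mult_nonneg_nonneg less_imp_le)
      hence "u $ i \<le> (of_nat b + 1) / v $ i" using lt v by (simp add: pos_le_divide_eq mult.commute)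
      also have "\<dots> \<le> of_nat (nat \<lceil>(of_nat b + 1) / v $ i\<rceil>)" by (rule of_nat_ceiling)
      also have "\<dots> \<le> of_nat N" unfolding N_def of_nat_le_iff by (intro member_le_sum) auto
      finally show ?thesis .
    qed
    moreover have "of_nat n * (of_nat N - u $ i) \<in> \<int>" for i
    proof -
      have "of_nat n * u $ i \<in> \<int>" using ug by (simp add: grid_def)
      hence "of_nat (n * N) - of_nat n * u $ i \<in> \<int>" by (intro Ints_diff) simp_all
      thus ?thesis by (simp add: algebra_simps)
    qed
    ultimately show "u \<in> grid_below n (\<chi> i. of_nat N)" using ug by (simp add: grid_below_def) (simp add: grid_def)
  qed
  thus ?thesis using finite_grid_below[OF n(1)] by (rule finite_subset)
qed

text \<open>For interior \<open>v\<close> the coefficient function has finite support by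
  \<open>finite_weight\<close>; this is what makes \<open>Abs_poly_mapping\<close> meaningful, see
  \<open>lookup_initial_form\<close>.\<close>

definition initial_form :: "rat ^ 'd::finite \<Rightarrow> nat \<Rightarrow> 'd puiseux \<Rightarrow> ((rat ^ 'd) \<Rightarrow>\<^sub>0 complex)"
  where "initial_form v b \<phi> = Abs_poly_mapping (\<lambda>u. if nat \<lfloor>pairing v u\<rfloor> = b then puis_coeff \<phi> u else 0)"

lemma lookup_initial_form:
  assumes "\<forall>i. 0 < v $ i"
  shows "Poly_Mapping.lookup (initial_form v b \<phi>) u = (if nat \<lfloor>pairing v u\<rfloor> = b then puis_coeff \<phi> u else 0)"
proof -
  have "finite {u. (if nat \<lfloor>pairing v u\<rfloor> = b then puis_coeff \<phi> u else 0) \<noteq> 0}"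
    by (rule finite_subset[OF _ finite_weight[OF assms, of \<phi> b]]) auto
  thus ?thesis unfolding initial_form_def by (simp add: Abs_poly_mapping_inverse)
qed

section \<open>The ring O_S and its monomial valuations\<close>

lemma O_S_simps:
  "carrier (O_S \<zeta>) = {poly p \<zeta> | p. p \<in> polys_over integral_points}" "mult (O_S \<zeta>) = (*)" "add (O_S \<zeta>) = (+)"
  "one (O_S \<zeta>) = 1" "zero (O_S \<zeta>) = 0"
  by (simp_all add: O_S_def subring_on_def pseries_poly_eq)

lemma O_SI: "p \<in> polys_over integral_points \<Longrightarrow> \<phi> = poly p \<zeta> \<Longrightarrow> \<phi> \<in> carrier (O_S \<zeta>)"
  by (auto simp: O_S_simps)

lemma cring_O_S: "cring (O_S \<zeta>)"
proof (rule cring_type_operations)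
  note L = additive_monoid_integral_points
  show "0 \<in> carrier (O_S \<zeta>)" by (rule O_SI[of 0]) simp_all
  show "1 \<in> carrier (O_S \<zeta>)" by (rule O_SI[of 1]) (simp_all add: polys_over_1 L)
  fix x y assume "x \<in> carrier (O_S \<zeta>)" "y \<in> carrier (O_S \<zeta>)"
  then obtain p q where pq: "p \<in> polys_over integral_points" "x = poly p \<zeta>"
    "q \<in> polys_over integral_points" "y = poly q \<zeta>" by (auto simp: O_S_simps)
  show "x + y \<in> carrier (O_S \<zeta>)" by (rule O_SI[of "p + q"]) (simp_all add: pq polys_over_add)
  show "x * y \<in> carrier (O_S \<zeta>)" by (rule O_SI[of "p * q"]) (simp_all add: pq polys_over_mult L)
  show "- x \<in> carrier (O_S \<zeta>)" using polys_over_diff[of 0 integral_points p] by (intro O_SI[of "- p"]) (simp_all add: pq)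
qed (simp_all add: O_S_simps)

lemma scale_in_O_S:
  fixes \<zeta> :: "('d::finite) puiseux"
  assumes "\<phi> \<in> carrier (O_S \<zeta>)" shows "scale c \<phi> \<in> carrier (O_S \<zeta>)"
proof -
  obtain p where p: "p \<in> polys_over integral_points" "\<phi> = poly p \<zeta>" using assms by (auto simp: O_S_simps)
  have s: "scale c 1 \<in> supported integral_points"
    by (rule supportedI) (auto simp: scale.rep_eq one_puiseux.rep_eq integral_points_def split: if_splits)
  have "scale c \<phi> = scale c 1 * \<phi>"
  proof (rule puis_eqI)
    fix u
    have "puis_coeff (scale c 1 * \<phi>) (0 + u) = puis_coeff (scale c 1) (0 :: rat ^ 'd) * puis_coeff \<phi> u"
      unfolding times_puiseux.rep_eq
      by (rule cauchy_single) (auto simp: scale.rep_eq one_puiseux.rep_eq split: if_splits)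
    thus "puis_coeff (scale c \<phi>) u = puis_coeff (scale c 1 * \<phi>) u"
      by (simp add: scale.rep_eq one_puiseux.rep_eq)
  qed
  thus ?thesis using p s
    using polys_over_mult[OF additive_monoid_integral_points polys_over_pCons[OF s polys_over_0] p(1)]
    by (intro O_SI[of "[:scale c 1:] * p"]) simp_all
qed

lemma sum_in_O_S: "(\<And>i. i \<in> I \<Longrightarrow> h i \<in> carrier (O_S \<zeta>)) \<Longrightarrow> sum h I \<in> carrier (O_S \<zeta>)"
proof (induction I rule: infinite_finite_induct)
  case (insert i I)
  have "h i \<oplus>\<^bsub>O_S \<zeta>\<^esub> sum h I \<in> carrier (O_S \<zeta>)"
    using insert by (intro cring.cring_simprules(1)[OF cring_O_S]) auto
  thus ?case using insert by (simp add: O_S_simps)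
qed (use cring.cring_simprules(2)[OF cring_O_S, of \<zeta>] in \<open>simp_all add: O_S_simps\<close>)

text \<open>The series without constant term form a proper ideal containing all \<open>x_i\<close>; it contains, hence
  is, the centre of the valuation.\<close>

lemma centered_imp_interior:
  fixes v :: "rat ^ 'd::finite"
  assumes c: "centered_at_max (O_S \<zeta>) (monomial_val v)"
  shows "\<forall>i. 0 < v $ i"
proof
  fix i
  interpret R: cring "O_S \<zeta>" by (rule cring_O_S)
  define I where "I = {\<phi> \<in> carrier (O_S \<zeta>). 0 < monomial_val v \<phi>}"
  define J where "J = {\<phi> \<in> carrier (O_S \<zeta>). puis_coeff \<phi> 0 = 0}"
  have I: "maximalideal I (O_S \<zeta>)" using c by (simp add: centered_at_max_def I_def)
  have J: "ideal J (O_S \<zeta>)"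
  proof (rule idealI)
    have m: "\<ominus>\<^bsub>O_S \<zeta>\<^esub> x = - x" if x: "x \<in> carrier (O_S \<zeta>)" for x
    proof -
      have "x \<oplus>\<^bsub>O_S \<zeta>\<^esub> \<ominus>\<^bsub>O_S \<zeta>\<^esub> x = \<zero>\<^bsub>O_S \<zeta>\<^esub>" using x by (rule R.r_neg)
      thus ?thesis by (simp add: O_S_simps(3,5) eq_neg_iff_add_eq_0 add.commute)
    qed
    have "additive_subgroup J (O_S \<zeta>)"
    proof (rule R.additive_subgroupI)
      fix x y assume "x \<in> J" "y \<in> J"
      thus "x \<oplus>\<^bsub>O_S \<zeta>\<^esub> y \<in> J" using R.a_closed[of x y] by (simp add: J_def O_S_simps(3) plus_puiseux.rep_eq)
    next
      fix x assume x: "x \<in> J"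
      thus "\<ominus>\<^bsub>O_S \<zeta>\<^esub> x \<in> J" using R.a_inv_closed[of x] m[of x] by (simp add: J_def uminus_puiseux.rep_eq)
    next
      show "\<zero>\<^bsub>O_S \<zeta>\<^esub> \<in> J" using R.zero_closed by (simp add: J_def O_S_simps(5) zero_puiseux.rep_eq)
    qed (auto simp: J_def)
    thus "subgroup J (add_monoid (O_S \<zeta>))" by (rule additive_subgroup.a_subgroup)
    fix a x assume "a \<in> J" "x \<in> carrier (O_S \<zeta>)"
    thus "x \<otimes>\<^bsub>O_S \<zeta>\<^esub> a \<in> J" "a \<otimes>\<^bsub>O_S \<zeta>\<^esub> x \<in> J"
      using R.m_closed[of a x] R.m_closed[of x a] by (simp_all add: J_def O_S_simps(2) puis_coeff_mult_0)
  qed (rule R.ring_axioms)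
  have IJ: "I \<subseteq> J"
  proof
    fix \<phi> assume \<phi>: "\<phi> \<in> I"
    have "puis_coeff \<phi> 0 = 0"
    proof (rule ccontr)
      assume "puis_coeff \<phi> 0 \<noteq> 0"
      hence "monomial_val v \<phi> \<le> enat (nat \<lfloor>pairing v 0\<rfloor>)"
        unfolding monomial_val_def min_pairing_def by (intro INF_lower) (simp add: puis_supp_def)
      thus False using \<phi> by (simp add: I_def zero_enat_def[symmetric])
    qed
    thus "\<phi> \<in> J" using \<phi> by (simp add: I_def J_def)
  qed
  have "J = I \<or> J = carrier (O_S \<zeta>)"
    by (rule maximalideal.I_maximal[OF I J IJ]) (auto simp: J_def)
  moreover have "J \<noteq> carrier (O_S \<zeta>)"
  proof
    assume "J = carrier (O_S \<zeta>)"
    hence "1 \<in> J" using R.one_closed by (simp add: O_S_simps(4))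
    thus False by (simp add: J_def one_puiseux.rep_eq)
  qed
  ultimately have JI: "J = I" by blast
  have ax: "0 \<le> (axis i 1 :: rat ^ 'd)" "axis i 1 \<noteq> (0 :: rat ^ 'd)"
    by (auto simp: less_eq_vec_def axis_def vec_eq_iff)
  have "puis_monom (axis i 1) \<in> supported integral_points"
    by (rule supportedI) (auto simp: puis_monom.rep_eq integral_points_def axis_def split: if_splits)
  hence "puis_monom (axis i 1) \<in> carrier (O_S \<zeta>)"
    by (intro O_SI[of "[:puis_monom (axis i 1):]"]) (simp_all add: polys_over_pCons)
  hence "puis_monom (axis i 1) \<in> I"
    unfolding JI[symmetric] using ax by (simp add: J_def puis_monom.rep_eq)
  moreover have "puis_supp (puis_monom (axis i 1)) = {axis i 1 :: rat ^ 'd}"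
    using ax by (auto simp: puis_supp_def puis_monom.rep_eq)
  ultimately have "0 < enat (nat \<lfloor>pairing v (axis i 1)\<rfloor>)"
    by (simp add: I_def monomial_val_def min_pairing_def)
  hence "0 < \<lfloor>v $ i\<rfloor>" by (simp add: pairing_axis zero_enat_def)
  thus "0 < v $ i" by linarith
qed

locale valued_branch = branch \<zeta> ls for \<zeta> :: "('d::finite) puiseux" and ls +
  fixes vs :: "(rat ^ 'd) list"
  assumes nonempty: "vs \<noteq> []"
    and vs: "\<And>v. v \<in> set vs \<Longrightarrow> v \<noteq> 0 \<and> v \<in> sigma \<inter> dual_lattice (lattice_of ls)"
    and interior: "\<forall>i. 0 < hd vs $ i"
begin

lemma grid_lattice: "\<exists>n>0. \<forall>u\<in>lattice_of ls. 0 \<le> u \<longrightarrow> u \<in> grid n"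
proof -
  obtain n where "n > 0" "\<And>j u i. j \<le> g \<Longrightarrow> u \<in> M j \<Longrightarrow> of_nat n * u $ i \<in> \<int>"
    by (rule denominator) blast
  from this(1) this(2)[of g] show ?thesis by (intro exI[of _ n]) (auto simp: grid_def less_eq_vec_def)
qed

lemma pairing_lattice: "v \<in> set vs \<Longrightarrow> u \<in> lattice_of ls \<Longrightarrow> pairing v u \<in> \<int>"
  using vs by (auto simp: dual_lattice_def)

lemma axis_in_Gam: "axis i 1 \<in> Gam ls"
proof -
  have "axis i 1 \<in> grid 1" by (auto simp: grid_def axis_def)
  moreover have "axis i 1 = axis i 1 + (\<Sum>i<g. of_nat ((\<lambda>_. 0) i) *s gam ls i)" by simp
  ultimately show ?thesis unfolding Gam_def by (intro CollectI exI conjI)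
qed

lemma nonzero_coordinate: "v \<in> set vs \<Longrightarrow> \<exists>i. v $ i \<noteq> 0"
  using vs[of v] by (auto simp: vec_eq_iff)

sublocale weighted_monoid "Gam ls" "set vs"
proof
  show "additive_monoid (Gam ls)" by (rule additive_monoid_Gam)
  show "\<exists>n>0. Gam ls \<subseteq> grid n" using grid_lattice Gam_subset_lattice Gam_nonneg by blast
  show "set vs \<subseteq> sigma" using vs by blast
  show "pairing v u \<in> \<int>" if "v \<in> set vs" "u \<in> Gam ls" for v u
    using pairing_lattice that Gam_subset_lattice by blast
  show "\<exists>u\<in>Gam ls. pairing v u \<noteq> 0" if "v \<in> set vs" for v
    using nonzero_coordinate[OF that] axis_in_Gam by (metis pairing_axis)
qed

abbreviation "R \<equiv> ungraded (O_S \<zeta>)"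
abbreviation "v0 \<equiv> hd vs"

lemma carrier_R: "carrier R = carrier (O_S \<zeta>)"
  by (simp add: ungraded_simps)

lemma supp_R:
  assumes "\<phi> \<in> carrier R" "puis_coeff \<phi> u \<noteq> 0" shows "u \<in> lattice_of ls" "0 \<le> u"
  using assms O_S_supported supportedD puis_coeff_nonneg by (fastforce simp: carrier_R O_S_simps)+

lemma pairing_weight_R:
  assumes "v \<in> set vs" "\<phi> \<in> carrier R" "puis_coeff \<phi> u \<noteq> 0"
  shows "pairing v u = of_nat (weight v u)"
proof -
  have "pairing v u \<in> \<int>" using pairing_lattice[OF assms(1)] supp_R[OF assms(2,3)] by blast
  moreover have "0 \<le> pairing v u" using pairing_nonneg vs[OF assms(1)] supp_R[OF assms(2,3)] by blast
  ultimately show ?thesis by (auto simp: weight_def elim!: Ints_cases)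
qed

lemma monomial_val_ge_iff:
  "enat b \<le> monomial_val v \<phi> \<longleftrightarrow> (\<forall>u. puis_coeff \<phi> u \<noteq> 0 \<longrightarrow> b \<le> weight v u)"
  by (simp add: monomial_val_def min_pairing_def weight_def le_INF_iff puis_supp_def)

lemma discrete_valuation_R:
  assumes v: "v \<in> set vs" shows "discrete_valuation R (monomial_val v)"
proof -
  have mult: "monomial_val v (x * y) = monomial_val v x + monomial_val v y"
    if xy: "x \<in> carrier R" "y \<in> carrier R" for x y
  proof -
    obtain n where n: "n > 0" "on_grid n (puis_coeff x)" "on_grid n (puis_coeff y)"
      by (rule puis_denominator2[of x y])
    show ?thesis unfolding monomial_val_def puis_supp_def times_puiseux.rep_eq
    proof (rule min_pairing_cauchy[OF n])
      show "v \<in> sigma" using vs[OF v] by blast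
    qed (use pairing_lattice[OF v] supp_R xy in blast)+
  qed
  have add: "min (monomial_val v x) (monomial_val v y) \<le> monomial_val v (x + y)" for x y
    unfolding monomial_val_def by (rule min_pairing_Un) (auto simp: puis_supp_def plus_puiseux.rep_eq)
  have zero: "monomial_val v x = \<infinity> \<longleftrightarrow> x = 0" for x
    using puis_nonzeroD[of x] by (auto simp: monomial_val_def min_pairing_eq_infinity_iff puis_supp_def zero_puiseux.rep_eq)
  \<comment> \<open>Non-triviality: \<open>v\<close> may lie on a face of the cone, so a coordinate
    where it does not vanish is chosen. All exponents of an element with least exponent e_i then
    have positive weight.\<close>
  obtain i where i: "v $ i \<noteq> 0" using nonzero_coordinate[OF v] by blast
  obtain p where p: "p \<in> polys_over integral_points" "least (poly p \<zeta>) (axis i 1)"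
    using Gam_attained[OF axis_in_Gam] by blast
  have pR: "poly p \<zeta> \<in> carrier R" using p(1) by (auto simp: carrier_R O_S_simps)
  have "weight v (axis i 1) \<noteq> 0"
    using pairing_weight[OF v axis_in_Gam[of i]] i by (auto simp: pairing_axis)
  have "\<not> monomial_val v (poly p \<zeta>) = 0"
  proof -
    have "enat 1 \<le> monomial_val v (poly p \<zeta>)"
      unfolding monomial_val_ge_iff
    proof (intro allI impI)
      fix u assume u: "puis_coeff (poly p \<zeta>) u \<noteq> 0"
      hence "0 \<le> u - axis i 1" using p(2) by (simp add: least_def less_eq_vec_def)
      hence "0 \<le> pairing v (u - axis i 1)" using pairing_nonneg vs[OF v] by blast
      hence "v $ i \<le> pairing v u" by (simp add: pairing_diff pairing_axis)
      moreover have "0 < v $ i" using i vs[OF v] by (auto simp: sigma_def order_less_le)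
      ultimately have "weight v u \<noteq> 0" using pairing_weight_R[OF v pR u] by auto
      thus "1 \<le> weight v u" by simp
    qed
    thus ?thesis by (auto simp: zero_enat_def)
  qed
  moreover have "monomial_val v (poly p \<zeta>) \<noteq> \<infinity>"
    using p(2) by (auto simp: zero least_def zero_puiseux.rep_eq)
  ultimately have "\<exists>x\<in>carrier R. monomial_val v x \<noteq> 0 \<and> monomial_val v x \<noteq> \<infinity>" using pR by blast
  thus ?thesis unfolding discrete_valuation_def using mult add zero by (simp add: ungraded_simps O_S_simps)
qed

lemma lookup_in: "Poly_Mapping.lookup (initial_form v0 b \<phi>) u = (if weight v0 u = b then puis_coeff \<phi> u else 0)"
  using lookup_initial_form[OF interior] by (simp add: weight_def)

lemma v0: "v0 \<in> set vs"
  using nonempty by simp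

text \<open>In I(b) an exponent of weight exactly \<open>b\<close> has minimal weight, so it is an
  initial exponent of an element of O_S.\<close>

lemma weight_in_initial:
  assumes x: "x \<in> filt R (monomial_val v0) b" and u: "puis_coeff x u \<noteq> 0" "weight v0 u = b"
  shows "u \<in> Gam ls"
proof -
  have xR: "x \<in> carrier R" and ge: "\<And>w. puis_coeff x w \<noteq> 0 \<Longrightarrow> b \<le> weight v0 w"
    using x by (simp_all add: filt_def monomial_val_ge_iff)
  obtain p where p: "p \<in> polys_over integral_points" "x = poly p \<zeta>" using xR by (auto simp: carrier_R O_S_simps)
  have "pairing v0 u \<le> pairing v0 w" if "puis_coeff x w \<noteq> 0" for w
    using pairing_weight_R[OF v0 xR u(1)] pairing_weight_R[OF v0 xR that] ge[OF that] u(2) by simp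
  hence "u \<in> init_exponents v0 x" using u(1) by (simp add: init_exponents_def)
  thus ?thesis using init_exponents_O_S[OF interior p(1)] p(2) by blast
qed

text \<open>Each X^u of \<open>p\<close> is replaced by an element of O_S with least exponent u and
  coefficient 1 there. Its other exponents exceed u coordinatewise: no weight in the cone drops, and
  the interior weight \<open>v0\<close> rises strictly, so the initial form is exactly
  \<open>p\<close>. One lift thus serves all the valuations.\<close>

lemma lift_initial_form:
  fixes p :: "(rat ^ 'd) \<Rightarrow>\<^sub>0 complex"
  assumes p: "Poly_Mapping.keys p \<subseteq> {u \<in> Gam ls. weight v0 u = b}"
  obtains x where "x \<in> filt R (monomial_val v0) b" "initial_form v0 b x = p"
    "\<And>v. v \<in> set vs \<Longrightarrow> algebra_val v p \<le> monomial_val v x"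
proof -
  have "\<forall>u\<in>Gam ls. \<exists>h. h \<in> carrier (O_S \<zeta>) \<and> least h u \<and> puis_coeff h u = 1"
    using Gam_attained by (fastforce simp: O_S_simps)
  then obtain h where h: "\<And>u. u \<in> Gam ls \<Longrightarrow> h u \<in> carrier (O_S \<zeta>)" "\<And>u. u \<in> Gam ls \<Longrightarrow> least (h u) u"
    "\<And>u. u \<in> Gam ls \<Longrightarrow> puis_coeff (h u) u = 1" by metis
  let ?K = "Poly_Mapping.keys p"
  define x where "x = (\<Sum>u\<in>?K. scale (Poly_Mapping.lookup p u) (h u))"
  have K: "u \<in> Gam ls" "weight v0 u = b" if "u \<in> ?K" for u using p that by auto
  have xR: "x \<in> carrier R" unfolding x_def carrier_R by (intro sum_in_O_S scale_in_O_S h K)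
  have cx: "puis_coeff x w = (\<Sum>u\<in>?K. Poly_Mapping.lookup p u * puis_coeff (h u) w)" for w
    by (simp add: x_def puis_coeff_sum scale.rep_eq)
  have le: "\<exists>u\<in>?K. u \<le> w" if w: "puis_coeff x w \<noteq> 0" for w
  proof -
    obtain u where "u \<in> ?K" "puis_coeff (h u) w \<noteq> 0"
      using w unfolding cx by (auto elim!: sum.not_neutral_contains_not_neutral)
    thus ?thesis using h(2)[OF K(1)] by (auto simp: least_def)
  qed
  have val: "algebra_val v p \<le> monomial_val v x" if v: "v \<in> set vs" for v
    unfolding monomial_val_def min_pairing_def
  proof (rule INF_greatest)
    fix w assume "w \<in> puis_supp x"
    then obtain u where u: "u \<in> ?K" "u \<le> w" using le by (auto simp: puis_supp_def)
    have "0 \<le> w - u" using u(2) by (simp add: less_eq_vec_def)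
    hence "0 \<le> pairing v (w - u)" using pairing_nonneg vs[OF v] by blast
    hence "pairing v u \<le> pairing v w" by (simp add: pairing_diff)
    hence "enat (nat \<lfloor>pairing v u\<rfloor>) \<le> enat (nat \<lfloor>pairing v w\<rfloor>)" by (simp add: nat_mono floor_mono)
    moreover have "algebra_val v p \<le> enat (nat \<lfloor>pairing v u\<rfloor>)"
      unfolding algebra_val_def min_pairing_def using u(1) by (rule INF_lower)
    ultimately show "algebra_val v p \<le> enat (nat \<lfloor>pairing v w\<rfloor>)" by (rule order_trans[rotated])
  qed
  have "enat b \<le> algebra_val v0 p"
    using algebra_val_ge_iff[OF v0, of p b] K by blast
  hence "x \<in> filt R (monomial_val v0) b"
    using xR order_trans[OF _ val[OF v0]] by (simp add: filt_def)
  moreover have "initial_form v0 b x = p"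
  proof (rule poly_mapping_eqI)
    fix w
    show "Poly_Mapping.lookup (initial_form v0 b x) w = Poly_Mapping.lookup p w"
    proof (cases "weight v0 w = b")
      case True
      have z: "puis_coeff (h u) w = (if u = w then 1 else 0)" if u: "u \<in> ?K" for u
      proof (cases "puis_coeff (h u) w = 0")
        case True
        thus ?thesis using h(3)[OF K(1)[OF u]] by auto
      next
        case False
        hence "u \<le> w" using h(2)[OF K(1)[OF u]] by (simp add: least_def)
        moreover have "pairing v0 w \<le> pairing v0 u"
          using pairing_weight_R[OF v0 _ False] h(1)[OF K(1)[OF u]] pairing_weight[OF v0 K(1)[OF u]] K(2)[OF u] True
          by (simp add: carrier_R \<open>weight v0 w = b\<close>)
        ultimately have "u = w" by (rule pairing_less[OF interior])
        thus ?thesis using h(3)[OF K(1)[OF u]] by simp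
      qed
      have "puis_coeff x w = (\<Sum>u\<in>?K. if u = w then Poly_Mapping.lookup p w else 0)"
        unfolding cx by (intro sum.cong refl) (simp add: z)
      thus ?thesis using True by (simp add: lookup_in in_keys_iff)
    next
      case False
      thus ?thesis using K by (auto simp: lookup_in in_keys_iff)
    qed
  qed
  ultimately show thesis using that val by blast
qed

lemma keys_in: "Poly_Mapping.keys (initial_form v0 b \<phi>) = {u. puis_coeff \<phi> u \<noteq> 0 \<and> weight v0 u = b}"
  by (auto simp: in_keys_iff lookup_in split: if_splits)

text \<open>When two exponents of weights at least \<open>b\<close> and \<open>c\<close> add up to
  one of weight \<open>b + c\<close>, both bounds are equalities, so the coefficient only involves
  the initial forms.\<close>

lemma initial_form_mult:
  assumes x: "x \<in> filt R (monomial_val v0) b" and y: "y \<in> filt R (monomial_val v0) c"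
  shows "initial_form v0 (b + c) (x * y) = initial_form v0 b x * initial_form v0 c y"
proof (rule poly_mapping_eqI)
  fix u
  have xR: "x \<in> carrier R" and gx: "\<And>w. puis_coeff x w \<noteq> 0 \<Longrightarrow> b \<le> weight v0 w"
    using x by (simp_all add: filt_def monomial_val_ge_iff)
  have yR: "y \<in> carrier R" and gy: "\<And>w. puis_coeff y w \<noteq> 0 \<Longrightarrow> c \<le> weight v0 w"
    using y by (simp_all add: filt_def monomial_val_ge_iff)
  let ?K = "Poly_Mapping.keys (initial_form v0 b x)"
  have w: "weight v0 u = weight v0 s + weight v0 (u - s)" if "puis_coeff x s \<noteq> 0" "puis_coeff y (u - s) \<noteq> 0" for s
  proof -
    have "pairing v0 u = of_nat (weight v0 s + weight v0 (u - s))"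
      using pairing_weight_R[OF v0 xR that(1)] pairing_weight_R[OF v0 yR that(2)] by (simp add: pairing_diff)
    thus ?thesis unfolding weight_def[of v0 u] by (simp only: floor_of_nat nat_int)
  qed
  have r: "Poly_Mapping.lookup (initial_form v0 b x * initial_form v0 c y) u
      = (\<Sum>s\<in>?K. puis_coeff x s * (if weight v0 (u - s) = c then puis_coeff y (u - s) else 0))"
    unfolding lookup_mult_sum[OF finite_keys order_refl]
    by (intro sum.cong refl) (auto simp: lookup_in keys_in)
  obtain n where n: "n > 0" "on_grid n (puis_coeff x)" "on_grid n (puis_coeff y)"
    by (rule puis_denominator2[of x y])
  show "Poly_Mapping.lookup (initial_form v0 (b + c) (x * y)) u = Poly_Mapping.lookup (initial_form v0 b x * initial_form v0 c y) u"
  proof (cases "weight v0 u = b + c")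
    case True
    have fin: "finite {s. puis_coeff x s \<noteq> 0 \<and> puis_coeff y (u - s) \<noteq> 0}"
      by (rule finite_subset[OF _ finite_grid_below[OF n(1), of u]]) (use n in \<open>auto simp: grid_below_def on_grid_def\<close>)
    have "puis_coeff (x * y) u = (\<Sum>s | puis_coeff x s \<noteq> 0 \<and> puis_coeff y (u - s) \<noteq> 0. puis_coeff x s * puis_coeff y (u - s))"
      by (simp add: times_puiseux.rep_eq cauchy_def)
    also have "\<dots> = (\<Sum>s | puis_coeff x s \<noteq> 0 \<and> puis_coeff y (u - s) \<noteq> 0.
        puis_coeff x s * (if weight v0 (u - s) = c then puis_coeff y (u - s) else 0))"
    proof (intro sum.cong refl)
      fix s assume "s \<in> {s. puis_coeff x s \<noteq> 0 \<and> puis_coeff y (u - s) \<noteq> 0}"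
      hence "weight v0 (u - s) = c" using w[of s] gx[of s] gy[of "u - s"] True by simp
      thus "puis_coeff x s * puis_coeff y (u - s) = puis_coeff x s * (if weight v0 (u - s) = c then puis_coeff y (u - s) else 0)" by simp
    qed
    also have "\<dots> = (\<Sum>s\<in>?K. puis_coeff x s * (if weight v0 (u - s) = c then puis_coeff y (u - s) else 0))"
    proof (rule sum.mono_neutral_cong[OF finite_keys fin])
      fix s assume "s \<in> {s. puis_coeff x s \<noteq> 0 \<and> puis_coeff y (u - s) \<noteq> 0} - ?K"
      hence "puis_coeff x s \<noteq> 0" "puis_coeff y (u - s) \<noteq> 0" "weight v0 s \<noteq> b" by (auto simp: keys_in)
      thus "puis_coeff x s * (if weight v0 (u - s) = c then puis_coeff y (u - s) else 0) = 0"
        using w[of s] gx[of s] gy[of "u - s"] True by simp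
    qed (auto simp: keys_in)
    finally show ?thesis using True r by (simp add: lookup_in)
  next
    case False
    have "puis_coeff x s * (if weight v0 (u - s) = c then puis_coeff y (u - s) else 0) = 0" if "s \<in> ?K" for s
      using that w[of s] False by (auto simp: keys_in)
    hence "Poly_Mapping.lookup (initial_form v0 b x * initial_form v0 c y) u = 0"
      unfolding r by (rule sum.neutral[OF ballI])
    thus ?thesis using False by (simp add: lookup_in)
  qed
qed

lemma initial_forms_R: "initial_forms (Gam ls) (set vs) R (monomial_val v0) [] v0 (initial_form v0)"
proof (intro initial_forms.intro weighted_monoid_axioms initial_forms_axioms.intro v0)
  show "multi_graded R" by (rule multi_graded_ungraded[OF cring_O_S])
  show "discrete_valuation R (monomial_val v0)" by (rule discrete_valuation_R[OF v0])
  show "grank R = length []" by (simp add: ungraded_simps)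
  show "initial_form v0 0 \<one>\<^bsub>R\<^esub> = 1"
    by (rule poly_mapping_eqI) (auto simp: lookup_in lookup_one ungraded_simps O_S_simps one_puiseux.rep_eq weight_def when_def)
next
  fix b x assume x: "x \<in> filt R (monomial_val v0) b"
  show r: "Poly_Mapping.keys (initial_form v0 b x) \<subseteq> {u \<in> Gam ls. weight v0 u = b}"
    using weight_in_initial[OF x] by (auto simp: keys_in)
  have "initial_form v0 b x = 0 \<longleftrightarrow> Poly_Mapping.keys (initial_form v0 b x) = {}" by simp
  also have "\<dots> \<longleftrightarrow> (\<forall>u. puis_coeff x u \<noteq> 0 \<longrightarrow> Suc b \<le> weight v0 u)"
    using x unfolding keys_in by (fastforce simp: filt_def monomial_val_ge_iff Suc_le_eq order_less_le)
  finally show "initial_form v0 b x = 0 \<longleftrightarrow> x \<in> filt R (monomial_val v0) (Suc b)"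
    using x by (simp add: filt_def monomial_val_ge_iff)
  fix y
  show "initial_form v0 b (x \<oplus>\<^bsub>R\<^esub> y) = initial_form v0 b x + initial_form v0 b y"
    by (rule poly_mapping_eqI) (simp add: lookup_in lookup_add ungraded_simps O_S_simps plus_puiseux.rep_eq)
next
  fix b c x y assume "x \<in> filt R (monomial_val v0) b" "y \<in> filt R (monomial_val v0) c"
  thus "initial_form v0 (b + c) (x \<otimes>\<^bsub>R\<^esub> y) = initial_form v0 b x * initial_form v0 c y"
    using initial_form_mult by (simp add: ungraded_simps O_S_simps)
next
  fix a :: "nat list" and b assume a: "length a = length ([] :: (rat ^ 'd) list)"
  show "initial_form v0 b ` (filt R (monomial_val v0) b \<inter> component R a) =
      {p. Poly_Mapping.keys p \<subseteq> {u \<in> Gam ls. weight v0 u = b \<and> mdeg [] u = a}}"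
  proof (intro equalityI subsetI)
    fix p assume "p \<in> initial_form v0 b ` (filt R (monomial_val v0) b \<inter> component R a)"
    thus "p \<in> {p. Poly_Mapping.keys p \<subseteq> {u \<in> Gam ls. weight v0 u = b \<and> mdeg [] u = a}}"
      using weight_in_initial a by (auto simp: keys_in mdeg_def)
  next
    fix p :: "(rat ^ 'd) \<Rightarrow>\<^sub>0 complex"
    assume "p \<in> {p. Poly_Mapping.keys p \<subseteq> {u \<in> Gam ls. weight v0 u = b \<and> mdeg [] u = a}}"
    hence "Poly_Mapping.keys p \<subseteq> {u \<in> Gam ls. weight v0 u = b}" by auto
    then obtain x where x: "x \<in> filt R (monomial_val v0) b" "initial_form v0 b x = p" by (rule lift_initial_form)
    have "x \<in> component R a" using x(1) by (simp add: filt_def ungraded_simps)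
    thus "p \<in> initial_form v0 b ` (filt R (monomial_val v0) b \<inter> component R a)" using x by blast
  qed
next
  fix b and p :: "(rat ^ 'd) \<Rightarrow>\<^sub>0 complex" assume "Poly_Mapping.keys p \<subseteq> {u \<in> Gam ls. weight v0 u = b}"
  then obtain x where "x \<in> filt R (monomial_val v0) b" "initial_form v0 b x = p" by (rule lift_initial_form)
  thus "\<exists>x\<in>filt R (monomial_val v0) b. initial_form v0 b x = p" by blast
qed (use nonempty in simp)

end

section \<open>The stages of the iteration and the isomorphism\<close>

context valued_branch
begin

abbreviation "stage \<equiv> iterated_gr (O_S \<zeta>) (map monomial_val vs)"

lemma stage_0: "stage 0 = (carry_ring Base R, map (carry_val Base R) (map monomial_val vs))"
  by simp

lemma stage_Suc:
  "fst (stage (Suc k)) = carry_ring encode_family (gr (fst (stage k)) (snd (stage k) ! k))"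
  "snd (stage (Suc k)) = map (\<lambda>\<omega>. carry_val encode_family (gr (fst (stage k)) (snd (stage k) ! k))
    (induced_val (fst (stage k)) (snd (stage k) ! k) \<omega>)) (snd (stage k))"
  by (simp_all add: case_prod_beta)

lemma transport_Base: "graded_transport R (carry_ring Base R) Base"
  by (rule graded_transport_carry[OF inj_on_Base])

lemma carry_val_Base: "x \<in> carrier R \<Longrightarrow> carry_val Base R \<omega> (Base x) = \<omega> x"
  by (rule carry_val_apply[OF inj_on_Base])

text \<open>The first stage is reached from R by initial forms and good lifts, the later ones from
  C[Gamma] by homogeneous parts. The count starts at \<open>Suc k\<close> because stage 0 is R, not
  a semigroup algebra. All valuations are carried along, as the next graded ring is taken for one of
  them.\<close>

lemma stage_transport:
  "k < length vs \<Longrightarrow> \<exists>\<Phi>. graded_transport (semigroup_algebra (Gam ls) (take (Suc k) vs)) (fst (stage (Suc k))) \<Phi> \<and>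
    length (snd (stage (Suc k))) = length vs \<and>
    (\<forall>i<length vs. \<forall>p\<in>carrier (semigroup_algebra (Gam ls) (take (Suc k) vs)).
      (snd (stage (Suc k)) ! i) (\<Phi> p) = algebra_val (vs ! i) p)"
proof (induction k)
  case 0
  interpret I: initial_forms "Gam ls" "set vs" R "monomial_val v0" "[]" v0 "initial_form v0"
    by (rule initial_forms_R)
  have v0_eq: "vs ! 0 = v0" using nonempty by (simp add: hd_conv_nth)
  obtain \<Theta> where \<Theta>: "graded_transport I.B
      (carry_ring encode_family (gr (carry_ring Base R) (carry_val Base R (monomial_val v0)))) \<Theta>"
    and val: "\<And>\<rho> \<rho>' w p. \<lbrakk>\<forall>x\<in>carrier R. \<rho>' (Base x) = \<rho> x; I.value_of_initial_form \<rho> w; p \<in> carrier I.B\<rbrakk> \<Longrightarrow>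
      carry_val encode_family (gr (carry_ring Base R) (carry_val Base R (monomial_val v0)))
        (induced_val (carry_ring Base R) (carry_val Base R (monomial_val v0)) \<rho>') (\<Theta> p) = algebra_val w p"
    using I.iteration_step[OF transport_Base, of "carry_val Base R (monomial_val v0)"] carry_val_Base by blast
  have take: "take (Suc 0) vs = [] @ [v0]" using nonempty by (cases vs) simp_all
  have \<omega>: "snd (stage 0) ! 0 = carry_val Base R (monomial_val v0)" using nonempty v0_eq by simp
  have fst_eq: "fst (stage 0) = carry_ring Base R" by simp
  show ?case
  proof (intro exI[of _ \<Theta>] conjI allI impI ballI)
    show "graded_transport (semigroup_algebra (Gam ls) (take (Suc 0) vs)) (fst (stage (Suc 0))) \<Theta>"
      using \<Theta> unfolding stage_Suc \<omega> fst_eq take .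
    show "length (snd (stage (Suc 0))) = length vs" unfolding stage_Suc by simp
    fix i p assume i: "i < length vs" and p: "p \<in> carrier (semigroup_algebra (Gam ls) (take (Suc 0) vs))"
    have vi: "vs ! i \<in> set vs" using i by simp
    have "snd (stage (Suc 0)) ! i = carry_val encode_family (gr (carry_ring Base R) (carry_val Base R (monomial_val v0)))
        (induced_val (carry_ring Base R) (carry_val Base R (monomial_val v0)) (carry_val Base R (monomial_val (vs ! i))))"
      unfolding stage_Suc \<omega> fst_eq using i by simp
    moreover have "\<dots> (\<Theta> p) = algebra_val (vs ! i) p"
    proof (rule val)
      show "\<forall>x\<in>carrier R. carry_val Base R (monomial_val (vs ! i)) (Base x) = monomial_val (vs ! i) x"
        using carry_val_Base by blast
      \<comment> \<open>The exponents of an initial form are among those of the element, so the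
        minimum is taken over a smaller set.\<close>
      have "monomial_val (vs ! i) x \<le> algebra_val (vs ! i) (initial_form v0 b x)" for b x
        unfolding monomial_val_def algebra_val_def
        by (rule min_pairing_antimono) (auto simp: keys_in puis_supp_def)
      moreover have "\<exists>x\<in>filt R (monomial_val v0) b. initial_form v0 b x = p \<and> algebra_val (vs ! i) p \<le> monomial_val (vs ! i) x"
        if "Poly_Mapping.keys p \<subseteq> {u \<in> Gam ls. weight v0 u = b}" for b p
        using lift_initial_form[OF that] vi by metis
      ultimately show "I.value_of_initial_form (monomial_val (vs ! i)) (vs ! i)"
        unfolding I.value_of_initial_form_def by blast
      show "p \<in> carrier (semigroup_algebra (Gam ls) ([] @ [v0]))" using p unfolding take .
    qed
    ultimately show "(snd (stage (Suc 0)) ! i) (\<Theta> p) = algebra_val (vs ! i) p" by simp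
  qed
next
  case (Suc k)
  define us v where "us = take (Suc k) vs" and "v = vs ! Suc k"
  have us: "set us \<subseteq> set vs" "v \<in> set vs" using Suc.prems by (auto simp: us_def v_def dest: in_set_takeD)
  let ?B = "semigroup_algebra (Gam ls) us"
  define A \<omega>s where "A = fst (stage (Suc k))" and "\<omega>s = snd (stage (Suc k))"
  obtain \<Phi> where \<Phi>: "graded_transport ?B A \<Phi>" "length \<omega>s = length vs"
    "\<And>i p. i < length vs \<Longrightarrow> p \<in> carrier ?B \<Longrightarrow> (\<omega>s ! i) (\<Phi> p) = algebra_val (vs ! i) p"
    using Suc.IH Suc.prems unfolding us_def A_def \<omega>s_def by auto
  interpret I: initial_forms "Gam ls" "set vs" ?B "algebra_val v" us v "part v"
    by (rule initial_forms_algebra[OF us])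
  define \<omega> where "\<omega> = \<omega>s ! Suc k"
  have \<omega>: "\<omega> (\<Phi> p) = algebra_val v p" if "p \<in> carrier ?B" for p
    unfolding \<omega>_def v_def using \<Phi>(3)[OF Suc.prems that] .
  obtain \<Theta> where \<Theta>: "graded_transport I.B (carry_ring encode_family (gr A \<omega>)) \<Theta>"
    and val: "\<And>\<rho> \<rho>' w p. \<lbrakk>\<forall>x\<in>carrier ?B. \<rho>' (\<Phi> x) = \<rho> x; I.value_of_initial_form \<rho> w; p \<in> carrier I.B\<rbrakk> \<Longrightarrow>
      carry_val encode_family (gr A \<omega>) (induced_val A \<omega> \<rho>') (\<Theta> p) = algebra_val w p"
    using I.iteration_step[OF \<Phi>(1) \<omega>] by blast
  have take: "take (Suc (Suc k)) vs = us @ [v]"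
    unfolding us_def v_def by (rule take_Suc_conv_app_nth[OF Suc.prems])
  note Suc_eq = stage_Suc[of "Suc k", folded A_def \<omega>s_def, folded \<omega>_def]
  show ?case
  proof (intro exI[of _ \<Theta>] conjI allI impI ballI)
    show "graded_transport (semigroup_algebra (Gam ls) (take (Suc (Suc k)) vs)) (fst (stage (Suc (Suc k)))) \<Theta>"
      using \<Theta> unfolding Suc_eq take .
    show "length (snd (stage (Suc (Suc k)))) = length vs" unfolding Suc_eq using \<Phi>(2) by simp
    fix i p assume i: "i < length vs" and p: "p \<in> carrier (semigroup_algebra (Gam ls) (take (Suc (Suc k)) vs))"
    have "snd (stage (Suc (Suc k))) ! i = carry_val encode_family (gr A \<omega>) (induced_val A \<omega> (\<omega>s ! i))"
      unfolding Suc_eq using i \<Phi>(2) by simp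
    moreover have "\<dots> (\<Theta> p) = algebra_val (vs ! i) p"
    proof (rule val)
      show "\<forall>x\<in>carrier ?B. (\<omega>s ! i) (\<Phi> x) = algebra_val (vs ! i) x"
        using \<Phi>(3)[OF i] by blast
      have "algebra_val (vs ! i) x \<le> algebra_val (vs ! i) (part v b x)" for b x
        unfolding algebra_val_def by (rule min_pairing_antimono) (auto simp: keys_part)
      moreover have "\<exists>x\<in>filt ?B (algebra_val v) b. part v b x = q \<and> algebra_val (vs ! i) q \<le> algebra_val (vs ! i) x"
        if q: "Poly_Mapping.keys q \<subseteq> {u \<in> Gam ls. weight v u = b}" for b q
      \<comment> \<open>In C[Gamma] a homogeneous element is its own lift, whatever the
        weight.\<close>
      proof (intro bexI[of _ q] conjI)
        show "part v b q = q" using I.part_id[OF q, of b] by simp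
        show "q \<in> filt ?B (algebra_val v) b"
          using q algebra_val_ge_iff[OF us(2), of q b] by (auto simp: filt_def semigroup_algebra_simps(1))
      qed simp
      ultimately show "I.value_of_initial_form (algebra_val (vs ! i)) (vs ! i)"
        unfolding I.value_of_initial_form_def by blast
      show "p \<in> carrier (semigroup_algebra (Gam ls) (us @ [v]))" using p unfolding take .
    qed
    ultimately show "(snd (stage (Suc (Suc k))) ! i) (\<Theta> p) = algebra_val (vs ! i) p" by simp
  qed
qed

text \<open>Stage 0 is a copy of R with the grading by Z^0 and is treated directly; the others
  inherit everything from a semigroup algebra through \<open>stage_transport\<close>.\<close>

lemma stage_valuations:
  assumes k: "k \<le> length vs"
  shows "multi_graded (fst (stage k)) \<and>
    (\<forall>\<omega>\<in>set (snd (stage k)). discrete_valuation (fst (stage k)) \<omega> \<and> compatible_val (fst (stage k)) \<omega>)"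
proof (cases k)
  case 0
  interpret T: graded_transport_loc R "carry_ring Base R" Base
    by unfold_locales (rule multi_graded_ungraded[OF cring_O_S], rule transport_Base)
  have "discrete_valuation (carry_ring Base R) (carry_val Base R (monomial_val v)) \<and>
      compatible_val (carry_ring Base R) (carry_val Base R (monomial_val v))" if v: "v \<in> set vs" for v
    using T.discrete_valuation_transport[OF carry_val_Base discrete_valuation_R[OF v]]
      T.compatible_val_transport[OF carry_val_Base compatible_val_ungraded[OF cring_O_S discrete_valuation_R[OF v]]]
    by blast
  thus ?thesis unfolding 0 stage_0 using T.multi_graded_A by auto
next
  case (Suc j)
  have j: "j < length vs" using k Suc by simp
  let ?B = "semigroup_algebra (Gam ls) (take (Suc j) vs)"
  have us: "set (take (Suc j) vs) \<subseteq> set vs" by (rule set_take_subset)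
  obtain \<Phi> where \<Phi>: "graded_transport ?B (fst (stage k)) \<Phi>" "length (snd (stage k)) = length vs"
    "\<And>i p. i < length vs \<Longrightarrow> p \<in> carrier ?B \<Longrightarrow> (snd (stage k) ! i) (\<Phi> p) = algebra_val (vs ! i) p"
    using stage_transport[OF j] unfolding Suc by blast
  interpret T: graded_transport_loc ?B "fst (stage k)" \<Phi>
    by unfold_locales (rule multi_graded_algebra[OF us], rule \<Phi>(1))
  have "discrete_valuation (fst (stage k)) \<omega> \<and> compatible_val (fst (stage k)) \<omega>" if \<omega>: "\<omega> \<in> set (snd (stage k))" for \<omega>
  proof -
    obtain i where i: "i < length vs" "\<omega> = snd (stage k) ! i" using \<omega> \<Phi>(2) by (auto simp: in_set_conv_nth)
    have vi: "vs ! i \<in> set vs" using i(1) by simp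
    show ?thesis unfolding i(2)
      using T.discrete_valuation_transport[OF \<Phi>(3)[OF i(1)] discrete_valuation_algebra[OF vi]]
        T.compatible_val_transport[OF \<Phi>(3)[OF i(1)] compatible_val_algebra[OF us]] by blast
  qed
  thus ?thesis using T.multi_graded_A by blast
qed

lemma multi_gr_iso:
  "\<exists>\<psi>\<in>graded_iso (multi_gr (O_S \<zeta>) (map monomial_val vs)) (semigroup_algebra (Gam ls) vs).
    \<forall>i<length vs. \<forall>x\<in>carrier (multi_gr (O_S \<zeta>) (map monomial_val vs)).
      algebra_val (vs ! i) (\<psi> x) = multi_val (O_S \<zeta>) (map monomial_val vs) i x"
proof -
  let ?B = "semigroup_algebra (Gam ls) vs"
  define A where "A = multi_gr (O_S \<zeta>) (map monomial_val vs)"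
  have A: "A = fst (stage (length vs))" by (simp add: A_def multi_gr_def)
  have j: "length vs - 1 < length vs" "Suc (length vs - 1) = length vs" using nonempty by simp_all
  obtain \<Phi> where \<Phi>: "graded_transport ?B A \<Phi>"
    "\<And>i p. i < length vs \<Longrightarrow> p \<in> carrier ?B \<Longrightarrow> (snd (stage (length vs)) ! i) (\<Phi> p) = algebra_val (vs ! i) p"
    using stage_transport[OF j(1)] unfolding j(2) A by auto
  interpret T: graded_transport_loc ?B A \<Phi>
    by unfold_locales (rule multi_graded_algebra[OF order_refl], rule \<Phi>(1))
  \<comment> \<open>The stages were parametrised by the semigroup algebra; the isomorphism wanted
    goes the other way.\<close>
  define \<psi> where "\<psi> = inv_into (carrier ?B) \<Phi>"
  have inv: "\<psi> (\<Phi> p) = p" if "p \<in> carrier ?B" for p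
    using that T.bij by (simp add: \<psi>_def bij_betw_def)
  have hom: "\<psi> \<in> ring_hom A ?B"
  proof (rule ring_hom_memI)
    fix x y assume "x \<in> carrier A" "y \<in> carrier A"
    then obtain p q where pq: "p \<in> carrier ?B" "x = \<Phi> p" "q \<in> carrier ?B" "y = \<Phi> q" unfolding T.carrier_A by blast
    show "\<psi> x \<in> carrier ?B" using pq inv by simp
    show "\<psi> (x \<otimes>\<^bsub>A\<^esub> y) = \<psi> x \<otimes>\<^bsub>?B\<^esub> \<psi> y"
      unfolding pq(2,4) T.mult[OF pq(1,3), symmetric] inv[OF pq(1)] inv[OF pq(3)] by (rule inv[OF T.B.m_closed[OF pq(1,3)]])
    show "\<psi> (x \<oplus>\<^bsub>A\<^esub> y) = \<psi> x \<oplus>\<^bsub>?B\<^esub> \<psi> y"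
      unfolding pq(2,4) T.add[OF pq(1,3), symmetric] inv[OF pq(1)] inv[OF pq(3)] by (rule inv[OF T.B.a_closed[OF pq(1,3)]])
  next
    show "\<psi> \<one>\<^bsub>A\<^esub> = \<one>\<^bsub>?B\<^esub>" using inv[OF T.B.one_closed] T.one by simp
  qed
  have "\<psi> ` component A a = component ?B a" if a: "length a = grank A" for a
  proof -
    have aB: "length a = grank ?B" using a by (simp add: T.grank)
    have "\<psi> ` component A a = (\<lambda>p. p) ` component ?B a"
      unfolding T.comp[OF aB] image_image using inv T.component_subset[OF aB] by (intro image_cong refl) blast
    thus ?thesis by simp
  qed
  hence "\<psi> \<in> graded_iso A ?B"
    unfolding graded_iso_def ring_iso_def using hom bij_betw_inv_into[OF T.bij] T.grank by (simp add: \<psi>_def)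
  moreover have "algebra_val (vs ! i) (\<psi> x) = multi_val (O_S \<zeta>) (map monomial_val vs) i x"
    if i: "i < length vs" and x: "x \<in> carrier A" for i x
  proof -
    obtain p where p: "p \<in> carrier ?B" "x = \<Phi> p" using x unfolding T.carrier_A by blast
    show ?thesis unfolding p(2) inv[OF p(1)] multi_val_def using \<Phi>(2)[OF i p(1)] by simp
  qed
  ultimately show ?thesis unfolding A_def by blast
qed

end

theorem proposition4p6:
  fixes f :: "('d::{finite,linorder}) puiseux poly"
    and \<zeta> :: "'d puiseux"
    and ls vs :: "(rat ^ 'd::{finite,linorder}) list"
  assumes "quasi_ordinary f"
    and "characteristic_exponents f ls"
    and "normalized ls"
    and "poly f \<zeta> = 0"
    and "vs \<noteq> []"
    and "\<forall>v\<in>set vs. v \<noteq> 0 \<and> v \<in> sigma \<inter> dual_lattice (lattice_of ls)"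
    and "centered_at_max (O_S \<zeta>) (monomial_val (hd vs))"
  shows
    "(\<forall>k\<le>length vs. \<forall>A \<omega>s. iterated_gr (O_S \<zeta>) (map monomial_val vs) k = (A, \<omega>s) \<longrightarrow>
        multi_graded A \<and> (\<forall>\<omega>\<in>set \<omega>s. discrete_valuation A \<omega> \<and> compatible_val A \<omega>)) \<and>
     (\<exists>\<psi>\<in>graded_iso (multi_gr (O_S \<zeta>) (map monomial_val vs)) (semigroup_algebra (Gam ls) vs).
        \<forall>i<length vs. \<forall>x\<in>carrier (multi_gr (O_S \<zeta>) (map monomial_val vs)).
          algebra_val (vs ! i) (\<psi> x) = multi_val (O_S \<zeta>) (map monomial_val vs) i x)"
proof -
  interpret valued_branch \<zeta> ls vs
  proof
    show "sorted_wrt (<) ls" using assms(2) by (simp add: characteristic_exponents_def)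
    show "\<exists>l\<in>set ls. least (\<zeta> - act t \<zeta>) l" if "t \<in> integral_points" "act t \<zeta> \<noteq> \<zeta>" for t
      by (rule conjugate_differences(1)[OF assms(1,2,4) that])
    show "\<exists>t\<in>integral_points. least (\<zeta> - act t \<zeta>) l" if "l \<in> set ls" for l
      by (rule conjugate_differences(2)[OF assms(1,2,4) that])
    show "\<forall>i. 0 < hd vs $ i" by (rule centered_imp_interior[OF assms(7)])
  qed (use assms(5,6) in auto)
  show ?thesis using stage_valuations multi_gr_iso by (metis fst_conv snd_conv)
qed

end
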